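(* Assume that the inclusion problem (P): find $x\in\mathcal H$ with $0\in Ax+PB(Rx)+N_{\Omega_b}(x)$, has at least one solution, and assume the following. (A) (i) $A$ is $(U,V)$-semimonotone, with $U,V\in\mathcal B(\mathcal H)$ self-adjoint; (ii) $B$ is $W^{-1}$-cocoercive, with $W\in\mathcal B(\mathcal K)$ self-adjoint and strongly monotone; (iii) $\Omega\subseteq\ker(P^*-R)$; (iv) $M$ has closed range, i.e. $\operatorname{ran}(M)=\Omega^\perp$. (B) (i) $L(\Omega)\subseteq\Omega^\perp$ and $L\bar x-q\in\Omega^\perp$ for some $\bar x\in\Omega_b$; (ii) $L_s=\frac12(L+L^* )$ satisfies $\ker(L_s)=\Omega$ and $L_s$ is strongly monotone on $\Omega^\perp$. (C) (i) Either $U=0$ or $U_{11}$ is strongly monotone; (ii) one of the following holds. Case I: $V=0$ (and $B$ may be nonzero). Case II: $B=0$, $V_{22}\succeq0$, $\operatorname{ran}(V_{22})$ is closed, and $\operatorname{ran}(V_{21})\subseteq\operatorname{ran}(V_{22})$. Let $X=U/U_{11}$, and for $\gamma>0$ let $\Theta_\gamma=\frac{\gamma}{4}(P-R^* )W(P^*-R)$ in Case I, $\Theta_\gamma=-\frac1\gamma L^*(V/V_{22})L$ in Case II, and $\widehat\Xi_\gamma=L_s-\Theta_\gamma+\gamma X$. Let $$\Gamma=\left\{\gamma>0:\ \lambda_{\max}\!\left((L_s^{1/2})^\dagger(\Theta_\gamma-\gamma X)(L_s^{1/2})^\dagger\right)<1\right\}.$$ Fix $\gamma\in\Lambda\cap\Gamma$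 and let $\beta_\gamma=\left\|(\widehat\Xi_\gamma^{1/2})^\dagger M\right\|^{-2}$. Let $z^0\in\mathcal H'$, let $\lambda_k\in[0,2\beta_\gamma]$ (with $\lambda_k<+\infty$) satisfy $\sum_{k=0}^\infty\lambda_k(2\beta_\gamma-\lambda_k)=+\infty$, and let $\{x^k\}\subset\mathcal H$, $\{z^k\}\subset\mathcal H'$ be generated by $$x^k=\Phi_\gamma(Mz^k),\qquad z^{k+1}=z^k-\lambda_k(M^*x^k-b),\qquad k\in\mathbb N.$$ Then: (i) $\{z^k\}$ is bounded and converges weakly to some point $z^*\in\operatorname{zer}(\Psi_\gamma)$. Moreover, $\Psi_\gamma(z^k)=M^*x^k-b\to0$ strongly. (ii) If $A$ is maximally $V$-comonotone, $U=0$, and $\{x^k\}$ is bounded, then there exists a solution $x^*$ of (P) such that $x^k\rightharpoonup x^*$. (iii) If $U$ is strongly monotone on $\Omega$, then there exists a solution $x^*$ of (P) such that $x^k\to x^*$ strongly.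
   Context: All Hilbert spaces are real. $\mathcal B(\mathcal X,\mathcal Y)$ is the set of bounded linear operators, $\mathcal B(\mathcal X)=\mathcal B(\mathcal X,\mathcal X)$; $T^*$ is the adjoint and $T^\dagger$ the Moore–Penrose inverse. $T\succeq0$ means $\langle Tx,x\rangle\ge0$ for all $x$. $T$ is strongly monotone on a set $D$ if there is $\alpha>0$ with $\langle Tx,x\rangle\ge\alpha\|x\|^2$ for all $x\in D$ ("strongly monotone" alone: $D$ is the whole space). For self-adjoint $T$, $\lambda_{\max}(T)=\sup_{\|x\|=1}\langle Tx,x\rangle$. $\rightharpoonup$ is weak convergence. Convention: $a/0=+\infty$ for $a>0$. $\operatorname{zer}(F)=\{x:0\in F(x)\}$. Semimonotonicity: for self-adjoint $U,V\in\mathcal B(\mathcal H)$, a set-valued $A:\mathcal H\rightrightarrows\mathcal H$ is $(U,V)$-semimonotone if $\langle x-x',y-y'\rangle\ge\langle x-x',U(x-x')\rangle+\langle y-y',V(y-y')\rangle$ for all $(x,y),(x',y')\in\operatorname{gra}A$; maximally so if no $(U,V)$-semimonotone operator has a strictly larger graph. $V$-comonotone means $(0,V)$-semimonotone. For $W$ self-adjoint and strongly monotone, $B:\mathcal K\to\mathcal K$ is $W^{-1}$-cocoercive if $\langle x-x',Bx-Bx'\rangle\ge\langle Bx-Bx',W^{-1}(Bx-Bx')\rangle$ for all $x,x'$. Setting: $\mathcal H,\mathcal K,\mathcal H'$ are real Hilbert spaces; $A:\mathcal H\rightrightarrows\mathcal H$; $B:\mathcal K\to\mathcal K$ single-valued;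 $P\in\mathcal B(\mathcal K,\mathcal H)$; $R\in\mathcal B(\mathcal H,\mathcal K)$; $M\in\mathcal B(\mathcal H',\mathcal H)$; $b\in\mathcal H'$; $\Omega=\ker(M^* )$; $\Omega_b=\{x\in\mathcal H:M^*x=b\}$; $N_{\Omega_b}$ is its normal cone ($N_{\Omega_b}(x)=\Omega^\perp$ if $x\in\Omega_b$, $\varnothing$ otherwise). $L\in\mathcal B(\mathcal H)$ and $q\in\mathcal H$. For $\gamma>0$: $\Phi_\gamma(w)=(\gamma A+\gamma PBR+L)^{-1}(w+q)$ for $w\in\Omega^\perp$ (a set in general, i.e. all $x$ with $w+q\in\gamma Ax+\gamma PB(Rx)+Lx$), and $\Psi_\gamma(z)=M^*\Phi_\gamma(Mz)-b$ for $z\in\mathcal H'$. $\Lambda$ is the set of $\gamma>0$ such that $\Phi_\gamma(w)$ is nonempty and single-valued for every $w\in\Omega^\perp$. Blocks: with $\Pi_\Omega$, $\Pi_{\Omega^\perp}$ the orthogonal projectors, for $T\in\mathcal B(\mathcal H)$: $T_{11}=\Pi_\Omega T\Pi_\Omega$, $T_{12}=\Pi_\Omega T\Pi_{\Omega^\perp}$, $T_{21}=\Pi_{\Omega^\perp}T\Pi_\Omega$, $T_{22}=\Pi_{\Omega^\perp}T\Pi_{\Omega^\perp}$. Properties of $T_{11}$ (resp. $T_{22}$) such as strong monotonicity or invertibility are understood on $\Omega$ (resp. $\Omega^\perp$), and their inverses/Moore–Penrose inverses are extended by zero to $\mathcal H$. Generalized Schur complements: $T/T_{11}=T_{22}-T_{21}T_{11}^\dagger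 T_{12}$ and $T/T_{22}=T_{11}-T_{12}T_{22}^\dagger T_{21}$. *)

theory Defs
  imports "HOL-Analysis.Analysis"
begin

section \<open>Bounded operators between real Hilbert spaces\<close>

text \<open>
  A real Hilbert space is a type of sort \<open>{real_inner, complete_space}\<close>, and
  bounded linear operators are the elements of \<open>'a \<Rightarrow>\<^sub>L 'b\<close>, whose norm is the operator norm.
\<close>

definition adj :: "('a::real_inner \<Rightarrow>\<^sub>L 'b::real_inner) \<Rightarrow> 'b \<Rightarrow>\<^sub>L 'a" where
  "adj T = Blinfun (adjoint (blinfun_apply T))"

definition selfadjoint :: "('a::real_inner \<Rightarrow>\<^sub>L 'a) \<Rightarrow> bool" where
  "selfadjoint T \<longleftrightarrow> adj T = T"

definition positive_op :: "('a::real_inner \<Rightarrow>\<^sub>L 'a) \<Rightarrow> bool" where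
  "positive_op T \<longleftrightarrow> (\<forall>x. T x \<bullet> x \<ge> 0)"

definition strongly_monotone_on :: "'a set \<Rightarrow> ('a::real_inner \<Rightarrow>\<^sub>L 'a) \<Rightarrow> bool" where
  "strongly_monotone_on D T \<longleftrightarrow> (\<exists>\<alpha>>0. \<forall>x\<in>D. T x \<bullet> x \<ge> \<alpha> * (norm x)\<^sup>2)"

definition ker :: "('a::real_normed_vector \<Rightarrow>\<^sub>L 'b::real_normed_vector) \<Rightarrow> 'a set" where
  "ker T = {x. T x = 0}"

text \<open>The orthogonal projector; it exists (uniquely) when \<open>S\<close> is a closed subspace.\<close>

definition proj :: "'a::real_inner set \<Rightarrow> 'a \<Rightarrow>\<^sub>L 'a" where
  "proj S = (THE p :: 'a \<Rightarrow>\<^sub>L 'a. \<forall>x. p x \<in> S \<and> x - p x \<in> S\<^sup>\<bottom>)"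

text \<open>
  The Moore--Penrose inverse, given by the four Penrose equations; a bounded solution exists
  (and is then unique) exactly when \<open>T\<close> has closed range.
\<close>

definition mp_inverse :: "('a::real_inner \<Rightarrow>\<^sub>L 'b::real_inner) \<Rightarrow> 'b \<Rightarrow>\<^sub>L 'a" where
  "mp_inverse T = (THE S.
     T o\<^sub>L S o\<^sub>L T = T \<and> S o\<^sub>L T o\<^sub>L S = S \<and>
     selfadjoint (T o\<^sub>L S) \<and> selfadjoint (S o\<^sub>L T))"

text \<open>The positive square root of a positive self-adjoint operator.\<close>

definition sqrt_op :: "('a::real_inner \<Rightarrow>\<^sub>L 'a) \<Rightarrow> 'a \<Rightarrow>\<^sub>L 'a" where
  "sqrt_op T = (THE S. selfadjoint S \<and> positive_op S \<and> S o\<^sub>L S = T)"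

text \<open>Extended real valued, so that the supremum over the empty unit sphere of the zero
  space is \<open>-\<infinity>\<close> rather than an unspecified real.\<close>

definition lambda_max :: "('a::real_inner \<Rightarrow>\<^sub>L 'a) \<Rightarrow> ereal" where
  "lambda_max T = (SUP x\<in>sphere 0 1. ereal (T x \<bullet> x))"

definition symm_part :: "('a::real_inner \<Rightarrow>\<^sub>L 'a) \<Rightarrow> 'a \<Rightarrow>\<^sub>L 'a" where
  "symm_part L = (1/2) *\<^sub>R (L + adj L)"

definition weakly_converges :: "(nat \<Rightarrow> 'a::real_inner) \<Rightarrow> 'a \<Rightarrow> bool" where
  "weakly_converges u l \<longleftrightarrow> (\<forall>y. (\<lambda>k. u k \<bullet> y) \<longlonglongrightarrow> l \<bullet> y)"

section \<open>Blocks and generalized Schur complements\<close>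

text \<open>
  With respect to \<open>\<Omega>\<close>, the blocks are operators on the whole space that vanish on the
  complementary subspace. Hence the Moore--Penrose inverse of a diagonal block, taken on the
  whole space, is the one taken on \<open>\<Omega>\<close> (or its complement), extended by zero.
\<close>

definition blk11 :: "'a::real_inner set \<Rightarrow> ('a \<Rightarrow>\<^sub>L 'a) \<Rightarrow> 'a \<Rightarrow>\<^sub>L 'a" where
  "blk11 \<Omega> T = proj \<Omega> o\<^sub>L T o\<^sub>L proj \<Omega>"

definition blk12 :: "'a::real_inner set \<Rightarrow> ('a \<Rightarrow>\<^sub>L 'a) \<Rightarrow> 'a \<Rightarrow>\<^sub>L 'a" where
  "blk12 \<Omega> T = proj \<Omega> o\<^sub>L T o\<^sub>L proj (\<Omega>\<^sup>\<bottom>)"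

definition blk21 :: "'a::real_inner set \<Rightarrow> ('a \<Rightarrow>\<^sub>L 'a) \<Rightarrow> 'a \<Rightarrow>\<^sub>L 'a" where
  "blk21 \<Omega> T = proj (\<Omega>\<^sup>\<bottom>) o\<^sub>L T o\<^sub>L proj \<Omega>"

definition blk22 :: "'a::real_inner set \<Rightarrow> ('a \<Rightarrow>\<^sub>L 'a) \<Rightarrow> 'a \<Rightarrow>\<^sub>L 'a" where
  "blk22 \<Omega> T = proj (\<Omega>\<^sup>\<bottom>) o\<^sub>L T o\<^sub>L proj (\<Omega>\<^sup>\<bottom>)"

definition schur11 :: "'a::real_inner set \<Rightarrow> ('a \<Rightarrow>\<^sub>L 'a) \<Rightarrow> 'a \<Rightarrow>\<^sub>L 'a" where
  "schur11 \<Omega> T = blk22 \<Omega> T - (blk21 \<Omega> T o\<^sub>L mp_inverse (blk11 \<Omega> T) o\<^sub>L blk12 \<Omega> T)"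

definition schur22 :: "'a::real_inner set \<Rightarrow> ('a \<Rightarrow>\<^sub>L 'a) \<Rightarrow> 'a \<Rightarrow>\<^sub>L 'a" where
  "schur22 \<Omega> T = blk11 \<Omega> T - (blk12 \<Omega> T o\<^sub>L mp_inverse (blk22 \<Omega> T) o\<^sub>L blk21 \<Omega> T)"

section \<open>Set-valued operators\<close>

definition gra :: "('a \<Rightarrow> 'b set) \<Rightarrow> ('a \<times> 'b) set" where
  "gra F = {(x, y). y \<in> F x}"

definition zer :: "('a \<Rightarrow> 'b::zero set) \<Rightarrow> 'a set" where
  "zer F = {x. 0 \<in> F x}"

definition semimonotone ::
    "('a::real_inner \<Rightarrow>\<^sub>L 'a) \<Rightarrow> ('a \<Rightarrow>\<^sub>L 'a) \<Rightarrow> ('a \<Rightarrow> 'a set) \<Rightarrow> bool" where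
  "semimonotone U V A \<longleftrightarrow> (\<forall>(x, y) \<in> gra A. \<forall>(x', y') \<in> gra A.
     (x - x') \<bullet> (y - y') \<ge> (x - x') \<bullet> U (x - x') + (y - y') \<bullet> V (y - y'))"

definition maximally_semimonotone ::
    "('a::real_inner \<Rightarrow>\<^sub>L 'a) \<Rightarrow> ('a \<Rightarrow>\<^sub>L 'a) \<Rightarrow> ('a \<Rightarrow> 'a set) \<Rightarrow> bool" where
  "maximally_semimonotone U V A \<longleftrightarrow>
     semimonotone U V A \<and> (\<nexists>A'. semimonotone U V A' \<and> gra A \<subset> gra A')"

abbreviation maximally_comonotone ::
    "('a::real_inner \<Rightarrow>\<^sub>L 'a) \<Rightarrow> ('a \<Rightarrow> 'a set) \<Rightarrow> bool" where
  "maximally_comonotone V A \<equiv> maximally_semimonotone 0 V A"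

text \<open>\<open>W\<^sup>-\<^sup>1\<close>-cocoercivity; \<open>W\<close> is bijective when it is self-adjoint and strongly monotone.\<close>

definition inv_cocoercive :: "('a::real_inner \<Rightarrow>\<^sub>L 'a) \<Rightarrow> ('a \<Rightarrow> 'a) \<Rightarrow> bool" where
  "inv_cocoercive W B \<longleftrightarrow> (\<forall>x x'.
     (x - x') \<bullet> (B x - B x') \<ge> (B x - B x') \<bullet> inv (blinfun_apply W) (B x - B x'))"

definition normal_cone :: "'a::real_inner set \<Rightarrow> 'a \<Rightarrow> 'a set" where
  "normal_cone C x = {u. x \<in> C \<and> (\<forall>y\<in>C. u \<bullet> (y - x) \<le> 0)}"

lemma normal_cone_affine:
  fixes T :: "'a::real_inner \<Rightarrow>\<^sub>L 'b::real_normed_vector"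
  shows "normal_cone {x. T x = b} x = (if T x = b then (ker T)\<^sup>\<bottom> else {})"
proof (cases "T x = b")
  case True
  have "(\<forall>y\<in>{x. T x = b}. u \<bullet> (y - x) \<le> 0) \<longleftrightarrow> u \<in> (ker T)\<^sup>\<bottom>" (is "?l \<longleftrightarrow> ?r") for u
  proof
    assume l: ?l
    have "v \<bullet> u = 0" if "T v = 0" for v
    proof -
      have "x + v \<in> {x. T x = b}" "x - v \<in> {x. T x = b}"
        using that True by (simp_all add: blinfun.add_right blinfun.diff_right)
      then have "u \<bullet> (x + v - x) \<le> 0" "u \<bullet> (x - v - x) \<le> 0"
        using l by blast+
      then show ?thesis by (simp add: inner_commute)
    qed
    then show ?r by (simp add: orthogonal_comp_def ker_def orthogonal_def)
  next
    assume r: ?r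
    show ?l
    proof
      fix y assume "y \<in> {x. T x = b}"
      then have "y - x \<in> ker T" using True by (simp add: ker_def blinfun.diff_right)
      then have "(y - x) \<bullet> u = 0" using r by (simp add: orthogonal_comp_def orthogonal_def)
      then show "u \<bullet> (y - x) \<le> 0" by (simp add: inner_commute)
    qed
  qed
  then show ?thesis using True by (auto simp: normal_cone_def)
qed (simp add: normal_cone_def)

section \<open>The inclusion problem and its warped resolvent\<close>

text \<open>The operator \<open>A + P B R + N\<close>, where \<open>N\<close> is the normal cone of \<open>{x. M\<^sup>* x = b}\<close>.\<close>

definition incl_op ::
    "('h::real_inner \<Rightarrow> 'h set) \<Rightarrow> ('k::real_inner \<Rightarrow> 'k) \<Rightarrow> ('k \<Rightarrow>\<^sub>L 'h) \<Rightarrow> ('h \<Rightarrow>\<^sub>L 'k) \<Rightarrow>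
     ('g::real_inner \<Rightarrow>\<^sub>L 'h) \<Rightarrow> 'g \<Rightarrow> 'h \<Rightarrow> 'h set" where
  "incl_op A B P R M b x =
     {a + P (B (R x)) + n | a n. a \<in> A x \<and> n \<in> normal_cone {x. adj M x = b} x}"

definition Phi ::
    "('h::real_inner \<Rightarrow> 'h set) \<Rightarrow> ('k::real_inner \<Rightarrow> 'k) \<Rightarrow> ('k \<Rightarrow>\<^sub>L 'h) \<Rightarrow> ('h \<Rightarrow>\<^sub>L 'k) \<Rightarrow>
     ('h \<Rightarrow>\<^sub>L 'h) \<Rightarrow> 'h \<Rightarrow> real \<Rightarrow> 'h \<Rightarrow> 'h set" where
  "Phi A B P R L q \<gamma> w = {x. \<exists>a\<in>A x. w + q = \<gamma> *\<^sub>R a + \<gamma> *\<^sub>R P (B (R x)) + L x}"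

definition Psi ::
    "('h::real_inner \<Rightarrow> 'h set) \<Rightarrow> ('k::real_inner \<Rightarrow> 'k) \<Rightarrow> ('k \<Rightarrow>\<^sub>L 'h) \<Rightarrow> ('h \<Rightarrow>\<^sub>L 'k) \<Rightarrow>
     ('h \<Rightarrow>\<^sub>L 'h) \<Rightarrow> 'h \<Rightarrow> ('g::real_inner \<Rightarrow>\<^sub>L 'h) \<Rightarrow> 'g \<Rightarrow> real \<Rightarrow> 'g \<Rightarrow> 'g set" where
  "Psi A B P R L q M b \<gamma> z = {adj M x - b | x. x \<in> Phi A B P R L q \<gamma> (M z)}"

definition Lambda_set ::
    "('h::real_inner \<Rightarrow> 'h set) \<Rightarrow> ('k::real_inner \<Rightarrow> 'k) \<Rightarrow> ('k \<Rightarrow>\<^sub>L 'h) \<Rightarrow> ('h \<Rightarrow>\<^sub>L 'k) \<Rightarrow>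
     ('h \<Rightarrow>\<^sub>L 'h) \<Rightarrow> 'h \<Rightarrow> 'h set \<Rightarrow> real set" where
  "Lambda_set A B P R L q \<Omega> = {\<gamma>. \<gamma> > 0 \<and> (\<forall>w\<in>\<Omega>\<^sup>\<bottom>. \<exists>!x. x \<in> Phi A B P R L q \<gamma> w)}"

definition Theta_I ::
    "('k::real_inner \<Rightarrow>\<^sub>L 'h::real_inner) \<Rightarrow> ('h \<Rightarrow>\<^sub>L 'k) \<Rightarrow> ('k \<Rightarrow>\<^sub>L 'k) \<Rightarrow> real \<Rightarrow> 'h \<Rightarrow>\<^sub>L 'h" where
  "Theta_I P R W \<gamma> = (\<gamma> / 4) *\<^sub>R ((P - adj R) o\<^sub>L W o\<^sub>L (adj P - R))"

definition Theta_II ::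
    "'h::real_inner set \<Rightarrow> ('h \<Rightarrow>\<^sub>L 'h) \<Rightarrow> ('h \<Rightarrow>\<^sub>L 'h) \<Rightarrow> real \<Rightarrow> 'h \<Rightarrow>\<^sub>L 'h" where
  "Theta_II \<Omega> L V \<gamma> = - ((1 / \<gamma>) *\<^sub>R (adj L o\<^sub>L schur22 \<Omega> V o\<^sub>L L))"

definition Xi_hat ::
    "('h::real_inner \<Rightarrow>\<^sub>L 'h) \<Rightarrow> (real \<Rightarrow> 'h \<Rightarrow>\<^sub>L 'h) \<Rightarrow> ('h \<Rightarrow>\<^sub>L 'h) \<Rightarrow> real \<Rightarrow> 'h \<Rightarrow>\<^sub>L 'h" where
  "Xi_hat L \<Theta> X \<gamma> = symm_part L - \<Theta> \<gamma> + \<gamma> *\<^sub>R X"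

definition Gamma_set ::
    "('h::real_inner \<Rightarrow>\<^sub>L 'h) \<Rightarrow> (real \<Rightarrow> 'h \<Rightarrow>\<^sub>L 'h) \<Rightarrow> ('h \<Rightarrow>\<^sub>L 'h) \<Rightarrow> real set" where
  "Gamma_set L \<Theta> X = {\<gamma>. \<gamma> > 0 \<and>
     lambda_max (mp_inverse (sqrt_op (symm_part L)) o\<^sub>L (\<Theta> \<gamma> - \<gamma> *\<^sub>R X)
       o\<^sub>L mp_inverse (sqrt_op (symm_part L))) < 1}"

text \<open>Division in \<open>ereal\<close> gives \<open>1 / 0 = \<infinity>\<close>; this occurs when \<open>M = 0\<close>.\<close>

definition step_bound ::
    "('h::real_inner \<Rightarrow>\<^sub>L 'h) \<Rightarrow> ('g::real_inner \<Rightarrow>\<^sub>L 'h) \<Rightarrow> ereal" where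
  "step_bound \<Xi> M = 1 / (ereal (norm (mp_inverse (sqrt_op \<Xi>) o\<^sub>L M)))\<^sup>2"

end

theory Submission
  imports Defs "HOL-Library.Diagonal_Subsequence"
begin

text \<open>
The iteration is a relaxed forward iteration for the residual \<open>F z = M\<^sup>* \<Phi>(M z) - b\<close> on the dual
space, so everything rests on \<open>F\<close> being cocoercive with exactly the constant that bounds the
step sizes.

Write \<open>\<Omega> = ker M\<^sup>*\<close>, take two dual points \<open>z\<close>, \<open>z'\<close> and let \<open>\<delta>\<close> be the difference of the primal
points \<open>\<Phi>(M z)\<close>, \<open>\<Phi>(M z')\<close>. Pairing the two inclusions that define these points with \<open>\<delta>\<close> gives
\<open>\<langle>z - z', F z - F z'\<rangle> \<ge> \<gamma>\<langle>U\<delta>, \<delta>\<rangle> + \<langle>(L\<^sub>s - \<Theta>)\<delta>, \<delta>\<rangle>\<close>. The operator \<open>\<Theta>\<close> is the price of the terms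
without a sign. When \<open>V = 0\<close> it comes from completing the square in the cocoercivity inequality
of \<open>B\<close> (\<open>monotone_estimate_cocoercive\<close>). When \<open>B = 0\<close> it comes from minimising the form of \<open>V\<close>
over the \<open>\<Omega>\<^sup>\<bottom>\<close> component of the difference of the values of \<open>A\<close>, whose \<open>\<Omega>\<close> component is
dictated by \<open>L\<delta>\<close> (\<open>monotone_estimate_semimonotone\<close>). Minimising the form of \<open>U\<close> over the \<open>\<Omega>\<close>
component of \<open>\<delta>\<close> replaces \<open>U\<close> by its Schur complement, so the right-hand side is at least
\<open>\<langle>\<Xi>\<delta>, \<delta>\<rangle> = \<parallel>\<Xi>\<^sup>1\<^sup>/\<^sup>2\<delta>\<parallel>\<^sup>2\<close>. The condition on \<open>\<lambda>\<^sub>m\<^sub>a\<^sub>x\<close> says that \<open>\<Xi>\<close> dominates a positive multiple of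
\<open>L\<^sub>s\<close>, hence is strongly monotone on \<open>\<Omega>\<^sup>\<bottom>\<close>; and \<open>\<parallel>M\<^sup>*\<delta>\<parallel> \<le> N \<parallel>\<Xi>\<^sup>1\<^sup>/\<^sup>2\<delta>\<parallel>\<close> with \<open>N\<close> the norm of the
operator in the step bound. This is \<open>residual_cocoercive\<close>.

For a cocoercive operator the distances to its zeros decrease along the iteration, the norm of
the residual decreases, and the divergence of \<open>\<Sum>\<lambda>\<^sub>k(2\<beta> - \<lambda>\<^sub>k)\<close> forces it to \<open>0\<close>; Opial's argument
then yields weak convergence to a zero (\<open>cocoercive_forward_iteration\<close>). Zeros of \<open>F\<close> correspond
to solutions of the inclusion through \<open>x = \<Phi>(M z)\<close>.

For the primal sequence, the pairing \<open>\<langle>z\<^sup>k - z\<^sup>*, F z\<^sup>k - F z\<^sup>*\<rangle>\<close> tends to \<open>0\<close>, so by strong monotonicity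
of \<open>\<Xi>\<close> the \<open>\<Omega>\<^sup>\<bottom>\<close> component of \<open>x\<^sup>k - \<Phi>(M z\<^sup>*)\<close> tends to \<open>0\<close> strongly. If \<open>U\<close> is strongly monotone on
\<open>\<Omega>\<close>, the same inequality controls the remaining component (\<open>strong_convergence\<close>). If instead \<open>A\<close> is
maximally comonotone, this partial strong convergence is what makes the pairing of \<open>x\<^sup>k\<close> with
the values of \<open>A\<close> pass to the weak limit, so that maximality identifies every weak cluster point
with the single point \<open>\<Phi>(M z\<^sup>*)\<close> (\<open>weak_convergence\<close>).

The adjoints, projectors, Moore--Penrose inverses and square roots in the statement are given by
descriptions, and they denote what they should because the spaces are complete: Riesz
representation provides the adjoints and projectors, the uniform boundedness principle the bounded
Moore--Penrose inverses (\<open>mp_inverse_selfadjoint\<close>), and a convergent iteration the square roots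
(\<open>sqrt_op_spec\<close>).
\<close>

section \<open>Orthogonal projection, Riesz representation and adjoints\<close>

lemma orthogonal_comp_iff: "x \<in> S\<^sup>\<bottom> \<longleftrightarrow> (\<forall>y\<in>S. x \<bullet> y = 0)"
  by (auto simp: orthogonal_comp_def orthogonal_def inner_commute)

lemma closed_orthogonal_comp: "closed (S\<^sup>\<bottom>)"
proof -
  have "S\<^sup>\<bottom> = (\<Inter>y\<in>S. {x. x \<bullet> y = 0})"
    by (auto simp: orthogonal_comp_iff)
  then show ?thesis
    by (auto intro!: closed_INT closed_Collect_eq continuous_intros)
qed

text \<open>
The parallelogram law in the form that makes minimising sequences Cauchy: for two residuals of
nearly minimal length, the midpoint is again a residual, so it is not shorter than the minimum,
and this forces their difference to be small.
\<close>

lemma parallelogram_midpoint: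
  fixes u v :: "'a::real_inner"
  shows "(norm (u - v))\<^sup>2 = 2 * (norm u)\<^sup>2 + 2 * (norm v)\<^sup>2 - 4 * (norm ((1/2) *\<^sub>R (u + v)))\<^sup>2"
  by (simp add: power_divide power2_norm_eq_inner inner_left_distrib inner_right_distrib
      inner_diff_left inner_diff_right inner_commute add_divide_distrib)

lemma closest_point_closed_subspace:
  fixes x :: "'a::{real_inner,complete_space}"
  assumes S: "subspace S" "closed S"
  shows "\<exists>p\<in>S. \<forall>y\<in>S. norm (x - p) \<le> norm (x - y)"
proof -
  define d where "d = Inf ((\<lambda>y. (norm (x - y))\<^sup>2) ` S)"
  have ne: "S \<noteq> {}" using S(1) subspace_0 by blast
  have bb: "bdd_below ((\<lambda>y. (norm (x - y))\<^sup>2) ` S)" by (rule bdd_belowI[of _ 0]) auto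
  have d: "d \<le> (norm (x - y))\<^sup>2" if "y \<in> S" for y
    unfolding d_def by (rule cInf_lower[OF _ bb]) (use that in auto)
  have "\<exists>y\<in>S. (norm (x - y))\<^sup>2 < d + 1 / Suc n" for n
  proof -
    have "d < d + 1 / Suc n" by simp
    then show ?thesis
      using cInf_less_iff[OF _ bb, of "d + 1 / Suc n"] ne unfolding d_def by auto
  qed
  then obtain f where f: "\<And>n. f n \<in> S" "\<And>n. (norm (x - f n))\<^sup>2 < d + 1 / Suc n"
    by metis
  have close: "(norm (f m - f n))\<^sup>2 \<le> 4 / Suc k" if "k \<le> m" "k \<le> n" for k m n
  proof -
    have mid: "(1/2) *\<^sub>R (f n + f m) \<in> S"
      using S(1) f(1) subspace_add subspace_scale by blast
    have "x - (1/2) *\<^sub>R (f n + f m) = (1/2) *\<^sub>R ((x - f n) + (x - f m))"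
      by (simp add: algebra_simps flip: scaleR_add_left)
    then have "d \<le> (norm ((1/2) *\<^sub>R ((x - f n) + (x - f m))))\<^sup>2"
      using d[OF mid] by simp
    moreover have "(norm (f m - f n))\<^sup>2 = 2 * (norm (x - f n))\<^sup>2 + 2 * (norm (x - f m))\<^sup>2
        - 4 * (norm ((1/2) *\<^sub>R ((x - f n) + (x - f m))))\<^sup>2"
      using parallelogram_midpoint[of "x - f n" "x - f m"] by simp
    moreover have "1 / Suc m \<le> 1 / real (Suc k)" "1 / Suc n \<le> 1 / real (Suc k)"
      using that by (simp_all add: frac_le)
    ultimately show ?thesis
      using f(2)[of m] f(2)[of n] by simp
  qed
  have "Cauchy f"
  proof (rule metric_CauchyI)
    fix e :: real assume e: "e > 0"
    obtain k where k: "4 / e\<^sup>2 < real k" using reals_Archimedean2 by blast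
    have "4 / Suc k < e\<^sup>2"
      using k e by (simp add: field_simps) (smt (verit) zero_less_power)
    have "dist (f m) (f n) < e" if "k \<le> m" "k \<le> n" for m n
      using close[OF that] \<open>4 / Suc k < e\<^sup>2\<close> e
      by (simp add: dist_norm) (smt (verit) power_mono)
    then show "\<exists>M. \<forall>m\<ge>M. \<forall>n\<ge>M. dist (f m) (f n) < e" by blast
  qed
  then obtain p where p: "f \<longlonglongrightarrow> p" using Cauchy_convergent convergent_def by blast
  have pS: "p \<in> S" using S(2) closed_sequential_limits f(1) p by blast
  have "(norm (x - p))\<^sup>2 \<le> d"
  proof (rule LIMSEQ_le)
    show "(\<lambda>n. (norm (x - f n))\<^sup>2) \<longlonglongrightarrow> (norm (x - p))\<^sup>2" using p by (intro tendsto_intros)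
    have "(\<lambda>n. 1 / real (Suc n)) \<longlonglongrightarrow> 0" using LIMSEQ_Suc[OF lim_1_over_n] .
    from tendsto_add[OF tendsto_const[of d] this]
    show "(\<lambda>n. d + 1 / Suc n) \<longlonglongrightarrow> d" by simp
    show "\<exists>N. \<forall>n\<ge>N. (norm (x - f n))\<^sup>2 \<le> d + 1 / Suc n" using f(2) less_imp_le by blast
  qed
  then have "\<forall>y\<in>S. norm (x - p) \<le> norm (x - y)"
    using d by (meson norm_ge_zero order_trans power2_le_imp_le)
  then show ?thesis using pS by blast
qed

text \<open>
The residual of a closest point is orthogonal to the subspace, because any component along the
subspace could be used to come closer.
\<close>

lemma orthogonal_decomposition:
  fixes x :: "'a::{real_inner,complete_space}"
  assumes S: "subspace S" "closed S"
  obtains p where "p \<in> S" "x - p \<in> S\<^sup>\<bottom>"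
proof -
  obtain p where p: "p \<in> S" "\<And>y. y \<in> S \<Longrightarrow> norm (x - p) \<le> norm (x - y)"
    using closest_point_closed_subspace[OF S] by blast
  have "(x - p) \<bullet> y = 0" if y: "y \<in> S" for y
  proof (cases "y = 0")
    case False
    \<comment> \<open>moving \<open>p\<close> by the optimal multiple of \<open>y\<close> must not bring it closer to \<open>x\<close>\<close>
    define t where "t = ((x - p) \<bullet> y) / (y \<bullet> y)"
    have yy: "y \<bullet> y > 0" using False by simp
    have "p + t *\<^sub>R y \<in> S" using S(1) p(1) y subspace_add subspace_scale by blast
    then have "(norm (x - p))\<^sup>2 \<le> (norm (x - (p + t *\<^sub>R y)))\<^sup>2"
      using p(2) by (simp add: power_mono)
    also have "\<dots> = (norm (x - p))\<^sup>2 - 2 * t * ((x - p) \<bullet> y) + t\<^sup>2 * (y \<bullet> y)"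
      unfolding power2_norm_eq_inner
      by (simp add: inner_diff_left inner_diff_right inner_add_left inner_add_right
          inner_commute algebra_simps power2_eq_square)
    also have "\<dots> = (norm (x - p))\<^sup>2 - ((x - p) \<bullet> y)\<^sup>2 / (y \<bullet> y)"
      using yy by (simp add: t_def power2_eq_square)
    finally have "((x - p) \<bullet> y)\<^sup>2 / (y \<bullet> y) \<le> 0" by simp
    then show ?thesis using yy
      by (simp add: divide_le_0_iff)
  qed simp
  then have "x - p \<in> S\<^sup>\<bottom>" by (simp add: orthogonal_comp_iff)
  then show ?thesis using p(1) that by blast
qed

lemma orthogonal_comp_comp:
  fixes S :: "'a::{real_inner,complete_space} set"
  assumes "subspace S" "closed S"
  shows "S\<^sup>\<bottom>\<^sup>\<bottom> = S"
proof
  show "S\<^sup>\<bottom>\<^sup>\<bottom> \<subseteq> S"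
  proof
    fix x assume x: "x \<in> S\<^sup>\<bottom>\<^sup>\<bottom>"
    obtain p where p: "p \<in> S" "x - p \<in> S\<^sup>\<bottom>" using orthogonal_decomposition[OF assms] by blast
    have "(x - p) \<bullet> (x - p) = x \<bullet> (x - p) - (x - p) \<bullet> p"
      by (simp add: inner_diff_left inner_diff_right inner_commute)
    also have "\<dots> = 0" using x p by (simp add: orthogonal_comp_iff)
    finally show "x \<in> S" using p(1) by simp
  qed
qed (rule orthogonal_comp_subset)

text \<open>
The kernel of a nonzero functional has a one-dimensional orthogonal complement; a suitable
multiple of a vector spanning it represents the functional.
\<close>

theorem riesz_representation:
  fixes f :: "'a::{real_inner,complete_space} \<Rightarrow> real"
  assumes "bounded_linear f"
  obtains r where "\<And>x. f x = x \<bullet> r"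
proof (cases "\<forall>x. f x = 0")
  case True
  then show ?thesis using that[of 0] by simp
next
  case False
  interpret f: bounded_linear f by fact
  define K where "K = {x. f x = 0}"
  have "subspace K" by (auto simp: K_def subspace_def f.add f.scaleR f.zero)
  moreover have "closed K"
    unfolding K_def by (intro closed_Collect_eq continuous_intros f.continuous_on)
  moreover obtain x0 where x0: "f x0 \<noteq> 0" using False by blast
  ultimately obtain p where p: "p \<in> K" "x0 - p \<in> K\<^sup>\<bottom>"
    using orthogonal_decomposition by metis
  define e where "e = x0 - p"
  have fe: "f e \<noteq> 0" using p(1) x0 by (simp add: e_def K_def f.diff)
  then have ee: "e \<bullet> e \<noteq> 0" using f.zero by auto
  have "f x = x \<bullet> ((f e / (e \<bullet> e)) *\<^sub>R e)" for x
  proof -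
    have "x - (f x / f e) *\<^sub>R e \<in> K" using fe by (simp add: K_def f.diff f.scaleR)
    then have "e \<bullet> (x - (f x / f e) *\<^sub>R e) = 0" using p(2) by (simp add: orthogonal_comp_iff e_def)
    then show ?thesis using fe ee by (simp add: inner_diff_right inner_commute field_simps)
  qed
  then show ?thesis using that by blast
qed

text \<open>
Riesz representation turns \<open>x \<mapsto> T x \<bullet> y\<close> into the vector \<open>adj T y\<close>. Only here is the definition
by an unspecified choice opened; afterwards adjoints are used through this identity.
\<close>

lemma adj_inner:
  fixes T :: "'a::{real_inner,complete_space} \<Rightarrow>\<^sub>L 'b::real_inner"
  shows "x \<bullet> adj T y = T x \<bullet> y"
proof -
  have "\<exists>r. \<forall>x. T x \<bullet> y = x \<bullet> r" for y
    using riesz_representation[of "\<lambda>x. T x \<bullet> y"]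
    by (metis bounded_linear_inner_left_comp blinfun.bounded_linear_right)
  then obtain g where g: "\<And>x y. T x \<bullet> y = x \<bullet> g y" by metis
  have ag: "adjoint (blinfun_apply T) = g" by (rule adjoint_unique) (simp add: g)
  have "bounded_linear g"
  proof (rule bounded_linear_intro[of _ "norm T"])
    show "g (y + z) = g y + g z" for y z
      by (rule vector_eq_rdot[THEN iffD1]) (metis g inner_add_right inner_commute)
    show "g (c *\<^sub>R y) = c *\<^sub>R g y" for c y
      by (rule vector_eq_rdot[THEN iffD1]) (metis g inner_scaleR_right inner_commute)
    show "norm (g y) \<le> norm y * norm T" for y
    proof -
      have "(norm (g y))\<^sup>2 = T (g y) \<bullet> y" by (simp add: g power2_norm_eq_inner)
      also have "\<dots> \<le> norm (T (g y)) * norm y" by (rule norm_cauchy_schwarz)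
      also have "\<dots> \<le> (norm T * norm (g y)) * norm y"
        by (intro mult_right_mono norm_blinfun) simp
      finally have "norm (g y) * norm (g y) \<le> norm (g y) * (norm y * norm T)"
        by (simp add: power2_eq_square mult_ac)
      then show ?thesis
        by (smt (verit) mult_le_cancel_left norm_ge_zero mult_nonneg_nonneg)
    qed
  qed
  then show ?thesis by (simp add: adj_def ag bounded_linear_Blinfun_apply g)
qed

lemma adj_inner_left:
  fixes T :: "'a::{real_inner,complete_space} \<Rightarrow>\<^sub>L 'b::real_inner"
  shows "adj T y \<bullet> x = y \<bullet> T x"
  by (metis adj_inner inner_commute)

lemma adj_eqI:
  fixes T :: "'a::{real_inner,complete_space} \<Rightarrow>\<^sub>L 'b::real_inner"
  assumes "\<And>x y. T x \<bullet> y = x \<bullet> blinfun_apply S y"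
  shows "adj T = S"
  by (rule blinfun_eqI) (metis adj_inner assms vector_eq_ldot)

lemma adj_adj:
  fixes T :: "'a::{real_inner,complete_space} \<Rightarrow>\<^sub>L 'b::{real_inner,complete_space}"
  shows "adj (adj T) = T"
  by (rule adj_eqI) (simp add: adj_inner_left)

lemma selfadjoint_iff:
  fixes T :: "'a::{real_inner,complete_space} \<Rightarrow>\<^sub>L 'a"
  shows "selfadjoint T \<longleftrightarrow> (\<forall>x y. T x \<bullet> y = x \<bullet> T y)"
  unfolding selfadjoint_def by (metis adj_eqI adj_inner)

lemma selfadjointD:
  fixes T :: "'a::{real_inner,complete_space} \<Rightarrow>\<^sub>L 'a"
  shows "selfadjoint T \<Longrightarrow> T x \<bullet> y = x \<bullet> T y"
  by (simp add: selfadjoint_iff)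

lemma ker_subspace: "subspace (ker T)"
  by (auto simp: ker_def subspace_def blinfun.add_right blinfun.scaleR_right)

lemma ker_closed: "closed (ker T)"
  unfolding ker_def by (intro closed_Collect_eq continuous_intros)

lemma range_subspace: "subspace (range (blinfun_apply T))"
  by (rule linear_subspace_image)
    (simp_all add: blinfun.bounded_linear_right bounded_linear.linear)

lemma ker_adj_orthogonal_range:
  fixes T :: "'a::{real_inner,complete_space} \<Rightarrow>\<^sub>L 'b::real_inner"
  shows "ker (adj T) = (range T)\<^sup>\<bottom>"
proof -
  have "adj T y = 0 \<longleftrightarrow> (\<forall>x. y \<bullet> T x = 0)" for y
    by (metis adj_inner_left inner_eq_zero_iff inner_zero_left)
  then show ?thesis by (auto simp: ker_def orthogonal_comp_iff)
qed

text \<open>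
This is how a closed range hypothesis becomes solvability of an equation: it suffices that the
right-hand side is orthogonal to the kernel of the adjoint.
\<close>

lemma closed_range_eq_orthogonal_ker_adj:
  fixes T :: "'a::{real_inner,complete_space} \<Rightarrow>\<^sub>L 'b::{real_inner,complete_space}"
  assumes "closed (range T)"
  shows "range T = (ker (adj T))\<^sup>\<bottom>"
  by (simp add: ker_adj_orthogonal_range orthogonal_comp_comp range_subspace assms)

text \<open>
The closest-point map is linear because the orthogonal decomposition is unique, so it is the
bounded operator that the definite description asks for.
\<close>

lemma proj_spec:
  fixes S :: "'a::{real_inner,complete_space} set"
  assumes S: "subspace S" "closed S"
  shows "proj S x \<in> S \<and> x - proj S x \<in> S\<^sup>\<bottom>"
proof -
  have uniq: "p = q" if "p \<in> S" "x - p \<in> S\<^sup>\<bottom>" "q \<in> S" "x - q \<in> S\<^sup>\<bottom>" for p q x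
  proof -
    have "p - q \<in> S" using that S subspace_diff by blast
    then have "(x - q) \<bullet> (p - q) = 0" "(x - p) \<bullet> (p - q) = 0"
      using that by (auto simp: orthogonal_comp_iff)
    then have "(p - q) \<bullet> (p - q) = 0"
      by (simp add: inner_diff_left)
    then show ?thesis by simp
  qed
  have "\<exists>p. p \<in> S \<and> x - p \<in> S\<^sup>\<bottom>" for x
    using orthogonal_decomposition[OF S, of x] by blast
  then obtain g where g: "\<And>x. g x \<in> S" "\<And>x. x - g x \<in> S\<^sup>\<bottom>"
    by metis
  note sub = S(1) subspace_orthogonal_comp[of S]
  have "bounded_linear g"
  proof (rule bounded_linear_intro[of _ 1])
    fix x y
    have "(x - g x) + (y - g y) \<in> S\<^sup>\<bottom>" using g(2) sub(2) subspace_add by blast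
    then have "x + y - (g x + g y) \<in> S\<^sup>\<bottom>" by (simp add: algebra_simps)
    then show "g (x + y) = g x + g y"
      by (rule uniq[OF g(1) g(2) subspace_add[OF S(1) g(1) g(1)]])
  next
    fix c x
    have "c *\<^sub>R (x - g x) \<in> S\<^sup>\<bottom>" using g(2) sub(2) subspace_scale by blast
    then have "c *\<^sub>R x - c *\<^sub>R g x \<in> S\<^sup>\<bottom>" by (simp add: algebra_simps)
    then show "g (c *\<^sub>R x) = c *\<^sub>R g x"
      by (rule uniq[OF g(1) g(2) subspace_scale[OF S(1) g(1)]])
  next
    fix x
    have "(x - g x) \<bullet> g x = 0" using g by (simp add: orthogonal_comp_iff)
    then have "(norm (g x))\<^sup>2 = x \<bullet> g x" by (simp add: power2_norm_eq_inner inner_diff_left)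
    also have "\<dots> \<le> norm x * norm (g x)" by (rule norm_cauchy_schwarz)
    finally show "norm (g x) \<le> norm x * 1"
      by (cases "norm (g x) = 0") (simp_all add: power2_eq_square)
  qed
  then have B: "blinfun_apply (Blinfun g) = g" by (rule bounded_linear_Blinfun_apply)
  have "\<exists>!p :: 'a \<Rightarrow>\<^sub>L 'a. \<forall>x. p x \<in> S \<and> x - p x \<in> S\<^sup>\<bottom>"
  proof (rule ex1I[of _ "Blinfun g"])
    show "\<forall>x. Blinfun g x \<in> S \<and> x - Blinfun g x \<in> S\<^sup>\<bottom>" by (simp add: B g)
    show "p = Blinfun g" if "\<forall>x. p x \<in> S \<and> x - p x \<in> S\<^sup>\<bottom>" for p :: "'a \<Rightarrow>\<^sub>L 'a"
      by (rule blinfun_eqI) (use that uniq g B in metis)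
  qed
  from theI'[OF this] show ?thesis unfolding proj_def by blast
qed

context
  fixes S :: "'a::{real_inner,complete_space} set"
  assumes S: "subspace S" "closed S"
begin

lemma proj_in: "proj S x \<in> S"
  and proj_residual: "x - proj S x \<in> S\<^sup>\<bottom>"
  using proj_spec[OF S] by auto

lemma proj_unique: "p \<in> S \<Longrightarrow> x - p \<in> S\<^sup>\<bottom> \<Longrightarrow> proj S x = p"
proof -
  assume p: "p \<in> S" "x - p \<in> S\<^sup>\<bottom>"
  have "p - proj S x \<in> S" using p S proj_in subspace_diff by blast
  moreover have "(x - proj S x) - (x - p) \<in> S\<^sup>\<bottom>"
    using p(2) proj_residual subspace_orthogonal_comp subspace_diff by blast
  ultimately have "(p - proj S x) \<bullet> (p - proj S x) = 0"
    by (simp add: orthogonal_comp_iff)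
  then show ?thesis by simp
qed

lemma proj_id: "x \<in> S \<Longrightarrow> proj S x = x"
  by (rule proj_unique) (auto simp: subspace_0 subspace_orthogonal_comp)

lemma proj_zero: "x \<in> S\<^sup>\<bottom> \<Longrightarrow> proj S x = 0"
  by (rule proj_unique) (auto simp: subspace_0 S)

lemma proj_orthogonal_comp: "proj (S\<^sup>\<bottom>) x = x - proj S x"
proof -
  have "p = x - proj S x" if "p \<in> S\<^sup>\<bottom>" "x - p \<in> S\<^sup>\<bottom>\<^sup>\<bottom>" for p
    using that proj_unique[of "x - p" x] orthogonal_comp_comp[OF S] by simp
  then show ?thesis
    using proj_spec[OF subspace_orthogonal_comp[of S] closed_orthogonal_comp[of S], of x] by blast
qed

lemma proj_selfadjoint: "proj S x \<bullet> y = x \<bullet> proj S y"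
proof -
  have "(x - proj S x) \<bullet> proj S y = 0" "(y - proj S y) \<bullet> proj S x = 0"
    using proj_in proj_residual by (auto simp: orthogonal_comp_iff)
  then show ?thesis by (simp add: inner_diff_right inner_diff_left inner_commute)
qed

end

section \<open>Moore--Penrose inverses of self-adjoint operators with closed range\<close>

text \<open>
The uniform boundedness principle for functionals given by vectors. By Baire's theorem one of
the closed sets on which the functionals are bounded by an integer contains a ball, and the
bound on a ball is a bound on the norms.
\<close>

lemma weakly_bounded_imp_bounded:
  fixes S :: "'a::{real_inner,complete_space} set"
  assumes "\<And>v. \<exists>C. \<forall>s\<in>S. \<bar>s \<bullet> v\<bar> \<le> C"
  shows "bounded S"
proof -
  define E where "E n = {v. \<forall>s\<in>S. \<bar>s \<bullet> v\<bar> \<le> real n}" for n :: nat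
  have cl: "closed (E n)" for n
  proof -
    have "E n = (\<Inter>s\<in>S. {v. \<bar>s \<bullet> v\<bar> \<le> real n})" by (auto simp: E_def)
    then show ?thesis by (auto intro!: closed_INT closed_Collect_le continuous_intros)
  qed
  have cover: "\<Union>(range E) = UNIV"
  proof -
    have "\<exists>n. v \<in> E n" for v
    proof -
      obtain C where C: "\<forall>s\<in>S. \<bar>s \<bullet> v\<bar> \<le> C" using assms by blast
      obtain n :: nat where "C \<le> n" using real_arch_simple by blast
      then have "v \<in> E n" using C unfolding E_def by (auto intro: order_trans)
      then show ?thesis ..
    qed
    then show ?thesis by blast
  qed
  have "\<exists>n. interior (E n) \<noteq> {}"
  proof (rule ccontr)
    assume "\<not> ?thesis"
    then have "interior (\<Union>(range E)) = {}"
      using Met_TC.metric_Baire_category_alt[of "range E"] cl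
      by (auto simp: complete_UNIV)
    then show False using cover by simp
  qed
  then obtain n v0 where "v0 \<in> interior (E n)" by blast
  then obtain r where r: "r > 0" "cball v0 r \<subseteq> E n"
    by (metis mem_interior_cball)
  have v0: "v0 \<in> E n" using r by auto
  have "norm s \<le> 2 * n / r" if s: "s \<in> S" for s
  proof (cases "s = 0")
    case False
    define w where "w = (r / norm s) *\<^sub>R s"
    have "norm w = r" using False r(1) by (simp add: w_def)
    then have "v0 + w \<in> E n" using r(2) by (auto simp: dist_norm)
    then have "\<bar>s \<bullet> (v0 + w)\<bar> \<le> n" "\<bar>s \<bullet> v0\<bar> \<le> n"
      using s v0 by (auto simp: E_def)
    then have "s \<bullet> w \<le> 2 * n" by (simp add: inner_add_right)
    moreover have "s \<bullet> w = r * norm s"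
      using False by (simp add: w_def flip: power2_norm_eq_inner) (simp add: power2_eq_square)
    ultimately show ?thesis using r(1) by (simp add: field_simps)
  qed (use r(1) in simp)
  then show ?thesis unfolding bounded_iff by blast
qed

text \<open>
The Hellinger--Toeplitz theorem. The image of the unit ball is weakly bounded since the operator
can be moved to the other argument. It replaces the open mapping theorem below: the algebraic
inverse of a self-adjoint operator on its range is symmetric, so its boundedness comes for free.
\<close>

theorem symmetric_imp_bounded_linear:
  fixes G :: "'a::{real_inner,complete_space} \<Rightarrow> 'a"
  assumes sym: "\<And>x y. G x \<bullet> y = x \<bullet> G y"
  shows "bounded_linear G"
proof -
  have "bounded (G ` cball 0 1)"
  proof (rule weakly_bounded_imp_bounded, intro exI ballI)
    fix v s assume "s \<in> G ` cball 0 1"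
    then obtain y where y: "s = G y" "norm y \<le> 1" by auto
    have "\<bar>s \<bullet> v\<bar> \<le> norm y * norm (G v)" using y(1) sym Cauchy_Schwarz_ineq2 by metis
    also have "\<dots> \<le> norm (G v)" using y(2) by (simp add: mult_left_le_one_le)
    finally show "\<bar>s \<bullet> v\<bar> \<le> norm (G v)" .
  qed
  then obtain C where "\<forall>s\<in>G ` cball 0 1. norm s \<le> C"
    unfolding bounded_iff by blast
  then have C: "norm (G y) \<le> C" if "norm y \<le> 1" for y
    using that by simp
  have add: "G (x + y) = G x + G y" for x y
    by (rule vector_eq_rdot[THEN iffD1]) (metis sym inner_add_right inner_commute)
  have scale: "G (c *\<^sub>R x) = c *\<^sub>R G x" for c x
    by (rule vector_eq_rdot[THEN iffD1]) (metis sym inner_scaleR_right inner_commute)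
  show ?thesis
  proof (rule bounded_linear_intro[of _ C])
    show "norm (G x) \<le> norm x * C" for x
    proof (cases "x = 0")
      case True
      then show ?thesis using scale[of 0 0] by simp
    next
      case False
      have "norm (G ((1 / norm x) *\<^sub>R x)) \<le> C" using False by (intro C) simp
      then show ?thesis using False by (simp add: scale field_simps)
    qed
  qed (fact add scale)+
qed

lemma adj_compose:
  fixes S :: "'a::{real_inner,complete_space} \<Rightarrow>\<^sub>L 'b::{real_inner,complete_space}"
    and T :: "'b \<Rightarrow>\<^sub>L 'c::real_inner"
  shows "adj (T o\<^sub>L S) = adj S o\<^sub>L adj T"
  by (rule adj_eqI) (simp add: adj_inner)

lemma mp_inverse_eqI:
  fixes T :: "'a::{real_inner,complete_space} \<Rightarrow>\<^sub>L 'b::{real_inner,complete_space}"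
  assumes K: "T o\<^sub>L K o\<^sub>L T = T" "K o\<^sub>L T o\<^sub>L K = K" "selfadjoint (T o\<^sub>L K)" "selfadjoint (K o\<^sub>L T)"
  shows "mp_inverse T = K"
  unfolding mp_inverse_def
proof (rule the_equality)
  fix S assume S: "T o\<^sub>L S o\<^sub>L T = T \<and> S o\<^sub>L T o\<^sub>L S = S \<and> selfadjoint (T o\<^sub>L S) \<and> selfadjoint (S o\<^sub>L T)"
  have assoc: "(A o\<^sub>L B) o\<^sub>L C = A o\<^sub>L (B o\<^sub>L C)"
    for A :: "'z::real_normed_vector \<Rightarrow>\<^sub>L 'w::real_normed_vector"
      and B :: "'y::real_normed_vector \<Rightarrow>\<^sub>L 'z" and C :: "'x::real_normed_vector \<Rightarrow>\<^sub>L 'y"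
    by (rule blinfun_eqI) simp
  \<comment> \<open>each of \<open>T S\<close> and \<open>T K\<close> absorbs the other on one side, so taking adjoints makes them equal\<close>
  have "T o\<^sub>L S = T o\<^sub>L K"
  proof -
    have "adj (T o\<^sub>L S) = adj ((T o\<^sub>L K) o\<^sub>L (T o\<^sub>L S))" using K(1) by (simp flip: assoc)
    also have "\<dots> = (T o\<^sub>L S) o\<^sub>L (T o\<^sub>L K)"
      using S K by (metis adj_compose selfadjoint_def)
    also have "\<dots> = T o\<^sub>L K" using S by (simp flip: assoc)
    finally show ?thesis using S by (simp add: selfadjoint_def)
  qed
  moreover have "S o\<^sub>L T = K o\<^sub>L T"
  proof -
    have "adj (S o\<^sub>L T) = adj ((S o\<^sub>L T) o\<^sub>L (K o\<^sub>L T))" using K(1) by (metis assoc)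
    also have "\<dots> = (K o\<^sub>L T) o\<^sub>L (S o\<^sub>L T)"
      using S K by (metis adj_compose selfadjoint_def)
    also have "\<dots> = K o\<^sub>L T" using S by (metis assoc)
    finally show ?thesis using S by (simp add: selfadjoint_def)
  qed
  ultimately show "S = K" using S K(2) by (metis assoc)
qed (use K in simp)

text \<open>
On its closed range, which is the orthogonal complement of its kernel, a self-adjoint operator
is a bijection; inverting it there after projecting satisfies the four Penrose equations.
\<close>

lemma mp_inverse_selfadjoint:
  fixes T :: "'a::{real_inner,complete_space} \<Rightarrow>\<^sub>L 'a"
  assumes T: "selfadjoint T" "closed (range T)"
  shows "T (mp_inverse T y) = proj (range T) y"
    and "mp_inverse T (T y) = proj (range T) y"
    and "selfadjoint (mp_inverse T)"
proof -
  note sub = range_subspace[of T] T(2)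
  have rg: "range T = (ker T)\<^sup>\<bottom>"
    using closed_range_eq_orthogonal_ker_adj[OF T(2)] T(1) by (simp add: selfadjoint_def)
  have ex: "\<exists>x. x \<in> range T \<and> T x = proj (range T) y" for y
  proof -
    obtain u where u: "T u = proj (range T) y" using proj_in[OF sub] by (metis imageE)
    have "u - proj (range T) u \<in> ker T"
      using proj_residual[OF sub, of u] rg orthogonal_comp_comp[OF ker_subspace ker_closed] by metis
    then have "T (proj (range T) u) = T u" by (simp add: ker_def blinfun.diff_right)
    then show ?thesis using u proj_in[OF sub] by metis
  qed
  then obtain G where G: "\<And>y. G y \<in> range T" "\<And>y. T (G y) = proj (range T) y" by metis
  have sym: "G x \<bullet> y = x \<bullet> G y" for x y
  proof -
    have "G x \<bullet> y = G x \<bullet> T (G y)"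
      using proj_selfadjoint[OF sub] proj_id[OF sub G(1)] G(2) by metis
    also have "\<dots> = T (G x) \<bullet> G y" using selfadjointD[OF T(1)] by simp
    also have "\<dots> = x \<bullet> G y"
      using proj_selfadjoint[OF sub] proj_id[OF sub G(1)] G(2) by metis
    finally show ?thesis .
  qed
  define K where "K = Blinfun G"
  have K: "blinfun_apply K = G"
    unfolding K_def by (rule bounded_linear_Blinfun_apply, rule symmetric_imp_bounded_linear, rule sym)
  have GT: "G (T x) = proj (range T) x" for x
  proof -
    have "G (T x) \<bullet> y = proj (range T) x \<bullet> y" for y
      by (metis G(2) sym T(1) selfadjointD proj_selfadjoint[OF sub])
    then show ?thesis by (metis vector_eq_rdot)
  qed
  have pT: "proj (range T) (T x) = T x" for x by (rule proj_id[OF sub]) simp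
  have eq: "mp_inverse T = K"
  proof (rule mp_inverse_eqI)
    show "T o\<^sub>L K o\<^sub>L T = T" by (rule blinfun_eqI) (simp add: K G(2) pT)
    show "K o\<^sub>L T o\<^sub>L K = K" by (rule blinfun_eqI) (simp add: K GT proj_id[OF sub G(1)])
    show "selfadjoint (T o\<^sub>L K)" "selfadjoint (K o\<^sub>L T)"
      by (simp_all add: selfadjoint_iff K G(2) GT proj_selfadjoint[OF sub])
  qed
  show "T (mp_inverse T y) = proj (range T) y" by (simp add: eq K G)
  show "mp_inverse T (T y) = proj (range T) y" by (simp add: eq K GT)
  show "selfadjoint (mp_inverse T)" by (simp add: eq selfadjoint_iff K sym)
qed

lemma closed_range_if_bounded_below:
  fixes T :: "'a::{real_inner,complete_space} \<Rightarrow>\<^sub>L 'b::{real_inner,complete_space}"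
  assumes "c > 0" and below: "\<And>x. x \<in> (ker T)\<^sup>\<bottom> \<Longrightarrow> c * norm x \<le> norm (T x)"
  shows "closed (range T)"
proof -
  note ks = ker_subspace[of T] ker_closed[of T]
  have "T x \<in> T ` ((ker T)\<^sup>\<bottom>)" for x
    by (rule image_eqI[OF _ proj_residual[OF ks, of x]])
      (use proj_in[OF ks, of x] in \<open>simp add: ker_def blinfun.diff_right\<close>)
  then have "range T = T ` ((ker T)\<^sup>\<bottom>)" by blast
  moreover have "complete (T ` ((ker T)\<^sup>\<bottom>))"
    by (rule complete_isometric_image[OF \<open>c > 0\<close> subspace_orthogonal_comp])
      (use below in \<open>auto simp: blinfun.bounded_linear_right complete_eq_closed closed_orthogonal_comp\<close>)
  ultimately show ?thesis by (simp add: complete_eq_closed)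
qed

lemma closed_range_if_strongly_monotone:
  fixes T :: "'a::{real_inner,complete_space} \<Rightarrow>\<^sub>L 'a"
  assumes "strongly_monotone_on ((ker T)\<^sup>\<bottom>) T"
  shows "closed (range T)"
proof -
  obtain c where c: "c > 0" "\<And>x. x \<in> (ker T)\<^sup>\<bottom> \<Longrightarrow> c * (norm x)\<^sup>2 \<le> T x \<bullet> x"
    using assms unfolding strongly_monotone_on_def by blast
  show ?thesis
  proof (rule closed_range_if_bounded_below[OF c(1)])
    fix x assume "x \<in> (ker T)\<^sup>\<bottom>"
    then have "c * (norm x)\<^sup>2 \<le> norm (T x) * norm x"
      using c(2) norm_cauchy_schwarz order_trans by blast
    then show "c * norm x \<le> norm (T x)"
      by (cases "norm x = 0") (simp_all add: power2_eq_square)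
  qed
qed

text \<open>
A Lax--Milgram statement; it guarantees that the inverse of \<open>W\<close> in the cocoercivity condition is
a genuine right inverse.
\<close>

lemma strongly_monotone_surj:
  fixes T :: "'a::{real_inner,complete_space} \<Rightarrow>\<^sub>L 'a"
  assumes "selfadjoint T" "strongly_monotone_on UNIV T"
  shows "surj T"
proof -
  have "ker T = {0}"
  proof -
    obtain c where c: "c > 0" "\<And>x. c * (norm x)\<^sup>2 \<le> T x \<bullet> x"
      using assms(2) unfolding strongly_monotone_on_def by blast
    then have "T x = 0 \<Longrightarrow> x = 0" for x
      using c(2)[of x] c(1) by (simp add: mult_le_0_iff)
    then show ?thesis by (auto simp: ker_def)
  qed
  moreover from this have "closed (range T)"
    using closed_range_if_strongly_monotone[of T] assms(2) by simp
  ultimately show ?thesis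
    using closed_range_eq_orthogonal_ker_adj[of T] assms(1) by (simp add: selfadjoint_def)
qed

section \<open>Square roots of positive operators\<close>

lemma positive_op_Cauchy_Schwarz:
  fixes T :: "'a::{real_inner,complete_space} \<Rightarrow>\<^sub>L 'a"
  assumes "selfadjoint T" "positive_op T"
  shows "(T x \<bullet> y)\<^sup>2 \<le> (T x \<bullet> x) * (T y \<bullet> y)"
proof -
  have q: "0 \<le> T x \<bullet> x + 2 * t * (T x \<bullet> y) + t\<^sup>2 * (T y \<bullet> y)" for t
  proof -
    have "T y \<bullet> x = T x \<bullet> y" using selfadjointD[OF assms(1)] by (simp add: inner_commute)
    then have "T (x + t *\<^sub>R y) \<bullet> (x + t *\<^sub>R y) = T x \<bullet> x + 2 * t * (T x \<bullet> y) + t\<^sup>2 * (T y \<bullet> y)"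
      by (simp add: blinfun.add_right blinfun.scaleR_right inner_add_left inner_add_right
          algebra_simps power2_eq_square)
    then show ?thesis using assms(2) unfolding positive_op_def by metis
  qed
  have yy: "T y \<bullet> y \<ge> 0" using assms(2) by (simp add: positive_op_def)
  show ?thesis
  proof (cases "T y \<bullet> y = 0")
    case True
    have "T x \<bullet> y = 0"
    proof (rule ccontr)
      assume "T x \<bullet> y \<noteq> 0"
      then show False using q[of "- (T x \<bullet> x + 1) / (2 * (T x \<bullet> y))"] True
        by (simp add: field_simps)
    qed
    then show ?thesis using True by simp
  next
    case False
    then have "T y \<bullet> y > 0" using yy by simp
    then show ?thesis using q[of "- (T x \<bullet> y) / (T y \<bullet> y)"]
      by (simp add: power2_eq_square field_simps)
  qed
qed

lemma positive_op_eq_0: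
  fixes T :: "'a::{real_inner,complete_space} \<Rightarrow>\<^sub>L 'a"
  assumes "selfadjoint T" "positive_op T" "T x \<bullet> x = 0"
  shows "T x = 0"
  using positive_op_Cauchy_Schwarz[OF assms(1,2), of x "T x"] assms(3) by simp

text \<open>
Cauchy--Schwarz for the form of \<open>T\<close>, applied to \<open>x\<close> and \<open>T x\<close>, bounds \<open>\<parallel>T x\<parallel>\<^sup>4\<close> by
\<open>\<parallel>x\<parallel>\<^sup>2\<parallel>T x\<parallel>\<^sup>2\<close>.
\<close>

lemma norm_le_1_if_between_0_and_id:
  fixes T :: "'a::{real_inner,complete_space} \<Rightarrow>\<^sub>L 'a"
  assumes T: "selfadjoint T" "positive_op T" and le: "\<And>x. T x \<bullet> x \<le> (norm x)\<^sup>2"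
  shows "norm T \<le> 1"
proof (rule norm_blinfun_bound)
  fix x
  have "(norm (T x))\<^sup>2 * (norm (T x))\<^sup>2 = (T x \<bullet> T x)\<^sup>2"
    by (simp only: power2_norm_eq_inner power2_eq_square[of "T x \<bullet> T x"])
  also have "\<dots> \<le> (T x \<bullet> x) * (T (T x) \<bullet> T x)" by (rule positive_op_Cauchy_Schwarz[OF T])
  also have "\<dots> \<le> (norm x)\<^sup>2 * (norm (T x))\<^sup>2"
    using le T(2) by (intro mult_mono) (auto simp: positive_op_def)
  finally have "(norm (T x))\<^sup>2 * ((norm (T x))\<^sup>2) \<le> (norm x)\<^sup>2 * (norm (T x))\<^sup>2" .
  then have "(norm (T x))\<^sup>2 \<le> (norm x)\<^sup>2"
    by (cases "T x = 0") (simp, rule mult_right_le_imp_le[of _ "(norm (T x))\<^sup>2"], simp_all only: zero_less_power2 norm_eq_zero not_False_eq_True)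
  from power2_le_imp_le[OF this] show "norm (T x) \<le> 1 * norm x" by simp
qed simp

text \<open>
With \<open>T = I - A\<close> and \<open>S = I - Z\<close>, the equation \<open>S\<^sup>2 = T\<close> is the fixed point equation
\<open>Z = (A + Z\<^sup>2) / 2\<close>. Its iterates from \<open>0\<close> are dominated, together with their increments, by the
bounded increasing real sequence \<open>y \<mapsto> (1 + y\<^sup>2) / 2\<close> belonging to \<open>\<parallel>A\<parallel> = 1\<close>, hence they are
Cauchy. The limit commutes with everything that commutes with \<open>T\<close>, because every iterate is a
polynomial in \<open>A\<close>; this is what uniqueness needs.
\<close>

lemma sqrt_op_exists_contraction:
  fixes T :: "'a::{real_inner,complete_space} \<Rightarrow>\<^sub>L 'a"
  assumes T: "selfadjoint T" "positive_op T" and le: "\<And>x. T x \<bullet> x \<le> (norm x)\<^sup>2"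
  obtains S where "selfadjoint S" "positive_op S" "S o\<^sub>L S = T"
    "\<And>C. C o\<^sub>L T = T o\<^sub>L C \<Longrightarrow> C o\<^sub>L S = S o\<^sub>L C"
proof -
  define A where "A = id_blinfun - T"
  have A_app: "A x = x - T x" for x by (simp add: A_def blinfun.diff_left)
  have nA: "norm A \<le> 1"
    by (rule norm_le_1_if_between_0_and_id)
      (use T le in \<open>auto simp: selfadjoint_iff positive_op_def A_app inner_diff_left inner_diff_right
        power2_norm_eq_inner\<close>)
  define Y where "Y n = ((\<lambda>Z. (1/2) *\<^sub>R (A + (Z o\<^sub>L Z))) ^^ n) 0" for n
  define y where "y n = ((\<lambda>t::real. (1 + t\<^sup>2) / 2) ^^ n) 0" for n
  have Y: "Y 0 = 0" "Y (Suc n) = (1/2) *\<^sub>R (A + (Y n o\<^sub>L Y n))" for n by (simp_all add: Y_def)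
  have y: "y 0 = 0" "y (Suc n) = (1 + (y n)\<^sup>2) / 2" for n by (simp_all add: y_def)
  have y01: "0 \<le> y n \<and> y n \<le> 1" for n
    by (induction n) (auto simp: y power_le_one)
  have ymono: "y n \<le> y (Suc n)" for n
    using sum_power2_ge_zero[of "y n - 1" 0] by (simp add: y power2_eq_square algebra_simps)
  have nY: "norm (Y n) \<le> y n" for n
  proof (induction n)
    case (Suc n)
    have "norm (Y n o\<^sub>L Y n) \<le> y n * y n"
      using y01[of n] by (intro order_trans[OF norm_blinfun_compose] mult_mono Suc) auto
    then have "norm (A + (Y n o\<^sub>L Y n)) \<le> 1 + y n * y n"
      using norm_triangle_ineq[of A "Y n o\<^sub>L Y n"] nA by linarith
    then show ?case by (simp add: Y y power2_eq_square)
  qed (simp add: Y y)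
  have nYd: "norm (Y (Suc n) - Y n) \<le> y (Suc n) - y n" for n
  proof (induction n)
    case 0
    then show ?case using nA by (simp add: Y y)
  next
    case (Suc n)
    have "Y (Suc (Suc n)) - Y (Suc n)
        = (1/2) *\<^sub>R ((Y (Suc n) o\<^sub>L Y (Suc n)) - (Y n o\<^sub>L Y n))"
      by (simp only: Y(2) scaleR_diff_right[symmetric]) simp
    also have "\<dots> = (1/2) *\<^sub>R ((Y (Suc n) o\<^sub>L (Y (Suc n) - Y n)) + ((Y (Suc n) - Y n) o\<^sub>L Y n))"
      by (rule blinfun_eqI) (simp add: blinfun.bilinear_simps)
    finally have "norm (Y (Suc (Suc n)) - Y (Suc n))
        = 1/2 * norm ((Y (Suc n) o\<^sub>L (Y (Suc n) - Y n)) + ((Y (Suc n) - Y n) o\<^sub>L Y n))"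
      by simp
    also have "\<dots> \<le> 1/2 * (norm (Y (Suc n)) * norm (Y (Suc n) - Y n) + norm (Y (Suc n) - Y n) * norm (Y n))"
      by (intro mult_left_mono order_trans[OF norm_triangle_ineq] add_mono norm_blinfun_compose) simp
    also have "\<dots> \<le> 1/2 * (y (Suc n) * (y (Suc n) - y n) + (y (Suc n) - y n) * y n)"
      using y01 ymono[of n] by (intro mult_left_mono add_mono mult_mono nY Suc) auto
    also have "\<dots> = y (Suc (Suc n)) - y (Suc n)"
      by (simp add: y(2)[of "Suc n"]) (simp add: y(2)[of n] power2_eq_square field_simps)
    finally show ?case .
  qed
  have dY: "norm (Y (m + k) - Y m) \<le> y (m + k) - y m" for m k
  proof (induction k)
    case (Suc k)
    have "Y (m + Suc k) - Y m = (Y (Suc (m + k)) - Y (m + k)) + (Y (m + k) - Y m)" by simp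
    then have "norm (Y (m + Suc k) - Y m) \<le> norm (Y (Suc (m + k)) - Y (m + k)) + norm (Y (m + k) - Y m)"
      using norm_triangle_ineq by metis
    then show ?case using nYd[of "m + k"] Suc by simp
  qed simp
  have "Cauchy Y"
  proof -
    have "convergent y"
      using y01 ymono by (intro Bseq_monoseq_convergent BseqI'[of _ 1]) (auto simp: monoseq_Suc)
    then have "Cauchy y" by (rule convergent_Cauchy)
    have "dist (Y m) (Y n) \<le> dist (y m) (y n)" if "m \<le> n" for m n
      using dY[of m "n - m"] that by (simp add: dist_norm norm_minus_commute)
    then have *: "dist (Y m) (Y n) \<le> dist (y m) (y n)" for m n
      by (metis dist_commute linear)
    show ?thesis
    proof (rule metric_CauchyI)
      fix e :: real assume "e > 0"
      then obtain N where "\<forall>m\<ge>N. \<forall>n\<ge>N. dist (y m) (y n) < e"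
        using \<open>Cauchy y\<close> unfolding Cauchy_def by blast
      then show "\<exists>N. \<forall>m\<ge>N. \<forall>n\<ge>N. dist (Y m) (Y n) < e"
        using * order_le_less_trans by blast
    qed
  qed
  have "convergent (\<lambda>n. Y n x)" for x
  proof -
    have "Cauchy (\<lambda>n. Y n x)"
      using bounded_linear.Cauchy[OF bounded_linear_apply_blinfun \<open>Cauchy Y\<close>] by blast
    then show ?thesis by (simp add: Cauchy_convergent_iff)
  qed
  then obtain z where z: "\<And>x. (\<lambda>n. Y n x) \<longlonglongrightarrow> z x"
    unfolding convergent_def by metis
  have nYx: "norm (Y n x) \<le> norm x" for n x
    using norm_blinfun[of "Y n" x] mult_right_mono[of "norm (Y n)" 1 "norm x"] nY[of n] y01[of n]
    by simp
  have nz: "norm (z x) \<le> norm x" for x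
    by (rule LIMSEQ_le_const2[OF tendsto_norm[OF z]]) (use nYx in blast)
  have "bounded_linear z"
  proof (rule bounded_linear_intro[of _ 1])
    show "z (u + v) = z u + z v" for u v
      by (rule LIMSEQ_unique[OF z]) (use tendsto_add[OF z z] in \<open>simp add: blinfun.add_right\<close>)
    show "z (c *\<^sub>R u) = c *\<^sub>R z u" for c u
      by (rule LIMSEQ_unique[OF z])
        (use tendsto_scaleR[OF tendsto_const z] in \<open>simp add: blinfun.scaleR_right\<close>)
  qed (simp add: nz)
  then have zB: "blinfun_apply (Blinfun z) = z" by (rule bounded_linear_Blinfun_apply)
  define Z where "Z = Blinfun z"
  have appl: "(\<lambda>n. Y n x) \<longlonglongrightarrow> Z x" for x by (simp add: Z_def zB z)
  have nZ: "norm (Z x) \<le> norm x" for x by (simp add: Z_def zB nz)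
  have fix_eq: "Z x = (1/2) *\<^sub>R (A x + Z (Z x))" for x
  proof (rule LIMSEQ_unique)
    show "(\<lambda>n. Y (Suc n) x) \<longlonglongrightarrow> Z x" using appl by (rule LIMSEQ_Suc)
    have "(\<lambda>n. Y n (Y n x - Z x)) \<longlonglongrightarrow> 0"
    proof (rule Lim_null_comparison)
      show "\<forall>\<^sub>F n in sequentially. norm (Y n (Y n x - Z x)) \<le> norm (Y n x - Z x)"
        by (simp add: nYx)
      show "(\<lambda>n. norm (Y n x - Z x)) \<longlonglongrightarrow> 0"
        using appl by (simp add: LIM_zero_iff tendsto_norm_zero)
    qed
    from tendsto_add[OF this appl[of "Z x"]] have "(\<lambda>n. Y n (Y n x)) \<longlonglongrightarrow> Z (Z x)"
      by (simp add: blinfun.diff_right)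
    from tendsto_scaleR[OF tendsto_const tendsto_add[OF tendsto_const this]]
    show "(\<lambda>n. Y (Suc n) x) \<longlonglongrightarrow> (1/2) *\<^sub>R (A x + Z (Z x))"
      unfolding Y(2) blinfun.scaleR_left blinfun.add_left blinfun_apply_blinfun_compose .
  qed
  have symY: "Y n x \<bullet> w = x \<bullet> Y n w" for n x w
  proof (induction n arbitrary: x w)
    case (Suc n)
    show ?case using Suc selfadjointD[OF T(1), of x w]
      by (simp add: Y A_app blinfun.bilinear_simps inner_add_left inner_add_right inner_diff_left inner_diff_right)
  qed (simp add: Y)
  have symZ: "Z x \<bullet> w = x \<bullet> Z w" for x w
  proof (rule LIMSEQ_unique)
    show "(\<lambda>n. Y n x \<bullet> w) \<longlonglongrightarrow> Z x \<bullet> w" by (intro tendsto_intros appl)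
    show "(\<lambda>n. Y n x \<bullet> w) \<longlonglongrightarrow> x \<bullet> Z w" unfolding symY by (intro tendsto_intros appl)
  qed
  show ?thesis
  proof
    show "selfadjoint (id_blinfun - Z)"
      by (simp add: selfadjoint_iff blinfun.diff_left inner_diff_left inner_diff_right symZ)
    show "positive_op (id_blinfun - Z)"
      unfolding positive_op_def
    proof
      fix x
      have "Z x \<bullet> x \<le> norm (Z x) * norm x" by (rule norm_cauchy_schwarz)
      also have "\<dots> \<le> norm x * norm x" using nZ by (rule mult_right_mono) simp
      finally show "(id_blinfun - Z) x \<bullet> x \<ge> 0"
        by (simp add: blinfun.diff_left inner_diff_left power2_eq_square flip: power2_norm_eq_inner)
    qed
    show "(id_blinfun - Z) o\<^sub>L (id_blinfun - Z) = T"
    proof (rule blinfun_eqI)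
      fix x
      have "2 *\<^sub>R Z x = A x + Z (Z x)"
        using arg_cong[OF fix_eq[of x], of "\<lambda>v. 2 *\<^sub>R v"] by simp
      then have "Z x + Z x = (x - T x) + Z (Z x)" by (simp add: A_app scaleR_2)
      then show "((id_blinfun - Z) o\<^sub>L (id_blinfun - Z)) x = T x"
        by (simp add: blinfun.bilinear_simps algebra_simps)
    qed
  next
    fix C assume C: "C o\<^sub>L T = T o\<^sub>L C"
    have CT: "C (T x) = T (C x)" for x using arg_cong[OF C, of "\<lambda>F. blinfun_apply F x"] by simp
    have CY: "C (Y n x) = Y n (C x)" for n x
      by (induction n arbitrary: x) (simp_all add: Y A_app CT blinfun.bilinear_simps)
    have "C (Z x) = Z (C x)" for x
    proof (rule LIMSEQ_unique)
      show "(\<lambda>n. C (Y n x)) \<longlonglongrightarrow> C (Z x)" by (intro tendsto_intros appl)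
      show "(\<lambda>n. C (Y n x)) \<longlonglongrightarrow> Z (C x)" unfolding CY by (rule appl)
    qed
    then show "C o\<^sub>L (id_blinfun - Z) = (id_blinfun - Z) o\<^sub>L C"
      by (intro blinfun_eqI) (simp add: blinfun.bilinear_simps)
  qed
qed

text \<open>
If \<open>Q\<^sup>2 = T\<close> then \<open>Q\<close> commutes with \<open>T\<close>, hence with \<open>S\<close>. For \<open>w = (S - Q) x\<close> this gives
\<open>(S + Q) w = 0\<close>, so both positive forms vanish at \<open>w\<close>, and then \<open>\<parallel>w\<parallel>\<^sup>2 = \<langle>(S - Q) w, x\<rangle> = 0\<close>.
\<close>

lemma sqrt_op_unique:
  fixes T :: "'a::{real_inner,complete_space} \<Rightarrow>\<^sub>L 'a"
  assumes S: "selfadjoint S" "positive_op S" "S o\<^sub>L S = T"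
    and comm: "\<And>C. C o\<^sub>L T = T o\<^sub>L C \<Longrightarrow> C o\<^sub>L S = S o\<^sub>L C"
    and Q: "selfadjoint Q" "positive_op Q" "Q o\<^sub>L Q = T"
  shows "Q = S"
proof (rule blinfun_eqI)
  fix x
  have assoc: "Q o\<^sub>L T = T o\<^sub>L Q" unfolding Q(3)[symmetric] by (rule blinfun_eqI) simp
  have QS: "Q (S u) = S (Q u)" for u
    using arg_cong[OF comm[OF assoc], of "\<lambda>F. blinfun_apply F u"] by simp
  have sq: "S (S u) = Q (Q u)" for u
    using arg_cong[OF trans[OF S(3) Q(3)[symmetric]], of "\<lambda>F. blinfun_apply F u"] by simp
  define w where "w = S x - Q x"
  have "S w + Q w = 0"
    by (simp add: w_def blinfun.diff_right QS sq)
  then have "S w \<bullet> w + Q w \<bullet> w = 0" by (metis inner_add_left inner_zero_left)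
  then have "S w \<bullet> w = 0" "Q w \<bullet> w = 0"
    using S(2)[unfolded positive_op_def, rule_format, of w]
      Q(2)[unfolded positive_op_def, rule_format, of w] by linarith+
  then have "S w = 0" "Q w = 0"
    by (simp_all add: positive_op_eq_0[OF S(1,2)] positive_op_eq_0[OF Q(1,2)])
  then have "w \<bullet> S x = 0" "w \<bullet> Q x = 0"
    using selfadjointD[OF S(1), of w x] selfadjointD[OF Q(1), of w x] by simp_all
  then have "w \<bullet> w = 0" by (simp add: w_def inner_diff_right)
  then show "Q x = S x" by (simp add: w_def)
qed

text \<open>
Dividing by \<open>\<parallel>T\<parallel> + 1\<close> reduces to an operator between \<open>0\<close> and the identity; the summand \<open>1\<close>
covers \<open>T = 0\<close>.
\<close>

theorem sqrt_op_spec: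
  fixes T :: "'a::{real_inner,complete_space} \<Rightarrow>\<^sub>L 'a"
  assumes T: "selfadjoint T" "positive_op T"
  shows "selfadjoint (sqrt_op T)" "positive_op (sqrt_op T)" "sqrt_op T o\<^sub>L sqrt_op T = T"
proof -
  define c where "c = norm T + 1"
  have c: "c > 0" by (simp add: c_def add_nonneg_pos)
  define T' where "T' = (1 / c) *\<^sub>R T"
  have T': "T' x = (1 / c) *\<^sub>R T x" for x by (simp add: T'_def blinfun.scaleR_left)
  have "T x \<bullet> x \<le> c * (norm x)\<^sup>2" for x
  proof -
    have "T x \<bullet> x \<le> norm (T x) * norm x" by (rule norm_cauchy_schwarz)
    also have "\<dots> \<le> (c * norm x) * norm x"
      using norm_blinfun[of T x]
      by (intro mult_right_mono) (auto simp: c_def algebra_simps intro: add_increasing)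
    finally show ?thesis by (simp add: power2_eq_square mult_ac)
  qed
  then have le: "T' x \<bullet> x \<le> (norm x)\<^sup>2" for x using c by (simp add: T' field_simps)
  have "selfadjoint T'" "positive_op T'"
    using T c by (simp_all add: selfadjoint_iff positive_op_def T')
  then obtain S where S: "selfadjoint S" "positive_op S" "S o\<^sub>L S = T'"
    "\<And>C. C o\<^sub>L T' = T' o\<^sub>L C \<Longrightarrow> C o\<^sub>L S = S o\<^sub>L C"
    using sqrt_op_exists_contraction[OF _ _ le] by blast
  define S' where "S' = sqrt c *\<^sub>R S"
  have S'app: "S' x = sqrt c *\<^sub>R S x" for x by (simp add: S'_def blinfun.scaleR_left)
  have SS: "S (S x) = T' x" for x using arg_cong[OF S(3), of "\<lambda>F. blinfun_apply F x"] by simp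
  have S': "selfadjoint S'" "positive_op S'" "S' o\<^sub>L S' = T"
    using S(1,2) c by (auto simp: selfadjoint_iff positive_op_def S'app SS T' blinfun.scaleR_right
        intro!: blinfun_eqI)
  have comm: "C o\<^sub>L S' = S' o\<^sub>L C" if C: "C o\<^sub>L T = T o\<^sub>L C" for C
  proof -
    have "C (T x) = T (C x)" for x using arg_cong[OF C, of "\<lambda>F. blinfun_apply F x"] by simp
    then have "C o\<^sub>L T' = T' o\<^sub>L C" by (intro blinfun_eqI) (simp add: T' blinfun.scaleR_right)
    then have "C o\<^sub>L S = S o\<^sub>L C" by (rule S(4))
    from arg_cong[OF this, of "\<lambda>F. blinfun_apply F _"]
    have "C (S x) = S (C x)" for x by simp
    then show ?thesis by (intro blinfun_eqI) (simp add: S'app blinfun.scaleR_right)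
  qed
  have "sqrt_op T = S'"
    unfolding sqrt_op_def
  proof (rule the_equality)
    show "Q = S'" if "selfadjoint Q \<and> positive_op Q \<and> Q o\<^sub>L Q = T" for Q
      using that by (intro sqrt_op_unique[OF S' comm]) auto
  qed (simp add: S')
  then show "selfadjoint (sqrt_op T)" "positive_op (sqrt_op T)" "sqrt_op T o\<^sub>L sqrt_op T = T"
    using S' by simp_all
qed

lemma norm_sqrt_op_square:
  fixes T :: "'a::{real_inner,complete_space} \<Rightarrow>\<^sub>L 'a"
  assumes T: "selfadjoint T" "positive_op T"
  shows "(norm (sqrt_op T x))\<^sup>2 = T x \<bullet> x"
proof -
  have "T x = sqrt_op T (sqrt_op T x)"
    using arg_cong[OF sqrt_op_spec(3)[OF T], of "\<lambda>F. blinfun_apply F x"] by simp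
  then show ?thesis
    using selfadjointD[OF sqrt_op_spec(1)[OF T]] by (simp add: power2_norm_eq_inner)
qed

text \<open>
The square root inherits the kernel of \<open>T\<close> and a lower bound on its complement from
\<open>\<parallel>T\<^sup>1\<^sup>/\<^sup>2x\<parallel>\<^sup>2 = \<langle>T x, x\<rangle>\<close>, so its range is closed and its Moore--Penrose inverse undoes it up to the
projection along the kernel.
\<close>

lemma mp_inverse_sqrt_op:
  fixes T :: "'a::{real_inner,complete_space} \<Rightarrow>\<^sub>L 'a"
  assumes T: "selfadjoint T" "positive_op T" "strongly_monotone_on ((ker T)\<^sup>\<bottom>) T"
  defines "K \<equiv> mp_inverse (sqrt_op T)"
  shows "selfadjoint K" "K (sqrt_op T x) = x - proj (ker T) x"
proof -
  let ?S = "sqrt_op T"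
  note S = sqrt_op_spec[OF T(1,2)] and nS = norm_sqrt_op_square[OF T(1,2)]
  have kS: "ker ?S = ker T"
  proof -
    have "?S x = 0 \<longleftrightarrow> T x = 0" for x
      using nS[of x] positive_op_eq_0[OF T(1,2), of x] by (metis inner_zero_left norm_eq_zero zero_eq_power2)
    then show ?thesis by (simp add: ker_def)
  qed
  obtain c where c: "c > 0" "\<And>x. x \<in> (ker T)\<^sup>\<bottom> \<Longrightarrow> c * (norm x)\<^sup>2 \<le> T x \<bullet> x"
    using T(3) unfolding strongly_monotone_on_def by blast
  have cl: "closed (range ?S)"
  proof (rule closed_range_if_bounded_below[of "sqrt c"])
    fix x assume "x \<in> (ker ?S)\<^sup>\<bottom>"
    then have "(sqrt c * norm x)\<^sup>2 \<le> (norm (?S x))\<^sup>2"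
      using c by (simp add: kS nS power_mult_distrib)
    then show "sqrt c * norm x \<le> norm (?S x)" by (rule power2_le_imp_le) simp
  qed (use c in simp)
  note mp = mp_inverse_selfadjoint[OF S(1) cl]
  show "selfadjoint K" unfolding K_def by (rule mp(3))
  have "range ?S = (ker T)\<^sup>\<bottom>"
    using closed_range_eq_orthogonal_ker_adj[OF cl] S(1) by (simp add: selfadjoint_def kS)
  then show "K (?S x) = x - proj (ker T) x"
    unfolding K_def by (simp add: mp(2) proj_orthogonal_comp[OF ker_subspace ker_closed])
qed

section \<open>Weak convergence\<close>

lemma weakly_converges_unique:
  assumes "weakly_converges u l" "weakly_converges u l'"
  shows "l = l'"
proof -
  have "l \<bullet> y = l' \<bullet> y" for y
    using assms LIMSEQ_unique unfolding weakly_converges_def by blast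
  then show ?thesis by (metis vector_eq_rdot)
qed

lemma weakly_converges_subseq:
  "weakly_converges u l \<Longrightarrow> strict_mono r \<Longrightarrow> weakly_converges (u \<circ> r) l"
  unfolding weakly_converges_def
  using LIMSEQ_subseq_LIMSEQ by (fastforce simp: o_def)

lemma tendsto_imp_weakly_converges: "u \<longlonglongrightarrow> l \<Longrightarrow> weakly_converges u l"
  unfolding weakly_converges_def by (auto intro: tendsto_intros)

lemma weakly_converges_add:
  "weakly_converges u l \<Longrightarrow> weakly_converges v m \<Longrightarrow> weakly_converges (\<lambda>k. u k + v k) (l + m)"
  unfolding weakly_converges_def by (auto simp: inner_add_left intro: tendsto_intros)

lemma weakly_converges_diff:
  "weakly_converges u l \<Longrightarrow> weakly_converges v m \<Longrightarrow> weakly_converges (\<lambda>k. u k - v k) (l - m)"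
  unfolding weakly_converges_def by (auto simp: inner_diff_left intro: tendsto_intros)

lemma weakly_converges_scaleR:
  "weakly_converges u l \<Longrightarrow> weakly_converges (\<lambda>k. c *\<^sub>R u k) (c *\<^sub>R l)"
  unfolding weakly_converges_def by (auto intro: tendsto_intros)

lemma weakly_converges_blinfun:
  fixes T :: "'a::{real_inner,complete_space} \<Rightarrow>\<^sub>L 'b::real_inner"
  assumes "weakly_converges u l"
  shows "weakly_converges (\<lambda>k. T (u k)) (T l)"
  using assms unfolding weakly_converges_def by (simp flip: adj_inner)

lemma weakly_converges_bounded:
  fixes u :: "nat \<Rightarrow> 'a::{real_inner,complete_space}"
  assumes "weakly_converges u l"
  shows "bounded (range u)"
proof (rule weakly_bounded_imp_bounded)
  fix v
  have "(\<lambda>k. u k \<bullet> v) \<longlonglongrightarrow> l \<bullet> v" using assms by (simp add: weakly_converges_def)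
  then have "bounded (range (\<lambda>k. u k \<bullet> v))" by (rule convergent_imp_bounded)
  then show "\<exists>C. \<forall>s\<in>range u. \<bar>s \<bullet> v\<bar> \<le> C" by (auto simp: bounded_iff)
qed

lemma bounded_inner_null:
  fixes u v :: "nat \<Rightarrow> 'a::real_inner"
  assumes "bounded (range u)" "v \<longlonglongrightarrow> 0"
  shows "(\<lambda>k. u k \<bullet> v k) \<longlonglongrightarrow> 0"
proof -
  obtain C where C: "\<And>k. norm (u k) \<le> C" using assms(1) by (auto simp: bounded_iff)
  show ?thesis
  proof (rule Lim_null_comparison)
    show "\<forall>\<^sub>F k in sequentially. norm (u k \<bullet> v k) \<le> C * norm (v k)"
      using C by (auto intro!: always_eventually order_trans[OF Cauchy_Schwarz_ineq2] mult_right_mono)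
    show "(\<lambda>k. C * norm (v k)) \<longlonglongrightarrow> 0"
      using tendsto_mult[OF tendsto_const tendsto_norm[OF assms(2)]] by fastforce
  qed
qed

lemma weak_strong_inner_tendsto:
  fixes u v :: "nat \<Rightarrow> 'a::{real_inner,complete_space}"
  assumes "weakly_converges u l" "v \<longlonglongrightarrow> m"
  shows "(\<lambda>k. u k \<bullet> v k) \<longlonglongrightarrow> l \<bullet> m"
proof -
  have "(\<lambda>k. u k \<bullet> (v k - m)) \<longlonglongrightarrow> 0"
    using assms(2) by (intro bounded_inner_null weakly_converges_bounded[OF assms(1)])
      (simp add: LIM_zero_iff)
  moreover have "(\<lambda>k. u k \<bullet> m) \<longlonglongrightarrow> l \<bullet> m" using assms(1) by (simp add: weakly_converges_def)
  ultimately have "(\<lambda>k. u k \<bullet> (v k - m) + u k \<bullet> m) \<longlonglongrightarrow> 0 + l \<bullet> m" by (rule tendsto_add)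
  then show ?thesis by (simp add: inner_diff_right)
qed

text \<open>
A diagonal subsequence makes the inner products with every member of the sequence converge.
The vectors for which convergence holds form a closed subspace containing the sequence, and
vectors orthogonal to it have zero inner products throughout; so no separability is needed.
Riesz representation turns the limits into a weak limit.
\<close>

theorem bounded_imp_weakly_convergent_subseq:
  fixes u :: "nat \<Rightarrow> 'a::{real_inner,complete_space}"
  assumes bd: "bounded (range u)"
  obtains r l where "strict_mono r" "weakly_converges (u \<circ> r) l"
proof -
  obtain C where C: "\<And>k. norm (u k) \<le> C" using bd by (auto simp: bounded_iff)
  have C0: "C \<ge> 0" using C[of 0] norm_ge_zero order_trans by blast
  define P where "P n s \<longleftrightarrow> convergent (\<lambda>k. u (s k) \<bullet> u n)" for n and s :: "nat \<Rightarrow> nat"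
  interpret subseqs P
  proof
    fix n and s :: "nat \<Rightarrow> nat"
    have "bounded (range (\<lambda>k. u (s k) \<bullet> u n))"
      by (rule boundedI[of _ "C * norm (u n)"])
        (auto intro!: order_trans[OF Cauchy_Schwarz_ineq2] mult_right_mono C)
    then obtain l r where "strict_mono r" "((\<lambda>k. u (s k) \<bullet> u n) \<circ> r) \<longlonglongrightarrow> l"
      using bounded_imp_convergent_subsequence by blast
    then show "\<exists>r'. strict_mono r' \<and> P n (s \<circ> r')"
      unfolding P_def convergent_def by (auto simp: o_def)
  qed
  define v where "v = u \<circ> diagseq"
  have vC: "norm (v k) \<le> C" for k by (simp add: v_def C)
  define Y where "Y = {y. convergent (\<lambda>k. v k \<bullet> y)}"
  have uY: "u n \<in> Y" for n
  proof -
    have "P n (diagseq \<circ> ((+) (Suc n)))"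
    proof (rule diagseq_holds)
      fix r s :: "nat \<Rightarrow> nat" and n
      assume "strict_mono r" "P n s"
      then show "P n (s \<circ> r)"
        unfolding P_def using convergent_subseq_convergent[of "\<lambda>k. u (s k) \<bullet> u n" r] by (simp add: o_def)
    qed
    then have "convergent (\<lambda>k. v (k + Suc n) \<bullet> u n)"
      by (simp add: P_def v_def o_def add.commute)
    then show ?thesis using convergent_ignore_initial_segment[of "\<lambda>k. v k \<bullet> u n" "Suc n"]
      by (simp add: Y_def)
  qed
  have subY: "subspace Y"
    unfolding subspace_def Y_def
    by (auto simp: inner_add_right intro: convergent_add convergent_const
        convergent_mult[OF convergent_const])
  have "closed Y"
    unfolding closed_sequential_limits
  proof (intro allI impI, elim conjE)
    fix f y assume f: "\<forall>n. f n \<in> Y" "f \<longlonglongrightarrow> y"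
    have "Cauchy (\<lambda>k. v k \<bullet> y)"
    proof (rule metric_CauchyI)
      fix e :: real assume e: "e > 0"
      have "(\<lambda>n. (C + 1) * norm (f n - y)) \<longlonglongrightarrow> (C + 1) * 0"
        using f(2) by (intro tendsto_mult tendsto_const) (simp add: LIM_zero_iff tendsto_norm_zero)
      then have "\<forall>\<^sub>F n in sequentially. (C + 1) * norm (f n - y) < e / 3"
        using order_tendstoD(2)[of _ "0::real" _ "e / 3"] e by auto
      then obtain n where n: "(C + 1) * norm (f n - y) < e / 3"
        by (auto simp: eventually_sequentially)
      have near: "\<bar>v k \<bullet> y - v k \<bullet> f n\<bar> < e / 3" for k
      proof -
        have "\<bar>v k \<bullet> (y - f n)\<bar> \<le> norm (v k) * norm (y - f n)" by (rule Cauchy_Schwarz_ineq2)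
        also have "\<dots> \<le> (C + 1) * norm (f n - y)"
          using vC[of k] by (simp add: norm_minus_commute mult_right_mono)
        finally show ?thesis using n by (simp add: inner_diff_right)
      qed
      have "Cauchy (\<lambda>k. v k \<bullet> f n)" using f(1) by (simp add: Y_def convergent_Cauchy)
      then obtain N where N: "\<And>i j. i \<ge> N \<Longrightarrow> j \<ge> N \<Longrightarrow> dist (v i \<bullet> f n) (v j \<bullet> f n) < e / 3"
        using e unfolding Cauchy_def by (metis divide_pos_pos zero_less_numeral)
      have "dist (v i \<bullet> y) (v j \<bullet> y) < e" if "i \<ge> N" "j \<ge> N" for i j
        using N[OF that] near[of i] near[of j] unfolding dist_real_def by linarith
      then show "\<exists>M. \<forall>i\<ge>M. \<forall>j\<ge>M. dist (v i \<bullet> y) (v j \<bullet> y) < e" by blast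
    qed
    then show "y \<in> Y" by (simp add: Y_def Cauchy_convergent_iff)
  qed
  have Yall: "y \<in> Y" for y
  proof -
    obtain p where p: "p \<in> Y" "y - p \<in> Y\<^sup>\<bottom>"
      using orthogonal_decomposition[OF subY \<open>closed Y\<close>] by blast
    have "v k \<bullet> (y - p) = 0" for k
      using p(2) uY[of "diagseq k"]
      by (auto simp: orthogonal_comp_iff v_def inner_commute[of "u (diagseq k)"])
    then have "y - p \<in> Y" by (simp add: Y_def convergent_const)
    from subspace_add[OF subY this p(1)] show ?thesis by simp
  qed
  define f where "f y = lim (\<lambda>k. v k \<bullet> y)" for y
  have f: "(\<lambda>k. v k \<bullet> y) \<longlonglongrightarrow> f y" for y
    using Yall[of y] by (simp add: Y_def f_def convergent_LIMSEQ_iff)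
  have "bounded_linear f"
  proof (rule bounded_linear_intro[of _ C])
    show "f (y + y') = f y + f y'" for y y'
      by (rule LIMSEQ_unique[OF f]) (use tendsto_add[OF f f] in \<open>simp add: inner_add_right\<close>)
    show "f (c *\<^sub>R y) = c *\<^sub>R f y" for c y
      by (rule LIMSEQ_unique[OF f]) (use tendsto_mult[OF tendsto_const f] in simp)
    show "norm (f y) \<le> norm y * C" for y
    proof (rule LIMSEQ_le_const2[OF tendsto_norm[OF f]], intro exI allI impI)
      fix k
      show "norm (v k \<bullet> y) \<le> norm y * C"
        using order_trans[OF Cauchy_Schwarz_ineq2[of "v k" y] mult_right_mono[OF vC norm_ge_zero]]
        by (simp add: mult.commute)
    qed
  qed
  then obtain l where "\<And>y. f y = y \<bullet> l" using riesz_representation by blast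
  then have "weakly_converges v l"
    using f by (simp add: weakly_converges_def inner_commute)
  then show ?thesis using that[OF subseq_diagseq] by (simp add: v_def)
qed

lemma weakly_converges_if_unique_cluster_point:
  fixes u :: "nat \<Rightarrow> 'a::{real_inner,complete_space}"
  assumes bd: "bounded (range u)"
    and uniq: "\<And>r l'. strict_mono r \<Longrightarrow> weakly_converges (u \<circ> r) l' \<Longrightarrow> l' = l"
  shows "weakly_converges u l"
  unfolding weakly_converges_def
proof (rule allI, rule ccontr)
  fix y assume "\<not> (\<lambda>k. u k \<bullet> y) \<longlonglongrightarrow> l \<bullet> y"
  then obtain e where e: "e > 0" "\<forall>N. \<exists>n\<ge>N. \<not> dist (u n \<bullet> y) (l \<bullet> y) < e"
    unfolding lim_sequentially by blast
  then have "infinite {n. \<not> dist (u n \<bullet> y) (l \<bullet> y) < e}"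
    unfolding infinite_nat_iff_unbounded_le by blast
  from infinite_enumerate[OF this] obtain r :: "nat \<Rightarrow> nat"
    where "strict_mono r" "\<forall>n. r n \<in> {n. \<not> dist (u n \<bullet> y) (l \<bullet> y) < e}" by blast
  then have r: "strict_mono r" "\<And>n. \<not> dist (u (r n) \<bullet> y) (l \<bullet> y) < e" by auto
  have "bounded (range (u \<circ> r))" by (rule bounded_subset[OF bd]) auto
  then obtain s l' where s: "strict_mono s" "weakly_converges ((u \<circ> r) \<circ> s) l'"
    by (rule bounded_imp_weakly_convergent_subseq)
  then have "l' = l" using uniq[of "r \<circ> s"] r(1) by (simp add: strict_mono_o o_assoc)
  then have "(\<lambda>n. u (r (s n)) \<bullet> y) \<longlonglongrightarrow> l \<bullet> y"
    using s(2) by (simp add: weakly_converges_def)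
  then obtain N where "\<And>n. n \<ge> N \<Longrightarrow> dist (u (r (s n)) \<bullet> y) (l \<bullet> y) < e"
    using e(1) unfolding lim_sequentially by blast
  then show False using r(2) by blast
qed

text \<open>
Opial's lemma. Two weak cluster points coincide because the difference of the squared distances
to them converges, whereas it would have different limits along the two subsequences.
\<close>

lemma opial:
  fixes z :: "nat \<Rightarrow> 'a::{real_inner,complete_space}"
  assumes "F \<noteq> {}"
    and conv: "\<And>w. w \<in> F \<Longrightarrow> convergent (\<lambda>k. norm (z k - w))"
    and cluster: "\<And>r l. strict_mono r \<Longrightarrow> weakly_converges (z \<circ> r) l \<Longrightarrow> l \<in> F"
  shows "bounded (range z) \<and> (\<exists>l\<in>F. weakly_converges z l)"
proof -
  obtain w where w: "w \<in> F" using assms(1) by blast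
  have "bounded (range (\<lambda>k. norm (z k - w)))"
    using conv[OF w] convergent_imp_bounded unfolding convergent_def by blast
  then have "bounded (range (\<lambda>k. z k - w))" by (auto simp: bounded_iff)
  then obtain C where "\<And>k. norm (z k - w) \<le> C" by (auto simp: bounded_iff)
  then have "norm (z k) \<le> C + norm w" for k
    by (metis add_right_mono diff_add_cancel norm_triangle_ineq order_trans)
  then have bd: "bounded (range z)" by (auto simp: bounded_iff)
  then obtain r l where rl: "strict_mono r" "weakly_converges (z \<circ> r) l"
    by (rule bounded_imp_weakly_convergent_subseq)
  have lF: "l \<in> F" by (rule cluster[OF rl])
  have "weakly_converges z l"
  proof (rule weakly_converges_if_unique_cluster_point[OF bd])
    fix s l' assume s: "strict_mono s" "weakly_converges (z \<circ> s) l'"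
    have l'F: "l' \<in> F" by (rule cluster[OF s])
    \<comment> \<open>the difference of the two squared distances is affine in \<open>z k\<close>\<close>
    have eq: "z k \<bullet> (l - l') = ((norm (z k - l'))\<^sup>2 - (norm (z k - l))\<^sup>2 + l \<bullet> l - l' \<bullet> l') / 2" for k
      by (simp add: power2_norm_eq_inner inner_diff_left inner_diff_right inner_commute)
    obtain a b where "(\<lambda>k. norm (z k - l')) \<longlonglongrightarrow> a" "(\<lambda>k. norm (z k - l)) \<longlonglongrightarrow> b"
      using conv[OF lF] conv[OF l'F] by (auto simp: convergent_def)
    then have "(\<lambda>k. z k \<bullet> (l - l')) \<longlonglongrightarrow> (a\<^sup>2 - b\<^sup>2 + l \<bullet> l - l' \<bullet> l') / 2"
      unfolding eq by (intro tendsto_intros) auto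
    then have "((\<lambda>k. z k \<bullet> (l - l')) \<circ> r) \<longlonglongrightarrow> (a\<^sup>2 - b\<^sup>2 + l \<bullet> l - l' \<bullet> l') / 2"
      "((\<lambda>k. z k \<bullet> (l - l')) \<circ> s) \<longlonglongrightarrow> (a\<^sup>2 - b\<^sup>2 + l \<bullet> l - l' \<bullet> l') / 2"
      using rl(1) s(1) LIMSEQ_subseq_LIMSEQ by blast+
    moreover have "((\<lambda>k. z k \<bullet> (l - l')) \<circ> r) \<longlonglongrightarrow> l \<bullet> (l - l')"
      "((\<lambda>k. z k \<bullet> (l - l')) \<circ> s) \<longlonglongrightarrow> l' \<bullet> (l - l')"
      using rl(2) s(2) by (simp_all add: weakly_converges_def o_def)
    ultimately have "l \<bullet> (l - l') = l' \<bullet> (l - l')" using LIMSEQ_unique by metis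
    then have "(l - l') \<bullet> (l - l') = 0" by (simp add: inner_diff_left)
    then show "l' = l" by simp
  qed
  then show ?thesis using bd lF by blast
qed

text \<open>
Cocoercivity gives two monotone quantities: the distance to any zero decreases by at least
\<open>\<lambda>\<^sub>k(2\<beta> - \<lambda>\<^sub>k)\<parallel>F z\<^sup>k\<parallel>\<^sup>2\<close> in square, and \<open>\<parallel>F z\<^sup>k\<parallel>\<close> itself decreases. Summing the first, a positive
lower bound on the second would bound the divergent series.
\<close>

theorem cocoercive_forward_iteration:
  fixes F :: "'a::{real_inner,complete_space} \<Rightarrow> 'a"
  assumes \<beta>: "\<beta> > 0"
    and coc: "\<And>u v. \<beta> * (norm (F u - F v))\<^sup>2 \<le> (u - v) \<bullet> (F u - F v)"
    and zero: "F w = 0"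
    and lam: "\<And>k. 0 \<le> lam k" "\<And>k. lam k \<le> 2 * \<beta>"
    and diverge: "\<And>C. \<exists>n. C < (\<Sum>k<n. lam k * (2 * \<beta> - lam k))"
    and step: "\<And>k. z (Suc k) = z k - lam k *\<^sub>R F (z k)"
  shows "bounded (range z) \<and> (\<exists>zs. F zs = 0 \<and> weakly_converges z zs) \<and> (\<lambda>k. F (z k)) \<longlonglongrightarrow> 0"
proof -
  have fejer: "(norm (z (Suc k) - v))\<^sup>2 \<le> (norm (z k - v))\<^sup>2 - lam k * (2 * \<beta> - lam k) * (norm (F (z k)))\<^sup>2"
    if v: "F v = 0" for v k
  proof -
    have "(norm (z (Suc k) - v))\<^sup>2
        = (norm (z k - v))\<^sup>2 - 2 * lam k * ((z k - v) \<bullet> F (z k)) + (lam k)\<^sup>2 * (norm (F (z k)))\<^sup>2"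
      unfolding step power2_norm_eq_inner
      by (simp add: inner_diff_left inner_diff_right inner_commute algebra_simps power2_eq_square)
    moreover have "2 * lam k * (\<beta> * (norm (F (z k)))\<^sup>2) \<le> 2 * lam k * ((z k - v) \<bullet> F (z k))"
      using coc[of "z k" v] v lam by (intro mult_left_mono) auto
    ultimately show ?thesis by (simp add: algebra_simps power2_eq_square)
  qed
  have nonneg: "0 \<le> lam k * (2 * \<beta> - lam k)" for k using lam[of k] by simp
  have dec: "norm (F (z (Suc k))) \<le> norm (F (z k))" for k
  proof (cases "lam k = 0")
    case True
    then show ?thesis by (simp add: step)
  next
    case False
    then have l: "lam k > 0" using lam(1)[of k] by simp
    define D where "D = F (z (Suc k)) - F (z k)"
    have "\<beta> * (norm D)\<^sup>2 \<le> - lam k * (F (z k) \<bullet> D)"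
      using coc[of "z (Suc k)" "z k"] by (simp add: D_def step)
    moreover have "lam k * (norm D)\<^sup>2 \<le> 2 * \<beta> * (norm D)\<^sup>2"
      using lam(2) by (intro mult_right_mono) auto
    ultimately have "lam k * (2 * (F (z k) \<bullet> D) + (norm D)\<^sup>2) \<le> 0" by (simp add: algebra_simps)
    then have "2 * (F (z k) \<bullet> D) + (norm D)\<^sup>2 \<le> 0" using l by (simp add: mult_le_0_iff)
    moreover have "(norm (F (z (Suc k))))\<^sup>2 = (norm (F (z k)))\<^sup>2 + (2 * (F (z k) \<bullet> D) + (norm D)\<^sup>2)"
      by (simp add: D_def power2_norm_eq_inner inner_diff_left inner_diff_right inner_commute)
    ultimately have "(norm (F (z (Suc k))))\<^sup>2 \<le> (norm (F (z k)))\<^sup>2" by simp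
    then show ?thesis by (rule power2_le_imp_le) simp
  qed
  have dec': "norm (F (z n)) \<le> norm (F (z m))" if "m \<le> n" for m n
    using that by (induction n rule: dec_induct) (auto intro: order_trans[OF dec])
  have small: "\<exists>m. norm (F (z m)) < e" if e: "e > 0" for e
  proof (rule ccontr)
    assume "\<not> ?thesis"
    then have ge: "e\<^sup>2 \<le> (norm (F (z m)))\<^sup>2" for m
      using e by (intro power_mono) (auto simp: not_less)
    have "e\<^sup>2 * (\<Sum>k<n. lam k * (2 * \<beta> - lam k)) \<le> (norm (z 0 - w))\<^sup>2 - (norm (z n - w))\<^sup>2" for n
    proof (induction n)
      case (Suc n)
      have "lam n * (2 * \<beta> - lam n) * e\<^sup>2 \<le> lam n * (2 * \<beta> - lam n) * (norm (F (z n)))\<^sup>2"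
        using ge nonneg by (rule mult_left_mono)
      then show ?case using Suc fejer[OF zero, of n] by (simp add: algebra_simps)
    qed simp
    then have "e\<^sup>2 * (\<Sum>k<n. lam k * (2 * \<beta> - lam k)) \<le> (norm (z 0 - w))\<^sup>2" for n
      by (smt (verit) zero_le_power2)
    then have "(\<Sum>k<n. lam k * (2 * \<beta> - lam k)) \<le> (norm (z 0 - w))\<^sup>2 / e\<^sup>2" for n
      using e by (simp add: pos_le_divide_eq mult.commute)
    then show False using diverge[of "(norm (z 0 - w))\<^sup>2 / e\<^sup>2"] by (meson not_less)
  qed
  have null: "(\<lambda>k. F (z k)) \<longlonglongrightarrow> 0"
    unfolding lim_sequentially dist_norm using small dec' by (metis diff_zero order_le_less_trans)
  have "bounded (range z) \<and> (\<exists>l\<in>{v. F v = 0}. weakly_converges z l)"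
  proof (rule opial)
    show "{v. F v = 0} \<noteq> {}" using zero by blast
  next
    fix v assume "v \<in> {v. F v = 0}"
    then have v: "F v = 0" by simp
    have "norm (z (Suc k) - v) \<le> norm (z k - v)" for k
    proof (rule power2_le_imp_le)
      show "(norm (z (Suc k) - v))\<^sup>2 \<le> (norm (z k - v))\<^sup>2"
        using fejer[OF v, of k] mult_nonneg_nonneg[OF nonneg zero_le_power2, of k "norm (F (z k))"]
        by linarith
    qed simp
    then have "decseq (\<lambda>k. norm (z k - v))" by (simp add: decseq_Suc_iff)
    then obtain a where "(\<lambda>k. norm (z k - v)) \<longlonglongrightarrow> a"
      by (rule decseq_convergent[of _ 0]) auto
    then show "convergent (\<lambda>k. norm (z k - v))" by (rule convergentI)
  next
    fix r l assume r: "strict_mono r" and wl: "weakly_converges (z \<circ> r) l"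
    \<comment> \<open>cocoercivity makes \<open>F\<close> demiclosed\<close>
    have Fr: "(\<lambda>k. F (z (r k))) \<longlonglongrightarrow> 0"
      using LIMSEQ_subseq_LIMSEQ[OF null r] by (simp add: o_def)
    have w0: "weakly_converges (\<lambda>k. z (r k) - l) (l - l)"
      using weakly_converges_diff[OF wl tendsto_imp_weakly_converges[OF tendsto_const[of l]]] by (simp add: o_def)
    have "(\<lambda>k. (z (r k) - l) \<bullet> (F (z (r k)) - F l)) \<longlonglongrightarrow> (l - l) \<bullet> (0 - F l)"
      by (intro weak_strong_inner_tendsto[OF w0] tendsto_intros Fr)
    moreover have "(\<lambda>k. \<beta> * (norm (F (z (r k)) - F l))\<^sup>2) \<longlonglongrightarrow> \<beta> * (norm (0 - F l))\<^sup>2"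
      by (intro tendsto_intros Fr)
    ultimately have "\<beta> * (norm (0 - F l))\<^sup>2 \<le> (l - l) \<bullet> (0 - F l)"
      using coc by (intro LIMSEQ_le) auto
    then show "l \<in> {v. F v = 0}" using \<beta> by (simp add: mult_le_0_iff)
  qed
  then show ?thesis using null by blast
qed

section \<open>Quadratic forms of operators that vanish on a subspace\<close>

lemma adj_diff:
  fixes S T :: "'a::{real_inner,complete_space} \<Rightarrow>\<^sub>L 'b::real_inner"
  shows "adj (S - T) = adj S - adj T"
  by (rule adj_eqI) (simp add: blinfun.diff_left inner_diff_left inner_diff_right adj_inner)

lemma norm_adj_le:
  fixes T :: "'a::{real_inner,complete_space} \<Rightarrow>\<^sub>L 'b::real_inner"
  shows "norm (adj T y) \<le> norm T * norm y"
proof -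
  have "(norm (adj T y))\<^sup>2 = T (adj T y) \<bullet> y" by (simp add: power2_norm_eq_inner adj_inner)
  also have "\<dots> \<le> norm (T (adj T y)) * norm y" by (rule norm_cauchy_schwarz)
  also have "\<dots> \<le> (norm T * norm (adj T y)) * norm y" by (intro mult_right_mono norm_blinfun) simp
  finally have "norm (adj T y) * norm (adj T y) \<le> (norm T * norm y) * norm (adj T y)"
    by (simp add: power2_eq_square mult_ac)
  then show ?thesis
    by (cases "norm (adj T y) = 0") (simp_all add: mult_le_cancel_right)
qed

lemma symm_part_apply: "symm_part L x = (1/2) *\<^sub>R (L x + adj L x)"
  by (simp add: symm_part_def blinfun.bilinear_simps)

lemma symm_part_selfadjoint:
  fixes L :: "'a::{real_inner,complete_space} \<Rightarrow>\<^sub>L 'a"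
  shows "selfadjoint (symm_part L)"
  by (simp add: selfadjoint_iff symm_part_apply inner_add_left inner_add_right adj_inner adj_inner_left)

lemma symm_part_quadratic:
  fixes L :: "'a::{real_inner,complete_space} \<Rightarrow>\<^sub>L 'a"
  shows "symm_part L x \<bullet> x = L x \<bullet> x"
  using adj_inner_left[of L x x] inner_commute[of x "L x"]
  by (simp add: symm_part_apply inner_add_left)

lemma vanishing_apply:
  fixes T :: "'a::{real_inner,complete_space} \<Rightarrow>\<^sub>L 'b::real_normed_vector"
  assumes D: "subspace D" "closed D" and T: "\<And>x. x \<in> D \<Longrightarrow> T x = 0"
  shows "T (x - proj D x) = T x"
  using T[OF proj_in[OF D]] by (simp add: blinfun.diff_right)

lemma vanishing_quadratic:
  fixes T :: "'a::{real_inner,complete_space} \<Rightarrow>\<^sub>L 'a"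
  assumes D: "subspace D" "closed D" and T: "\<And>x. x \<in> D \<Longrightarrow> T x = 0" "selfadjoint T"
  shows "T (x - proj D x) \<bullet> (x - proj D x) = T x \<bullet> x"
  using selfadjointD[OF T(2), of x "proj D x"] T(1)[OF proj_in[OF D]]
  by (simp add: blinfun.diff_right inner_diff_right)

text \<open>
Collects what the square root and its Moore--Penrose inverse require, for the operators at hand:
a form that vanishes on \<open>D\<close> and controls the distance to \<open>D\<close>.
\<close>

lemma vanishing_strongly_monotone:
  fixes T :: "'a::{real_inner,complete_space} \<Rightarrow>\<^sub>L 'a"
  assumes D: "subspace D" "closed D" and T: "\<And>x. x \<in> D \<Longrightarrow> T x = 0" "selfadjoint T"
    and c: "c > 0" "\<And>x. c * (norm (x - proj D x))\<^sup>2 \<le> T x \<bullet> x"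
  shows "ker T = D" "positive_op T" "strongly_monotone_on ((ker T)\<^sup>\<bottom>) T"
proof -
  show k: "ker T = D"
  proof
    show "ker T \<subseteq> D"
    proof
      fix x assume "x \<in> ker T"
      then have "c * (norm (x - proj D x))\<^sup>2 \<le> 0" using c(2)[of x] by (simp add: ker_def)
      then have "x = proj D x" using c(1) by (simp add: mult_le_0_iff)
      then show "x \<in> D" using proj_in[OF D] by metis
    qed
  qed (use T in \<open>auto simp: ker_def\<close>)
  have "0 \<le> c * (norm (x - proj D x))\<^sup>2" for x using c(1) by simp
  then show "positive_op T"
    unfolding positive_op_def using c(2) order_trans by blast
  show "strongly_monotone_on ((ker T)\<^sup>\<bottom>) T"
    unfolding strongly_monotone_on_def k
  proof (intro exI[of _ c] conjI ballI)
    fix x assume "x \<in> D\<^sup>\<bottom>"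
    then show "c * (norm x)\<^sup>2 \<le> T x \<bullet> x" using c(2)[of x] by (simp add: proj_zero[OF D])
  qed (rule c(1))
qed

text \<open>
Equal kernels allow \<open>M\<^sup>* = M\<^sup>* K \<Xi>\<^sup>1\<^sup>/\<^sup>2\<close> with \<open>K\<close> the Moore--Penrose inverse of \<open>\<Xi>\<^sup>1\<^sup>/\<^sup>2\<close>, and \<open>M\<^sup>* K\<close>
is the adjoint of \<open>K M\<close>. This is the origin of the norm in the step bound.
\<close>

lemma norm_adj_le_mp_inverse_sqrt:
  fixes \<Xi> :: "'a::{real_inner,complete_space} \<Rightarrow>\<^sub>L 'a" and M :: "'b::{real_inner,complete_space} \<Rightarrow>\<^sub>L 'a"
  assumes \<Xi>: "selfadjoint \<Xi>" "positive_op \<Xi>" "strongly_monotone_on ((ker \<Xi>)\<^sup>\<bottom>) \<Xi>"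
    and ker: "ker \<Xi> = ker (adj M)"
  shows "(norm (adj M x))\<^sup>2 \<le> (norm (mp_inverse (sqrt_op \<Xi>) o\<^sub>L M))\<^sup>2 * (\<Xi> x \<bullet> x)"
proof -
  let ?K = "mp_inverse (sqrt_op \<Xi>)"
  note K = mp_inverse_sqrt_op[OF \<Xi>]
  have "adj M x = adj M (x - proj (ker \<Xi>) x)"
    using proj_in[OF ker_subspace ker_closed, of "adj M" x] ker
    by (simp add: blinfun.diff_right) (simp add: ker_def)
  also have "\<dots> = adj (?K o\<^sub>L M) (sqrt_op \<Xi> x)"
    using K by (simp add: adj_compose selfadjoint_def)
  finally have "norm (adj M x) \<le> norm (?K o\<^sub>L M) * norm (sqrt_op \<Xi> x)"
    using norm_adj_le by metis
  then have "(norm (adj M x))\<^sup>2 \<le> (norm (?K o\<^sub>L M) * norm (sqrt_op \<Xi> x))\<^sup>2"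
    by (rule power_mono) simp
  then show ?thesis by (simp add: power_mult_distrib norm_sqrt_op_square[OF \<Xi>(1,2)])
qed

text \<open>
Substituting \<open>u = H\<^sup>1\<^sup>/\<^sup>2x\<close> undoes the two Moore--Penrose inverses, so the bound on \<open>\<lambda>\<^sub>m\<^sub>a\<^sub>x\<close> reads
\<open>\<langle>D x, x\<rangle> \<le> c \<langle>H x, x\<rangle>\<close> with \<open>c < 1\<close>.
\<close>

lemma lambda_max_less_1_imp_strongly_monotone:
  fixes H D :: "'a::{real_inner,complete_space} \<Rightarrow>\<^sub>L 'a"
  assumes H: "selfadjoint H" "strongly_monotone_on ((ker H)\<^sup>\<bottom>) H"
    and D: "selfadjoint D" "\<And>x. x \<in> ker H \<Longrightarrow> D x = 0"
    and less: "lambda_max (mp_inverse (sqrt_op H) o\<^sub>L D o\<^sub>L mp_inverse (sqrt_op H)) < 1"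
  obtains c where "c > 0" "\<And>x. c * (norm (x - proj (ker H) x))\<^sup>2 \<le> (H - D) x \<bullet> x"
proof -
  note ks = ker_subspace[of H] ker_closed[of H]
  obtain \<alpha> where \<alpha>: "\<alpha> > 0" "\<And>x. x \<in> (ker H)\<^sup>\<bottom> \<Longrightarrow> \<alpha> * (norm x)\<^sup>2 \<le> H x \<bullet> x"
    using H(2) unfolding strongly_monotone_on_def by blast
  have Hlow: "\<alpha> * (norm (x - proj (ker H) x))\<^sup>2 \<le> H x \<bullet> x" for x
  proof -
    have "H (x - proj (ker H) x) \<bullet> (x - proj (ker H) x) = H x \<bullet> x"
      by (rule vanishing_quadratic[OF ks _ H(1)]) (simp add: ker_def)
    then show ?thesis using \<alpha>(2)[OF proj_residual[OF ks, of x]] by simp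
  qed
  note pos = vanishing_strongly_monotone(2)[OF ks _ H(1) \<alpha>(1) Hlow]
  have pH: "positive_op H" by (rule pos) (simp add: ker_def)
  define K where "K = mp_inverse (sqrt_op H)"
  note K = mp_inverse_sqrt_op[OF H(1) pH H(2), folded K_def]
  obtain c where c: "lambda_max (K o\<^sub>L D o\<^sub>L K) \<le> ereal c" "c < 1"
  proof -
    obtain e where "lambda_max (K o\<^sub>L D o\<^sub>L K) < e" "e < (1::ereal)"
      using less dense unfolding K_def by blast
    \<comment> \<open>a number strictly above the supremum is real even on the zero space, where the supremum is \<open>-\<infinity>\<close>\<close>
    then show ?thesis using that by (cases e) (auto intro: less_imp_le)
  qed
  have unit: "D (K u) \<bullet> K u \<le> c" if "norm u = 1" for u
  proof -
    have "ereal ((K o\<^sub>L D o\<^sub>L K) u \<bullet> u) \<le> lambda_max (K o\<^sub>L D o\<^sub>L K)"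
      unfolding lambda_max_def by (rule SUP_upper) (use that in simp)
    also note c(1)
    finally show ?thesis using selfadjointD[OF K(1)] by simp
  qed
  have all: "D (K u) \<bullet> K u \<le> c * (norm u)\<^sup>2" for u
  proof (cases "u = 0")
    case False
    have "D (K ((1 / norm u) *\<^sub>R u)) \<bullet> K ((1 / norm u) *\<^sub>R u) \<le> c"
      using False by (intro unit) simp
    then show ?thesis using False
      by (simp add: blinfun.scaleR_right field_simps power2_eq_square)
  qed simp
  have "(1 - c) * \<alpha> * (norm (x - proj (ker H) x))\<^sup>2 \<le> (H - D) x \<bullet> x" for x
  proof -
    have "D x \<bullet> x = D (K (sqrt_op H x)) \<bullet> K (sqrt_op H x)"
      using vanishing_quadratic[OF ks D(2,1), of x] K(2) by simp
    also have "\<dots> \<le> c * (norm (sqrt_op H x))\<^sup>2" by (rule all)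
    finally have "D x \<bullet> x \<le> c * (H x \<bullet> x)" by (simp add: norm_sqrt_op_square[OF H(1) pH])
    moreover have "(1 - c) * (\<alpha> * (norm (x - proj (ker H) x))\<^sup>2) \<le> (1 - c) * (H x \<bullet> x)"
      using Hlow c(2) by (intro mult_left_mono) auto
    ultimately show ?thesis
      by (simp add: blinfun.diff_left inner_diff_left algebra_simps)
  qed
  moreover have "(1 - c) * \<alpha> > 0" using c(2) \<alpha>(1) by simp
  ultimately show ?thesis using that by blast
qed

section \<open>Generalized Schur complements\<close>

context
  fixes D :: "'a::{real_inner,complete_space} set" and T :: "'a \<Rightarrow>\<^sub>L 'a"
  assumes D: "subspace D" "closed D" and T: "selfadjoint T"
begin

lemma blk_apply:
  "blk11 D T x = proj D (T (proj D x))"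
  "blk12 D T x = proj D (T (x - proj D x))"
  "blk21 D T x = T (proj D x) - proj D (T (proj D x))"
  "blk22 D T x = T (x - proj D x) - proj D (T (x - proj D x))"
  by (simp_all add: blk11_def blk12_def blk21_def blk22_def proj_orthogonal_comp[OF D])

lemma blk_inner:
  "blk11 D T x \<bullet> y = T (proj D x) \<bullet> proj D y"
  "blk12 D T x \<bullet> y = T (x - proj D x) \<bullet> proj D y"
  "blk21 D T x \<bullet> y = T (proj D x) \<bullet> (y - proj D y)"
  "blk22 D T x \<bullet> y = T (x - proj D x) \<bullet> (y - proj D y)"
  by (simp_all add: blk_apply inner_diff_left inner_diff_right proj_selfadjoint[OF D])

lemma schur22_eq_schur11: "schur22 D T = schur11 (D\<^sup>\<bottom>) T"
  by (simp add: schur22_def schur11_def blk11_def blk12_def blk21_def blk22_def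
      orthogonal_comp_comp[OF D])

lemma schur11_vanishes: "x \<in> D \<Longrightarrow> schur11 D T x = 0"
  by (simp add: schur11_def blinfun.diff_left blk_apply proj_id[OF D])

lemma blk11_selfadjoint: "selfadjoint (blk11 D T)"
  unfolding selfadjoint_iff by (metis blk_inner(1) inner_commute selfadjointD[OF T])

lemma blk12_adjoint: "blk21 D T x \<bullet> y = x \<bullet> blk12 D T y"
  by (metis blk_inner(2,3) inner_commute selfadjointD[OF T])

context
  assumes cl: "closed (range (blk11 D T))"
begin

lemma schur11_selfadjoint: "selfadjoint (schur11 D T)"
proof -
  note K = mp_inverse_selfadjoint(3)[OF blk11_selfadjoint cl]
  have "blk22 D T x \<bullet> y = x \<bullet> blk22 D T y" for x y
    by (metis blk_inner(4) inner_commute selfadjointD[OF T])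
  moreover have "blk21 D T (mp_inverse (blk11 D T) (blk12 D T x)) \<bullet> y
      = x \<bullet> blk21 D T (mp_inverse (blk11 D T) (blk12 D T y))" for x y
    by (metis blk12_adjoint selfadjointD[OF K] inner_commute)
  ultimately show ?thesis
    by (simp add: selfadjoint_iff schur11_def blinfun.diff_left inner_diff_left inner_diff_right)
qed

text \<open>
Completing the square: with \<open>u\<close> a solution of \<open>T\<^sub>1\<^sub>1 u = T\<^sub>1\<^sub>2 x\<close>, which exists by the range inclusion,
the difference of the two forms is \<open>\<langle>T\<^sub>1\<^sub>1(x + u), x + u\<rangle>\<close>.
\<close>

lemma schur11_le:
  assumes pos: "positive_op (blk11 D T)" and rg: "range (blk12 D T) \<subseteq> range (blk11 D T)"
  shows "schur11 D T x \<bullet> x \<le> T x \<bullet> x"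
proof -
  define u where "u = mp_inverse (blk11 D T) (blk12 D T x)"
  have "blk12 D T x \<in> range (blk11 D T)" using rg by blast
  then have u: "blk11 D T u = blk12 D T x"
    unfolding u_def mp_inverse_selfadjoint(1)[OF blk11_selfadjoint cl]
    by (rule proj_id[OF range_subspace cl])
  have "schur11 D T x \<bullet> x = blk22 D T x \<bullet> x - u \<bullet> blk11 D T u"
    by (simp add: schur11_def blinfun.diff_left inner_diff_left blk12_adjoint u flip: u_def)
  moreover have "T x \<bullet> x = blk11 D T x \<bullet> x + 2 * (blk11 D T u \<bullet> x) + blk22 D T x \<bullet> x"
  proof -
    have "T x \<bullet> proj D x = T (proj D x) \<bullet> x"
      by (metis inner_commute selfadjointD[OF T])
    then show ?thesis
      by (simp add: u blk_inner blinfun.diff_right inner_diff_left inner_diff_right)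
  qed
  ultimately have "T x \<bullet> x - schur11 D T x \<bullet> x = blk11 D T (x + u) \<bullet> (x + u)"
    using selfadjointD[OF blk11_selfadjoint, of x u]
    by (simp add: blinfun.add_right inner_add_left inner_add_right inner_commute)
  then show ?thesis using pos unfolding positive_op_def by (metis diff_ge_0_iff_ge)
qed

end

lemma blk11_strongly_monotone:
  assumes sm: "strongly_monotone_on D (blk11 D T)"
  shows "positive_op (blk11 D T)" "closed (range (blk11 D T))" "range (blk11 D T) = D"
proof -
  obtain c where c: "c > 0" "\<And>x. x \<in> D \<Longrightarrow> c * (norm x)\<^sup>2 \<le> blk11 D T x \<bullet> x"
    using sm unfolding strongly_monotone_on_def by blast
  have D': "subspace (D\<^sup>\<bottom>)" "closed (D\<^sup>\<bottom>)" by (rule subspace_orthogonal_comp closed_orthogonal_comp)+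
  have vz: "x \<in> D\<^sup>\<bottom> \<Longrightarrow> blk11 D T x = 0" for x by (simp add: blk_apply proj_zero[OF D])
  have low: "c * (norm (x - proj (D\<^sup>\<bottom>) x))\<^sup>2 \<le> blk11 D T x \<bullet> x" for x
    using c(2)[OF proj_in[OF D], of x]
    by (simp add: proj_orthogonal_comp[OF D] blk_inner proj_id[OF D proj_in[OF D]])
  note v = vanishing_strongly_monotone[OF D' vz blk11_selfadjoint c(1) low]
  show "positive_op (blk11 D T)" by (rule v(2))
  show cl: "closed (range (blk11 D T))" by (rule closed_range_if_strongly_monotone[OF v(3)])
  show "range (blk11 D T) = D"
    using closed_range_eq_orthogonal_ker_adj[OF cl] blk11_selfadjoint v(1)
    by (simp add: selfadjoint_def orthogonal_comp_comp[OF D])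
qed

text \<open>
A form whose \<open>D\<^sup>\<bottom>\<close> block is positive is weakly lower semicontinuous along sequences whose \<open>D\<close>
component converges strongly: dropping the \<open>D\<^sup>\<bottom>\<close> block of the error leaves terms that are all
products of a weakly and a strongly convergent factor.
\<close>

lemma blk22_weakly_lsc:
  assumes pos: "positive_op (blk22 D T)" and e: "weakly_converges e l"
    and conv: "convergent (\<lambda>k. proj D (e k))"
  obtains g where "g \<longlonglongrightarrow> l \<bullet> T l" "\<And>k. g k \<le> e k \<bullet> T (e k)"
proof -
  define d where "d k = e k - l" for k
  have d: "weakly_converges d 0"
    using weakly_converges_diff[OF e tendsto_imp_weakly_converges[OF tendsto_const[of l]]]
    by (simp add: d_def[abs_def])
  have d1: "(\<lambda>k. proj D (d k)) \<longlonglongrightarrow> 0"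
  proof -
    obtain m where m: "(\<lambda>k. proj D (e k)) \<longlonglongrightarrow> m" using conv by (auto simp: convergent_def)
    have "m = proj D l"
      using weakly_converges_unique[OF tendsto_imp_weakly_converges[OF m] weakly_converges_blinfun[OF e]] .
    then have "(\<lambda>k. proj D (e k) - proj D l) \<longlonglongrightarrow> 0" using m by (simp add: LIM_zero_iff)
    then show ?thesis by (simp add: d_def blinfun.diff_right)
  qed
  define g where "g k = l \<bullet> T l + 2 * (d k \<bullet> T l) + 2 * (d k \<bullet> T (proj D (d k))) - proj D (d k) \<bullet> T (proj D (d k))" for k
  have Td1: "(\<lambda>k. T (proj D (d k))) \<longlonglongrightarrow> 0"
    using blinfun.tendsto[OF tendsto_const d1, of T] by simp
  have "g \<longlonglongrightarrow> l \<bullet> T l + 2 * (0 \<bullet> T l) + 2 * (0 \<bullet> (0::'a)) - 0 \<bullet> (0::'a)"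
    unfolding g_def
    by (intro tendsto_add tendsto_diff tendsto_mult tendsto_const weak_strong_inner_tendsto[OF d]
        tendsto_inner[OF d1 Td1] Td1)
  moreover have "g k \<le> e k \<bullet> T (e k)" for k
  proof -
    have "blk22 D T (d k) \<bullet> d k \<ge> 0" using pos by (simp add: positive_op_def)
    moreover have "e k = l + d k" by (simp add: d_def)
    moreover have "l \<bullet> T (d k) = d k \<bullet> T l" "T (d k) \<bullet> proj D (d k) = d k \<bullet> T (proj D (d k))"
      "T (proj D (d k)) \<bullet> d k = d k \<bullet> T (proj D (d k))" "T (d k) \<bullet> d k = d k \<bullet> T (d k)"
      "T (proj D (d k)) \<bullet> proj D (d k) = proj D (d k) \<bullet> T (proj D (d k))"
      using selfadjointD[OF T] by (metis inner_commute)+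
    ultimately show ?thesis
      by (simp add: g_def blk_inner blinfun.diff_right blinfun.add_right inner_diff_left inner_diff_right
          inner_add_left inner_add_right)
  qed
  ultimately show ?thesis using that by simp
qed

end

section \<open>The warped resolvent and its dual residual\<close>

text \<open>
The term linear in \<open>t\<close> is absorbed into half of the quadratic one.
\<close>

lemma quadratic_inequality_null:
  fixes t s r :: "nat \<Rightarrow> real"
  assumes a: "a > 0" and le: "\<And>k. a * (t k)\<^sup>2 \<le> s k + r k * t k"
    and s: "s \<longlonglongrightarrow> 0" and r: "r \<longlonglongrightarrow> 0"
  shows "t \<longlonglongrightarrow> 0"
proof -
  have "(\<lambda>k. (t k)\<^sup>2) \<longlonglongrightarrow> 0"
  proof (rule Lim_null_comparison)
    have "(\<lambda>k. 2 / a * (s k + (r k)\<^sup>2 / (2 * a))) \<longlonglongrightarrow> 2 / a * (0 + 0\<^sup>2 / (2 * a))"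
      using a by (intro tendsto_intros s r) auto
    then show "(\<lambda>k. 2 / a * (s k + (r k)\<^sup>2 / (2 * a))) \<longlonglongrightarrow> 0" by simp
    have "(t k)\<^sup>2 \<le> 2 / a * (s k + (r k)\<^sup>2 / (2 * a))" for k
    proof -
      have "0 \<le> (a * t k - r k)\<^sup>2" by simp
      then have "2 * a * (r k * t k) \<le> a\<^sup>2 * (t k)\<^sup>2 + (r k)\<^sup>2"
        by (simp add: power2_eq_square algebra_simps)
      moreover have "2 * a * (a * (t k)\<^sup>2) \<le> 2 * a * (s k + r k * t k)"
        using le a by (intro mult_left_mono) auto
      ultimately have "a\<^sup>2 * (t k)\<^sup>2 \<le> 2 * a * s k + (r k)\<^sup>2"
        by (simp add: power2_eq_square algebra_simps)
      then show ?thesis using a by (simp add: field_simps power2_eq_square)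
    qed
    then show "\<forall>\<^sub>F k in sequentially. norm ((t k)\<^sup>2) \<le> 2 / a * (s k + (r k)\<^sup>2 / (2 * a))"
      by simp
  qed
  then have "(\<lambda>k. sqrt ((t k)\<^sup>2)) \<longlonglongrightarrow> sqrt 0" by (rule tendsto_real_sqrt)
  then show ?thesis by (simp add: tendsto_rabs_zero_iff)
qed

text \<open>
The form of maximality used to close graphs: a pair related to the whole graph could be added to
it, so it is already there.
\<close>

lemma maximally_comonotone_mem:
  assumes max: "maximally_comonotone V A"
    and mono: "\<And>x' y'. y' \<in> A x' \<Longrightarrow> (y - y') \<bullet> V (y - y') \<le> (x - x') \<bullet> (y - y')"
  shows "y \<in> A x"
proof (rule ccontr)
  assume n: "y \<notin> A x"
  define A' where "A' = (\<lambda>u. if u = x then insert y (A x) else A u)"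
  have gra: "gra A' = insert (x, y) (gra A)" by (auto simp: gra_def A'_def split: if_splits)
  have sm: "semimonotone 0 V A" using max by (simp add: maximally_semimonotone_def)
  have flip: "(y' - y) \<bullet> V (y' - y) \<le> (x' - x) \<bullet> (y' - y)" if "y' \<in> A x'" for x' y'
  proof -
    have "V (y' - y) = - V (y - y')" by (simp add: blinfun.diff_right)
    moreover have "y' - y = - (y - y')" "x' - x = - (x - x')" by simp_all
    ultimately show ?thesis using mono[OF that] by (metis inner_minus_left inner_minus_right minus_minus)
  qed
  have "semimonotone 0 V A'"
    using sm mono flip unfolding semimonotone_def gra by (auto simp: gra_def)
  moreover have "gra A \<subset> gra A'" using n by (auto simp: gra) (auto simp: gra_def)
  ultimately show False using max by (auto simp: maximally_semimonotone_def)
qed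

text \<open>
The part of the problem on which the convergence proof depends. The two alternatives for \<open>A\<close>, \<open>B\<close>
and \<open>V\<close> enter only through the inequality \<open>monotone\<close>, where \<open>Q\<close> stands for \<open>L\<^sub>s - \<Theta>\<close>. The operator
\<open>\<Xi>\<close> is a lower bound of \<open>\<gamma> U + Q\<close> that no longer involves the component in \<open>ker (adj M)\<close>.
\<close>

locale warped_resolvent =
  fixes A :: "'h::{real_inner,complete_space} \<Rightarrow> 'h set"
    and B :: "'k::{real_inner,complete_space} \<Rightarrow> 'k"
    and P :: "'k \<Rightarrow>\<^sub>L 'h" and R :: "'h \<Rightarrow>\<^sub>L 'k"
    and M :: "'g::{real_inner,complete_space} \<Rightarrow>\<^sub>L 'h" and b :: 'g
    and L :: "'h \<Rightarrow>\<^sub>L 'h" and q :: 'h and \<gamma> :: real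
    and U Q \<Xi> :: "'h \<Rightarrow>\<^sub>L 'h" and c :: real
  assumes closed_range: "closed (range M)"
    and gamma_pos: "\<gamma> > 0"
    and L_block: "L ` ker (adj M) \<subseteq> (ker (adj M))\<^sup>\<bottom>"
    and feasible: "\<exists>xbar. adj M xbar = b \<and> L xbar - q \<in> (ker (adj M))\<^sup>\<bottom>"
    and single_valued: "\<And>w. w \<in> (ker (adj M))\<^sup>\<bottom> \<Longrightarrow> \<exists>!x. x \<in> Phi A B P R L q \<gamma> w"
    and Xi_selfadjoint: "selfadjoint \<Xi>"
    and Xi_vanishes: "\<And>x. x \<in> ker (adj M) \<Longrightarrow> \<Xi> x = 0"
    and c_pos: "c > 0"
    and Xi_lower: "\<And>x. c * (norm (x - proj (ker (adj M)) x))\<^sup>2 \<le> \<Xi> x \<bullet> x"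
    and Xi_upper: "\<And>x. \<Xi> x \<bullet> x \<le> \<gamma> * (U x \<bullet> x) + Q x \<bullet> x"
    and monotone: "\<And>w w' x x'. w \<in> (ker (adj M))\<^sup>\<bottom> \<Longrightarrow> w' \<in> (ker (adj M))\<^sup>\<bottom> \<Longrightarrow>
      x \<in> Phi A B P R L q \<gamma> w \<Longrightarrow> x' \<in> Phi A B P R L q \<gamma> w' \<Longrightarrow>
      \<gamma> * (U (x - x') \<bullet> (x - x')) + Q (x - x') \<bullet> (x - x') \<le> (w - w') \<bullet> (x - x')"
begin

abbreviation \<Omega> where "\<Omega> \<equiv> ker (adj M)"
abbreviation \<Phi> where "\<Phi> \<equiv> Phi A B P R L q \<gamma>"

text \<open>
The selection of the single value of \<open>\<Phi>\<close>, and the residual map, which is the single-valued form of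
the operator \<open>Psi\<close>. Their values are meaningful because \<open>M z\<close> always lies in \<open>\<Omega>\<^sup>\<bottom>\<close>.
\<close>

definition J where "J w = (THE x. x \<in> \<Phi> w)"
definition F where "F z = adj M (J (M z)) - b"

lemmas \<Omega>_closed_subspace = ker_subspace[of "adj M"] ker_closed[of "adj M"]

lemma range_M: "range M = \<Omega>\<^sup>\<bottom>"
  by (rule closed_range_eq_orthogonal_ker_adj[OF closed_range])

lemma M_in: "M z \<in> \<Omega>\<^sup>\<bottom>"
  using range_M by blast

lemma J_in: "w \<in> \<Omega>\<^sup>\<bottom> \<Longrightarrow> J w \<in> \<Phi> w"
  unfolding J_def by (rule theI') (rule single_valued)

lemma J_eq: "w \<in> \<Omega>\<^sup>\<bottom> \<Longrightarrow> x \<in> \<Phi> w \<Longrightarrow> J w = x"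
  using J_in single_valued by blast

lemma residual_gap:
  "(M z - M z') \<bullet> (J (M z) - J (M z')) = (z - z') \<bullet> (F z - F z')"
  by (simp add: F_def inner_diff_left inner_diff_right adj_inner blinfun.diff_right)

lemma monotone_residual:
  defines "\<delta> \<equiv> \<lambda>z z'. J (M z) - J (M z')"
  shows "\<gamma> * (U (\<delta> z z') \<bullet> \<delta> z z') + Q (\<delta> z z') \<bullet> \<delta> z z' \<le> (z - z') \<bullet> (F z - F z')"
proof -
  show ?thesis
    using monotone[OF M_in M_in J_in[OF M_in] J_in[OF M_in], of z z'] by (simp add: \<delta>_def residual_gap)
qed

lemma Xi_le_residual:
  "\<Xi> (J (M z) - J (M z')) \<bullet> (J (M z) - J (M z')) \<le> (z - z') \<bullet> (F z - F z')"
  using monotone_residual Xi_upper order_trans by blast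

lemmas Xi_props = vanishing_strongly_monotone[OF \<Omega>_closed_subspace Xi_vanishes Xi_selfadjoint c_pos Xi_lower]

lemma residual_cocoercive:
  "(norm (F z - F z'))\<^sup>2 \<le> (norm (mp_inverse (sqrt_op \<Xi>) o\<^sub>L M))\<^sup>2 * ((z - z') \<bullet> (F z - F z'))"
proof -
  let ?N = "(norm (mp_inverse (sqrt_op \<Xi>) o\<^sub>L M))\<^sup>2"
  have "(norm (adj M (J (M z) - J (M z'))))\<^sup>2
      \<le> ?N * (\<Xi> (J (M z) - J (M z')) \<bullet> (J (M z) - J (M z')))"
    by (rule norm_adj_le_mp_inverse_sqrt[OF Xi_selfadjoint Xi_props(2,3,1)])
  also have "\<dots> \<le> ?N * ((z - z') \<bullet> (F z - F z'))"
    by (intro mult_left_mono Xi_le_residual) simp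
  finally show ?thesis by (simp add: F_def blinfun.diff_right)
qed

text \<open>
Feasible points differ by elements of \<open>\<Omega>\<close>, which \<open>L\<close> maps into \<open>\<Omega>\<^sup>\<bottom>\<close>; so one suitable feasible point
makes all of them suitable. A dual point \<open>z\<close> and a normal vector \<open>n\<close> at \<open>x\<close> are exchanged through
\<open>M z = L x - q - \<gamma> n\<close>, and this is the reason why both sides of that equation lie in \<open>\<Omega>\<^sup>\<bottom>\<close>.
\<close>

lemma warp_orthogonal: "adj M x = b \<Longrightarrow> L x - q \<in> \<Omega>\<^sup>\<bottom>"
proof -
  assume x: "adj M x = b"
  obtain xb where xb: "adj M xb = b" "L xb - q \<in> \<Omega>\<^sup>\<bottom>" using feasible by blast
  have "x - xb \<in> \<Omega>" using x xb(1) by (simp add: ker_def blinfun.diff_right)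
  then have "L (x - xb) \<in> \<Omega>\<^sup>\<bottom>" using L_block by blast
  from subspace_add[OF subspace_orthogonal_comp this xb(2)] show ?thesis
    by (simp add: blinfun.diff_right)
qed

lemma solution_imp_residual_zero:
  assumes "x \<in> zer (incl_op A B P R M b)"
  obtains z where "F z = 0"
proof -
  obtain a n where an: "0 = a + P (B (R x)) + n" "a \<in> A x" "n \<in> normal_cone {x. adj M x = b} x"
    using assms by (auto simp: zer_def incl_op_def)
  then have x: "adj M x = b" and n: "n \<in> \<Omega>\<^sup>\<bottom>"
    by (auto simp: normal_cone_affine split: if_splits)
  have "L x - q - \<gamma> *\<^sub>R n \<in> \<Omega>\<^sup>\<bottom>"
    using warp_orthogonal[OF x] n subspace_diff subspace_scale subspace_orthogonal_comp by blast
  then obtain z where z: "M z = L x - q - \<gamma> *\<^sub>R n" using range_M by (metis imageE)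
  have n_eq: "n = - (a + P (B (R x)))" using add.inverse_unique[OF an(1)[symmetric]] by simp
  have "x \<in> \<Phi> (M z)"
    unfolding Phi_def using an(2) by (auto simp: z n_eq algebra_simps intro!: bexI[of _ a])
  then have "F z = 0" by (simp add: F_def J_eq[OF M_in] x)
  then show ?thesis by (rule that)
qed

lemma residual_zero_imp_solution:
  assumes "F z = 0"
  shows "J (M z) \<in> zer (incl_op A B P R M b)"
proof -
  define x where "x = J (M z)"
  have x: "adj M x = b" using assms by (simp add: F_def x_def)
  obtain a where a: "a \<in> A x" "M z + q = \<gamma> *\<^sub>R a + \<gamma> *\<^sub>R P (B (R x)) + L x"
    using J_in[OF M_in, of z] by (auto simp: Phi_def x_def)
  define n where "n = (1 / \<gamma>) *\<^sub>R (L x - q - M z)"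
  have "L x - q - M z \<in> \<Omega>\<^sup>\<bottom>" using warp_orthogonal[OF x] M_in subspace_diff subspace_orthogonal_comp by blast
  then have "n \<in> \<Omega>\<^sup>\<bottom>" unfolding n_def by (rule subspace_scale[OF subspace_orthogonal_comp])
  then have "n \<in> normal_cone {x. adj M x = b} x" by (simp add: normal_cone_affine x)
  moreover have "\<gamma> *\<^sub>R (a + P (B (R x)) + n) = 0"
    using a(2) gamma_pos by (simp add: n_def algebra_simps)
  then have "0 = a + P (B (R x)) + n" using gamma_pos by simp
  ultimately show ?thesis using a(1) unfolding zer_def incl_op_def x_def[symmetric] by blast
qed

text \<open>
If the operator in the step bound vanishes, the step bound is infinite, but then cocoercivity
makes the residual constant, hence zero, and the sequence does not move.
\<close>

lemma dual_iteration:
  fixes lam :: "nat \<Rightarrow> real"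
  assumes solvable: "zer (incl_op A B P R M b) \<noteq> {}"
    and lam_range: "\<And>k. 0 \<le> lam k" "\<And>k. ereal (lam k) \<le> 2 * step_bound \<Xi> M"
    and lam_sum: "(\<Sum>k. ereal (lam k) * (2 * step_bound \<Xi> M - ereal (lam k))) = \<infinity>"
    and step: "\<And>k. z (Suc k) = z k - lam k *\<^sub>R F (z k)"
  shows "bounded (range z) \<and> (\<exists>zs. F zs = 0 \<and> weakly_converges z zs) \<and> (\<lambda>k. F (z k)) \<longlonglongrightarrow> 0"
proof -
  define N where "N = norm (mp_inverse (sqrt_op \<Xi>) o\<^sub>L M)"
  obtain z0 where z0: "F z0 = 0" using solvable solution_imp_residual_zero by blast
  have coc: "(norm (F u - F v))\<^sup>2 \<le> N\<^sup>2 * ((u - v) \<bullet> (F u - F v))" for u v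
    unfolding N_def by (rule residual_cocoercive)
  show ?thesis
  proof (cases "N = 0")
    case True
    then have F0: "F u = 0" for u using coc[of u z0] z0 by simp
    have "z k = z 0" for k by (induction k) (simp_all add: step F0)
    then obtain v where v: "z = (\<lambda>_. v)" by (metis ext)
    have "weakly_converges z v" unfolding v by (rule tendsto_imp_weakly_converges[OF tendsto_const])
    moreover have "bounded (range z)" unfolding v by simp
    ultimately show ?thesis using F0 by auto
  next
    case False
    then have N: "N\<^sup>2 > 0" by simp
    define \<beta> where "\<beta> = 1 / N\<^sup>2"
    have sb: "step_bound \<Xi> M = ereal \<beta>"
      using False unfolding step_bound_def N_def[symmetric] \<beta>_def
      by (simp add: power2_eq_square one_ereal_def)
    have nonneg: "0 \<le> lam k * (2 * \<beta> - lam k)" for k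
      using lam_range[of k] by (simp add: sb)
    show ?thesis
    proof (rule cocoercive_forward_iteration)
      show "\<beta> > 0" using N by (simp add: \<beta>_def)
      show "\<beta> * (norm (F u - F v))\<^sup>2 \<le> (u - v) \<bullet> (F u - F v)" for u v
        using coc[of u v] N by (simp add: \<beta>_def field_simps)
      show "lam k \<le> 2 * \<beta>" for k using lam_range(2)[of k] by (simp add: sb)
      show "\<exists>n. C < (\<Sum>k<n. lam k * (2 * \<beta> - lam k))" for C
      proof (rule ccontr)
        assume "\<not> ?thesis"
        then have "(\<Sum>k<n. ereal (lam k * (2 * \<beta> - lam k))) \<le> ereal C" for n
          by (simp add: not_less)
        then have "(\<Sum>k. ereal (lam k * (2 * \<beta> - lam k))) \<le> ereal C"
          using nonneg by (intro suminf_bound) auto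
        then show False using lam_sum by (simp add: sb)
      qed
    qed (fact z0 lam_range(1) step)+
  qed
qed

context
  fixes z :: "nat \<Rightarrow> 'g" and zs :: 'g
  assumes z_weak: "weakly_converges z zs"
    and residual_null: "(\<lambda>k. F (z k)) \<longlonglongrightarrow> 0"
    and zs: "F zs = 0"
begin

lemma gap_null: "(\<lambda>k. (z k - zs) \<bullet> (F (z k) - F zs)) \<longlonglongrightarrow> 0"
proof -
  have "weakly_converges (\<lambda>k. z k - zs) (zs - zs)"
    by (intro weakly_converges_diff z_weak tendsto_imp_weakly_converges tendsto_const)
  from weak_strong_inner_tendsto[OF this residual_null] show ?thesis by (simp add: zs)
qed

definition displacement where "displacement k = J (M (z k)) - J (M zs)"

text \<open>
The pairing of the dual error with the residual is a weakly null sequence against a strongly null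
one, and it dominates the form of \<open>\<Xi>\<close>.
\<close>

lemma complement_null: "(\<lambda>k. displacement k - proj \<Omega> (displacement k)) \<longlonglongrightarrow> 0"
proof -
  have "(\<lambda>k. (norm (displacement k - proj \<Omega> (displacement k)))\<^sup>2) \<longlonglongrightarrow> 0"
  proof (rule Lim_null_comparison)
    show "(\<lambda>k. (z k - zs) \<bullet> (F (z k) - F zs) / c) \<longlonglongrightarrow> 0"
      using tendsto_divide[OF gap_null tendsto_const[of c]] c_pos by simp
    have "c * (norm (displacement k - proj \<Omega> (displacement k)))\<^sup>2 \<le> (z k - zs) \<bullet> (F (z k) - F zs)" for k
      unfolding displacement_def by (rule order_trans[OF Xi_lower Xi_le_residual])
    then show "\<forall>\<^sub>F k in sequentially. norm ((norm (displacement k - proj \<Omega> (displacement k)))\<^sup>2)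
        \<le> (z k - zs) \<bullet> (F (z k) - F zs) / c"
      using c_pos by (simp add: pos_le_divide_eq mult.commute)
  qed
  from tendsto_real_sqrt[OF this] show ?thesis by (simp add: tendsto_norm_zero_iff)
qed

text \<open>
With the \<open>\<Omega>\<^sup>\<bottom>\<close> component null, the estimate \<open>monotone\<close> becomes a quadratic inequality for the norm
of the \<open>\<Omega>\<close> component whose other coefficients tend to \<open>0\<close>.
\<close>

lemma strong_convergence:
  assumes U: "selfadjoint U" "strongly_monotone_on \<Omega> U"
    and Q: "selfadjoint Q" "\<And>x. x \<in> \<Omega> \<Longrightarrow> Q x = 0"
  shows "(\<lambda>k. J (M (z k))) \<longlonglongrightarrow> J (M zs)"
proof -
  obtain \<alpha> where \<alpha>: "\<alpha> > 0" "\<And>x. x \<in> \<Omega> \<Longrightarrow> \<alpha> * (norm x)\<^sup>2 \<le> U x \<bullet> x"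
    using U(2) unfolding strongly_monotone_on_def by blast
  define e where "e k = displacement k - proj \<Omega> (displacement k)" for k
  define p where "p k = proj \<Omega> (displacement k)" for k
  have split_D: "displacement k = p k + e k" for k by (simp add: e_def p_def)
  have e0: "e \<longlonglongrightarrow> 0" unfolding e_def by (rule complement_null)
  have Ue: "(\<lambda>k. U (e k)) \<longlonglongrightarrow> 0" and Qe: "(\<lambda>k. Q (e k)) \<longlonglongrightarrow> 0"
    using blinfun.tendsto[OF tendsto_const e0, of U] blinfun.tendsto[OF tendsto_const e0, of Q] by simp_all
  define s where "s k = (z k - zs) \<bullet> (F (z k) - F zs) - \<gamma> * (U (e k) \<bullet> e k) - Q (e k) \<bullet> e k" for k
  have le: "(\<gamma> * \<alpha>) * (norm (p k))\<^sup>2 \<le> s k + (2 * \<gamma> * norm (U (e k))) * norm (p k)" for k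
  proof -
    have Q': "Q (e k) \<bullet> e k = Q (displacement k) \<bullet> displacement k"
      unfolding e_def by (rule vanishing_quadratic[OF \<Omega>_closed_subspace Q(2,1)])
    have "U (p k) \<bullet> e k = U (e k) \<bullet> p k" by (metis inner_commute selfadjointD[OF U(1)])
    then have U': "U (displacement k) \<bullet> displacement k = U (p k) \<bullet> p k + 2 * (U (e k) \<bullet> p k) + U (e k) \<bullet> e k"
      by (simp add: split_D blinfun.add_right inner_add_left inner_add_right)
    have "\<gamma> * (U (displacement k) \<bullet> displacement k) + Q (displacement k) \<bullet> displacement k \<le> (z k - zs) \<bullet> (F (z k) - F zs)"
      unfolding displacement_def by (rule monotone_residual)
    then have "\<gamma> * (U (p k) \<bullet> p k) \<le> s k - \<gamma> * (2 * (U (e k) \<bullet> p k))"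
      by (simp add: s_def U' Q' algebra_simps)
    moreover have "\<gamma> * (\<alpha> * (norm (p k))\<^sup>2) \<le> \<gamma> * (U (p k) \<bullet> p k)"
      using \<alpha>(2)[of "p k"] gamma_pos by (simp add: p_def proj_in[OF \<Omega>_closed_subspace])
    moreover have "\<gamma> * (- (U (e k) \<bullet> p k)) \<le> \<gamma> * (norm (U (e k)) * norm (p k))"
      using Cauchy_Schwarz_ineq2[of "U (e k)" "p k"] gamma_pos by (intro mult_left_mono) auto
    ultimately show ?thesis by (simp add: algebra_simps)
  qed
  have "(\<lambda>k. norm (p k)) \<longlonglongrightarrow> 0"
  proof (rule quadratic_inequality_null[OF _ le])
    show "\<gamma> * \<alpha> > 0" using gamma_pos \<alpha>(1) by simp
    have "s \<longlonglongrightarrow> 0 - \<gamma> * (0 \<bullet> (0::'h)) - 0 \<bullet> (0::'h)"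
      unfolding s_def
      by (intro tendsto_diff tendsto_mult tendsto_const gap_null tendsto_inner[OF Ue e0] tendsto_inner[OF Qe e0])
    then show "s \<longlonglongrightarrow> 0" by simp
    have "(\<lambda>k. 2 * \<gamma> * norm (U (e k))) \<longlonglongrightarrow> 2 * \<gamma> * norm (0::'h)" by (intro tendsto_intros Ue)
    then show "(\<lambda>k. 2 * \<gamma> * norm (U (e k))) \<longlonglongrightarrow> 0" by simp
  qed
  then have "p \<longlonglongrightarrow> 0" by (simp add: tendsto_norm_zero_iff)
  from tendsto_add[OF this e0] have "displacement \<longlonglongrightarrow> 0" by (simp flip: split_D)
  then show ?thesis by (simp add: displacement_def[abs_def] LIM_zero_iff)
qed

text \<open>
Keeping the cocoercivity term instead of spending it on a completed square bounds the squared
increment of \<open>B\<close> by null sequences, up to a factor linear in that increment, because \<open>P\<^sup>* - R\<close> sees only the \<open>\<Omega>\<^sup>\<bottom>\<close> component.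
\<close>

lemma forward_operator_converges:
  assumes A: "semimonotone 0 0 A" and L: "positive_op (symm_part L)"
    and PR: "\<Omega> \<subseteq> ker (adj P - R)"
    and coc: "\<omega> > 0" "\<And>u v. \<omega> * (norm (B u - B v))\<^sup>2 \<le> (u - v) \<bullet> (B u - B v)"
  shows "(\<lambda>k. B (R (J (M (z k))))) \<longlonglongrightarrow> B (R (J (M zs)))"
proof -
  define \<delta>B where "\<delta>B k = B (R (J (M (z k)))) - B (R (J (M zs)))" for k
  define v where "v k = (adj P - R) (displacement k)" for k
  have v0: "v \<longlonglongrightarrow> 0"
  proof -
    have "v k = (adj P - R) (displacement k - proj \<Omega> (displacement k))" for k
      unfolding v_def
      by (rule vanishing_apply[OF \<Omega>_closed_subspace, symmetric]) (use PR in \<open>auto simp: ker_def\<close>)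
    then have "v = (\<lambda>k. (adj P - R) (displacement k - proj \<Omega> (displacement k)))" by (rule ext)
    then show ?thesis
      using blinfun.tendsto[OF tendsto_const complement_null, of "adj P - R"] by simp
  qed
  have le: "(\<gamma> * \<omega>) * (norm (\<delta>B k))\<^sup>2
      \<le> (z k - zs) \<bullet> (F (z k) - F zs) + (\<gamma> * norm (v k)) * norm (\<delta>B k)" for k
  proof -
    obtain a where a: "a \<in> A (J (M (z k)))"
      "M (z k) + q = \<gamma> *\<^sub>R a + \<gamma> *\<^sub>R P (B (R (J (M (z k))))) + L (J (M (z k)))"
      using J_in[OF M_in, of "z k"] by (auto simp: Phi_def)
    obtain a' where a': "a' \<in> A (J (M zs))"
      "M zs + q = \<gamma> *\<^sub>R a' + \<gamma> *\<^sub>R P (B (R (J (M zs)))) + L (J (M zs))"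
      using J_in[OF M_in, of zs] by (auto simp: Phi_def)
    have "M (z k) - M zs = \<gamma> *\<^sub>R (a - a') + \<gamma> *\<^sub>R P (\<delta>B k) + L (displacement k)"
      using arg_cong2[OF a(2) a'(2), of "(-)"]
      by (simp add: \<delta>B_def displacement_def blinfun.diff_right algebra_simps)
    then have "(z k - zs) \<bullet> (F (z k) - F zs)
        = \<gamma> * ((a - a') \<bullet> displacement k) + \<gamma> * (P (\<delta>B k) \<bullet> displacement k) + L (displacement k) \<bullet> displacement k"
      unfolding residual_gap[symmetric] displacement_def[symmetric] by (simp add: inner_add_left)
    moreover have "0 \<le> \<gamma> * ((a - a') \<bullet> displacement k)"
    proof -
      have "0 \<le> (a - a') \<bullet> displacement k"
        using A a(1) a'(1) unfolding semimonotone_def gra_def displacement_def by (fastforce simp: inner_commute)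
      then show ?thesis using gamma_pos by simp
    qed
    moreover have "0 \<le> L (displacement k) \<bullet> displacement k"
      using L symm_part_quadratic[of L "displacement k"] by (metis positive_op_def)
    moreover have "P (\<delta>B k) \<bullet> displacement k = R (displacement k) \<bullet> \<delta>B k + v k \<bullet> \<delta>B k"
      using adj_inner_left[of P "displacement k" "\<delta>B k"] inner_commute[of "P (\<delta>B k)" "displacement k"]
      by (simp add: v_def blinfun.diff_left inner_diff_left)
    moreover have "\<omega> * (norm (\<delta>B k))\<^sup>2 \<le> R (displacement k) \<bullet> \<delta>B k"
      using coc(2) by (simp add: \<delta>B_def displacement_def blinfun.diff_right)
    then have "\<gamma> * (\<omega> * (norm (\<delta>B k))\<^sup>2) \<le> \<gamma> * (R (displacement k) \<bullet> \<delta>B k)"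
      using gamma_pos by (intro mult_left_mono) auto
    moreover have "\<gamma> * (- (v k \<bullet> \<delta>B k)) \<le> \<gamma> * (norm (v k) * norm (\<delta>B k))"
      using Cauchy_Schwarz_ineq2[of "v k" "\<delta>B k"] gamma_pos by (intro mult_left_mono) auto
    ultimately show ?thesis by (simp add: algebra_simps)
  qed
  have "(\<lambda>k. norm (\<delta>B k)) \<longlonglongrightarrow> 0"
  proof (rule quadratic_inequality_null[OF _ le gap_null])
    show "\<gamma> * \<omega> > 0" using gamma_pos coc(1) by simp
    show "(\<lambda>k. \<gamma> * norm (v k)) \<longlonglongrightarrow> 0"
      using tendsto_mult[OF tendsto_const tendsto_norm[OF v0], of \<gamma>] by simp
  qed
  then show ?thesis by (simp add: \<delta>B_def tendsto_norm_zero_iff LIM_zero_iff)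
qed

text \<open>
Let \<open>l\<close> be a weak cluster point. The values of \<open>A\<close> selected at the iterates converge weakly, and their
pairing with the iterates converges: each term of the pairing is a product of a weakly and a
strongly convergent factor, the quadratic term in \<open>L\<close> because \<open>L\<^sub>s\<close> vanishes on \<open>\<Omega>\<close>. The \<open>\<Omega>\<close>
component of those values even converges strongly, because \<open>L\<close> maps \<open>\<Omega>\<close> into \<open>\<Omega>\<^sup>\<bottom>\<close>; this gives lower
semicontinuity of the form of \<open>V\<close>. Maximality then puts \<open>l\<close> into \<open>\<Phi>(M zs)\<close>, which has one element.
\<close>

lemma weak_convergence:
  assumes max: "maximally_comonotone V A"
    and bd: "bounded (range (\<lambda>k. J (M (z k))))"
    and Ls: "ker (symm_part L) = \<Omega>"
    and V: "selfadjoint V" "positive_op (blk22 \<Omega> V)"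
    and coc: "\<omega> > 0" "\<And>u v. \<omega> * (norm (B u - B v))\<^sup>2 \<le> (u - v) \<bullet> (B u - B v)"
    and B: "(\<lambda>k. B (R (J (M (z k))))) \<longlonglongrightarrow> B (R (J (M zs)))"
  shows "weakly_converges (\<lambda>k. J (M (z k))) (J (M zs))"
proof (rule weakly_converges_if_unique_cluster_point[OF bd])
  fix r l assume r: "strict_mono r" and "weakly_converges ((\<lambda>k. J (M (z k))) \<circ> r) l"
  note l = this(2)
  define u where "u k = J (M (z (r k)))" for k
  have u: "weakly_converges u l" using l by (simp add: u_def[abs_def] o_def)
  have zr: "weakly_converges (\<lambda>k. z (r k)) zs"
    using weakly_converges_subseq[OF z_weak r] by (simp add: o_def)
  define a where "a k = (1 / \<gamma>) *\<^sub>R (M (z (r k)) + q - \<gamma> *\<^sub>R P (B (R (u k))) - L (u k))" for k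
  have aA: "a k \<in> A (u k)" for k
  proof -
    obtain a' where a': "a' \<in> A (u k)" "M (z (r k)) + q = \<gamma> *\<^sub>R a' + \<gamma> *\<^sub>R P (B (R (u k))) + L (u k)"
      using J_in[OF M_in, of "z (r k)"] by (auto simp: Phi_def u_def)
    have "a k = a'" unfolding a_def a'(2) using gamma_pos by simp
    then show ?thesis using a'(1) by simp
  qed
  define \<beta> where "\<beta> = B (R (J (M zs)))"
  define al where "al = (1 / \<gamma>) *\<^sub>R (M zs + q - \<gamma> *\<^sub>R P \<beta> - L l)"
  have B_u: "(\<lambda>k. B (R (u k))) \<longlonglongrightarrow> \<beta>"
    using LIMSEQ_subseq_LIMSEQ[OF B r] by (simp add: u_def \<beta>_def o_def)
  then have Bu: "(\<lambda>k. P (B (R (u k)))) \<longlonglongrightarrow> P \<beta>"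
    by (intro blinfun.tendsto tendsto_const)
  have B_l: "B (R l) = \<beta>"
  proof -
    have "weakly_converges (\<lambda>k. R (u k) - R l) (R l - R l)"
      by (intro weakly_converges_diff weakly_converges_blinfun u tendsto_imp_weakly_converges[OF tendsto_const])
    from weak_strong_inner_tendsto[OF this tendsto_diff[OF B_u tendsto_const]]
    have "(\<lambda>k. (R (u k) - R l) \<bullet> (B (R (u k)) - B (R l))) \<longlonglongrightarrow> 0" by simp
    moreover have "(\<lambda>k. \<omega> * (norm (B (R (u k)) - B (R l)))\<^sup>2) \<longlonglongrightarrow> \<omega> * (norm (\<beta> - B (R l)))\<^sup>2"
      by (intro tendsto_intros B_u)
    ultimately have "\<omega> * (norm (\<beta> - B (R l)))\<^sup>2 \<le> 0"
      using coc(2) by (intro LIMSEQ_le) auto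
    then show ?thesis using coc(1) by (simp add: mult_le_0_iff)
  qed
  have a_weak: "weakly_converges a al"
    unfolding a_def al_def
    by (intro weakly_converges_scaleR weakly_converges_diff weakly_converges_add
        weakly_converges_blinfun zr u tendsto_imp_weakly_converges[OF Bu]
        tendsto_imp_weakly_converges[OF tendsto_const])
  have adj_u: "(\<lambda>k. adj M (u k)) \<longlonglongrightarrow> b"
  proof -
    have "(\<lambda>k. F (z (r k))) \<longlonglongrightarrow> 0" using LIMSEQ_subseq_LIMSEQ[OF residual_null r] by (simp add: o_def)
    from tendsto_add[OF this tendsto_const[of b]] show ?thesis by (simp add: F_def u_def)
  qed
  have adj_l: "adj M l = b"
    by (rule weakly_converges_unique[OF weakly_converges_blinfun[OF u] tendsto_imp_weakly_converges[OF adj_u]])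
  have u_perp: "(\<lambda>k. u k - proj \<Omega> (u k)) \<longlonglongrightarrow> J (M zs) - proj \<Omega> (J (M zs))"
  proof -
    have "(\<lambda>k. displacement (r k) - proj \<Omega> (displacement (r k))) \<longlonglongrightarrow> 0"
      using LIMSEQ_subseq_LIMSEQ[OF complement_null r] by (simp add: o_def)
    from tendsto_add[OF this tendsto_const[of "J (M zs) - proj \<Omega> (J (M zs))"]]
    show ?thesis by (simp add: displacement_def u_def blinfun.diff_right)
  qed
  have a_conv: "convergent (\<lambda>k. proj \<Omega> (a k))"
  proof -
    have "proj \<Omega> (a k) = (1 / \<gamma>) *\<^sub>R (proj \<Omega> q - \<gamma> *\<^sub>R proj \<Omega> (P (B (R (u k))))
        - proj \<Omega> (L (u k - proj \<Omega> (u k))))" for k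
    proof -
      have "L (proj \<Omega> (u k)) \<in> \<Omega>\<^sup>\<bottom>" using L_block proj_in[OF \<Omega>_closed_subspace] by blast
      then show ?thesis
        by (simp add: a_def blinfun.bilinear_simps proj_zero[OF \<Omega>_closed_subspace] M_in)
    qed
    moreover have "(\<lambda>k. (1 / \<gamma>) *\<^sub>R (proj \<Omega> q - \<gamma> *\<^sub>R proj \<Omega> (P (B (R (u k))))
        - proj \<Omega> (L (u k - proj \<Omega> (u k))))) \<longlonglongrightarrow>
        (1 / \<gamma>) *\<^sub>R (proj \<Omega> q - \<gamma> *\<^sub>R proj \<Omega> (P \<beta>)
        - proj \<Omega> (L (J (M zs) - proj \<Omega> (J (M zs)))))"
      by (intro tendsto_scaleR tendsto_const tendsto_diff blinfun.tendsto Bu u_perp)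
    ultimately show ?thesis unfolding convergent_def by auto
  qed
  \<comment> \<open>the symmetric part of \<open>L\<close> sees only the \<open>\<Omega>\<^sup>\<bottom>\<close> component, for which \<open>u_perp\<close> holds\<close>
  have Ls_u: "(\<lambda>k. symm_part L (u k)) \<longlonglongrightarrow> symm_part L l"
  proof -
    have "symm_part L (v - proj \<Omega> v) = symm_part L v" for v
      by (rule vanishing_apply[OF \<Omega>_closed_subspace]) (use Ls in \<open>auto simp: ker_def\<close>)
    then have "(\<lambda>k. symm_part L (u k)) \<longlonglongrightarrow> symm_part L (J (M zs))"
      using blinfun.tendsto[OF tendsto_const[of "symm_part L"] u_perp] by simp
    moreover from this have "symm_part L (J (M zs)) = symm_part L l"
      by (rule weakly_converges_unique[OF tendsto_imp_weakly_converges weakly_converges_blinfun[OF u]])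
    ultimately show ?thesis by simp
  qed
  have ua: "(\<lambda>k. u k \<bullet> a k) \<longlonglongrightarrow> l \<bullet> al"
  proof -
    have "u k \<bullet> a k = (1 / \<gamma>) * (z (r k) \<bullet> adj M (u k) + u k \<bullet> q
        - \<gamma> * (u k \<bullet> P (B (R (u k)))) - u k \<bullet> symm_part L (u k))" for k
      using symm_part_quadratic[of L "u k"]
      by (simp add: a_def adj_inner inner_diff_right inner_add_right inner_commute)
    moreover have "l \<bullet> al = (1 / \<gamma>) * (zs \<bullet> b + l \<bullet> q - \<gamma> * (l \<bullet> P \<beta>) - l \<bullet> symm_part L l)"
      using symm_part_quadratic[of L l] adj_l[symmetric]
      by (simp add: al_def adj_inner inner_diff_right inner_add_right inner_commute)
    ultimately show ?thesis
      by (simp only:) (intro tendsto_mult tendsto_const tendsto_diff tendsto_add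
        weak_strong_inner_tendsto[OF zr adj_u] weak_strong_inner_tendsto[OF u tendsto_const]
        weak_strong_inner_tendsto[OF u Bu] weak_strong_inner_tendsto[OF u Ls_u])
  qed
  have "al \<in> A l"
  proof (rule maximally_comonotone_mem[OF max])
    fix x' y' assume y': "y' \<in> A x'"
    have e: "weakly_converges (\<lambda>k. a k - y') (al - y')"
      by (intro weakly_converges_diff a_weak tendsto_imp_weakly_converges[OF tendsto_const])
    have "convergent (\<lambda>k. proj \<Omega> (a k - y'))"
      unfolding blinfun.diff_right by (intro convergent_diff a_conv convergent_const)
    then obtain g where g: "g \<longlonglongrightarrow> (al - y') \<bullet> V (al - y')" "\<And>k. g k \<le> (a k - y') \<bullet> V (a k - y')"
      using blk22_weakly_lsc[OF \<Omega>_closed_subspace V e] by blast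
    have lim: "(\<lambda>k. (u k - x') \<bullet> (a k - y')) \<longlonglongrightarrow> (l - x') \<bullet> (al - y')"
    proof -
      have "(\<lambda>k. u k \<bullet> a k - u k \<bullet> y' - (x' \<bullet> a k - x' \<bullet> y')) \<longlonglongrightarrow> l \<bullet> al - l \<bullet> y' - (x' \<bullet> al - x' \<bullet> y')"
        using u a_weak unfolding inner_commute[of x']
        by (intro tendsto_diff tendsto_const ua) (auto simp: weakly_converges_def)
      then show ?thesis by (simp add: inner_diff_left inner_diff_right algebra_simps)
    qed
    show "(al - y') \<bullet> V (al - y') \<le> (l - x') \<bullet> (al - y')"
    proof (rule LIMSEQ_le[OF g(1) lim], intro exI allI impI)
      fix k
      have "semimonotone 0 V A" using max by (simp add: maximally_semimonotone_def)
      then have "(a k - y') \<bullet> V (a k - y') \<le> (u k - x') \<bullet> (a k - y')"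
        using aA[of k] y' unfolding semimonotone_def gra_def by fastforce
      then show "g k \<le> (u k - x') \<bullet> (a k - y')" using g(2) order_trans by blast
    qed
  qed
  moreover have "M zs + q = \<gamma> *\<^sub>R al + \<gamma> *\<^sub>R P (B (R l)) + L l"
    using gamma_pos by (simp add: al_def B_l)
  ultimately have "l \<in> \<Phi> (M zs)" by (auto simp: Phi_def)
  then show "l = J (M zs)" using J_eq[OF M_in] by simp
qed

end

end

section \<open>The monotonicity estimate in the two cases\<close>

lemma strongly_monotone_inv:
  fixes W :: "'k::{real_inner,complete_space} \<Rightarrow>\<^sub>L 'k"
  assumes W: "selfadjoint W" "strongly_monotone_on UNIV W"
  shows "W (inv (blinfun_apply W) y) = y"
  using strongly_monotone_surj[OF W] by (simp add: surj_f_inv_f)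

text \<open>
With \<open>w = W\<^sup>-\<^sup>1(B u - B v)\<close>, the form of \<open>W\<^sup>-\<^sup>1\<close> at \<open>B u - B v = W w\<close> is \<open>\<langle>W w, w\<rangle> \<ge> \<alpha>\<parallel>w\<parallel>\<^sup>2\<close>, and \<open>\<parallel>W w\<parallel>\<close> is at
most a multiple of \<open>\<parallel>w\<parallel>\<close>.
\<close>

lemma inv_cocoercive_lower:
  fixes W :: "'k::{real_inner,complete_space} \<Rightarrow>\<^sub>L 'k"
  assumes W: "selfadjoint W" "strongly_monotone_on UNIV W" and B: "inv_cocoercive W B"
  obtains \<omega> where "\<omega> > 0" "\<And>u v. \<omega> * (norm (B u - B v))\<^sup>2 \<le> (u - v) \<bullet> (B u - B v)"
proof -
  obtain \<alpha> where \<alpha>: "\<alpha> > 0" "\<And>x. \<alpha> * (norm x)\<^sup>2 \<le> W x \<bullet> x"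
    using W(2) unfolding strongly_monotone_on_def by blast
  define N where "N = (norm W)\<^sup>2 + 1"
  have N: "N > 0" by (simp add: N_def add_nonneg_pos)
  have "\<alpha> / N * (norm (B u - B v))\<^sup>2 \<le> (u - v) \<bullet> (B u - B v)" for u v
  proof -
    define w where "w = inv (blinfun_apply W) (B u - B v)"
    have w: "W w = B u - B v" unfolding w_def by (rule strongly_monotone_inv[OF W])
    have "(norm (W w))\<^sup>2 \<le> (norm W * norm w)\<^sup>2" by (intro power_mono norm_blinfun) simp
    also have "\<dots> \<le> N * (norm w)\<^sup>2" by (simp add: N_def power_mult_distrib mult_right_mono)
    finally have "\<alpha> / N * (norm (W w))\<^sup>2 \<le> \<alpha> / N * (N * (norm w)\<^sup>2)"
      using \<alpha>(1) N by (intro mult_left_mono) auto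
    also have "\<dots> = \<alpha> * (norm w)\<^sup>2" using N by simp
    also have "\<dots> \<le> W w \<bullet> w" by (rule \<alpha>(2))
    also have "\<dots> \<le> (u - v) \<bullet> (B u - B v)"
      using B unfolding inv_cocoercive_def w by (simp add: w_def)
    finally show ?thesis by (simp add: w)
  qed
  moreover have "\<alpha> / N > 0" using \<alpha>(1) N by simp
  ultimately show ?thesis using that by blast
qed

text \<open>
Completing the square in the metric of \<open>W\<close>: with \<open>W w = B x - B x'\<close> the defect is the form of \<open>W\<close> at
\<open>w + v / 2\<close>. In the application \<open>v\<close> measures the mismatch between \<open>P\<^sup>*\<close> and \<open>R\<close>.
\<close>

lemma inv_cocoercive_perturbed:
  fixes W :: "'k::{real_inner,complete_space} \<Rightarrow>\<^sub>L 'k"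
  assumes W: "selfadjoint W" "strongly_monotone_on UNIV W" and B: "inv_cocoercive W B"
  shows "- (W v \<bullet> v) / 4 \<le> (x - x') \<bullet> (B x - B x') + (B x - B x') \<bullet> v"
proof -
  define w where "w = inv (blinfun_apply W) (B x - B x')"
  have w: "W w = B x - B x'" unfolding w_def by (rule strongly_monotone_inv[OF W])
  have pos: "0 \<le> W u \<bullet> u" for u
  proof -
    obtain \<alpha> where \<alpha>: "\<alpha> > 0" "\<And>x. \<alpha> * (norm x)\<^sup>2 \<le> W x \<bullet> x"
      using W(2) unfolding strongly_monotone_on_def by blast
    have "0 \<le> \<alpha> * (norm u)\<^sup>2" using \<alpha>(1) by simp
    then show ?thesis using \<alpha>(2) order_trans by blast
  qed
  have "W v \<bullet> w = W w \<bullet> v" by (metis inner_commute selfadjointD[OF W(1)])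
  then have "W (w + (1/2) *\<^sub>R v) \<bullet> (w + (1/2) *\<^sub>R v) = W w \<bullet> w + W w \<bullet> v + (W v \<bullet> v) / 4"
    by (simp add: blinfun.add_right blinfun.scaleR_right inner_add_left inner_add_right add_divide_distrib)
  moreover have "W w \<bullet> w \<le> (x - x') \<bullet> (B x - B x')"
    using B unfolding inv_cocoercive_def w by (simp add: w_def)
  ultimately show ?thesis using pos[of "w + (1/2) *\<^sub>R v"] w by simp
qed

lemma Theta_I_inner:
  fixes P :: "'k::{real_inner,complete_space} \<Rightarrow>\<^sub>L 'h::{real_inner,complete_space}"
  shows "Theta_I P R W \<gamma> x \<bullet> y = \<gamma> / 4 * (W ((adj P - R) x) \<bullet> (adj P - R) y)"
proof -
  have "adj (P - adj R) = adj P - R" by (simp add: adj_diff adj_adj)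
  then have "(P - adj R) u \<bullet> y = u \<bullet> (adj P - R) y" for u
    by (metis adj_inner)
  then show ?thesis by (simp add: Theta_I_def blinfun.scaleR_left)
qed

lemma Theta_I_selfadjoint:
  fixes P :: "'k::{real_inner,complete_space} \<Rightarrow>\<^sub>L 'h::{real_inner,complete_space}"
  assumes "selfadjoint W"
  shows "selfadjoint (Theta_I P R W \<gamma>)"
  unfolding selfadjoint_iff
  by (metis Theta_I_inner inner_commute selfadjointD[OF assms])

lemma Theta_II_inner:
  fixes L :: "'h::{real_inner,complete_space} \<Rightarrow>\<^sub>L 'h"
  shows "Theta_II \<Omega> L V \<gamma> x \<bullet> y = - (schur22 \<Omega> V (L x) \<bullet> L y) / \<gamma>"
  by (simp add: Theta_II_def blinfun.minus_left blinfun.scaleR_left adj_inner_left)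

lemma monotone_estimate_cocoercive:
  fixes P :: "'k::{real_inner,complete_space} \<Rightarrow>\<^sub>L 'h::{real_inner,complete_space}"
  assumes \<gamma>: "\<gamma> > 0" and A: "semimonotone U 0 A"
    and W: "selfadjoint W" "strongly_monotone_on UNIV W" and B: "inv_cocoercive W B"
    and x: "x \<in> Phi A B P R L q \<gamma> w" and x': "x' \<in> Phi A B P R L q \<gamma> w'"
  shows "\<gamma> * (U (x - x') \<bullet> (x - x')) + (symm_part L - Theta_I P R W \<gamma>) (x - x') \<bullet> (x - x')
    \<le> (w - w') \<bullet> (x - x')"
proof -
  obtain a where a: "a \<in> A x" "w + q = \<gamma> *\<^sub>R a + \<gamma> *\<^sub>R P (B (R x)) + L x"
    using x by (auto simp: Phi_def)
  obtain a' where a': "a' \<in> A x'" "w' + q = \<gamma> *\<^sub>R a' + \<gamma> *\<^sub>R P (B (R x')) + L x'"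
    using x' by (auto simp: Phi_def)
  define \<delta> where "\<delta> = x - x'"
  define \<delta>B where "\<delta>B = B (R x) - B (R x')"
  define v where "v = (adj P - R) \<delta>"
  have "w - w' = \<gamma> *\<^sub>R (a - a') + \<gamma> *\<^sub>R P \<delta>B + L \<delta>"
    using arg_cong2[OF a(2) a'(2), of "(-)"]
    by (simp add: \<delta>B_def \<delta>_def blinfun.diff_right algebra_simps)
  then have eq: "(w - w') \<bullet> \<delta> = \<gamma> * ((a - a') \<bullet> \<delta>) + \<gamma> * (P \<delta>B \<bullet> \<delta>) + L \<delta> \<bullet> \<delta>"
    by (simp add: inner_add_left)
  have "U \<delta> \<bullet> \<delta> \<le> (a - a') \<bullet> \<delta>"
    using A a(1) a'(1) unfolding semimonotone_def gra_def \<delta>_def by (fastforce simp: inner_commute)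
  then have 1: "\<gamma> * (U \<delta> \<bullet> \<delta>) \<le> \<gamma> * ((a - a') \<bullet> \<delta>)" using \<gamma> by simp
  have "P \<delta>B \<bullet> \<delta> = R \<delta> \<bullet> \<delta>B + \<delta>B \<bullet> v"
    using inner_commute[of "R \<delta>" \<delta>B]
    by (simp add: v_def blinfun.diff_left inner_diff_right adj_inner)
  then have "- (W v \<bullet> v) / 4 \<le> P \<delta>B \<bullet> \<delta>"
    using inv_cocoercive_perturbed[OF W B, of v "R x" "R x'"]
    by (simp add: \<delta>B_def \<delta>_def blinfun.diff_right)
  then have "\<gamma> * (- (W v \<bullet> v) / 4) \<le> \<gamma> * (P \<delta>B \<bullet> \<delta>)" using \<gamma> by (intro mult_left_mono) auto
  then have 2: "- (Theta_I P R W \<gamma> \<delta> \<bullet> \<delta>) \<le> \<gamma> * (P \<delta>B \<bullet> \<delta>)"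
    by (simp add: Theta_I_inner v_def)
  show ?thesis
    using 1 2 eq by (simp add: blinfun.diff_left inner_diff_left symm_part_quadratic flip: \<delta>_def)
qed

lemma schur22_props:
  fixes V :: "'h::{real_inner,complete_space} \<Rightarrow>\<^sub>L 'h"
  assumes \<Omega>: "subspace \<Omega>" "closed \<Omega>" and V: "selfadjoint V" "closed (range (blk22 \<Omega> V))"
  shows "selfadjoint (schur22 \<Omega> V)" "x \<in> \<Omega>\<^sup>\<bottom> \<Longrightarrow> schur22 \<Omega> V x = 0"
    and "positive_op (blk22 \<Omega> V) \<Longrightarrow> range (blk21 \<Omega> V) \<subseteq> range (blk22 \<Omega> V) \<Longrightarrow>
      schur22 \<Omega> V y \<bullet> y \<le> V y \<bullet> y"
proof -
  have \<Omega>': "subspace (\<Omega>\<^sup>\<bottom>)" "closed (\<Omega>\<^sup>\<bottom>)" by (rule subspace_orthogonal_comp closed_orthogonal_comp)+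
  have b: "blk11 (\<Omega>\<^sup>\<bottom>) V = blk22 \<Omega> V" "blk12 (\<Omega>\<^sup>\<bottom>) V = blk21 \<Omega> V"
    by (simp_all add: blk11_def blk12_def blk21_def blk22_def orthogonal_comp_comp[OF \<Omega>])
  note s = schur22_eq_schur11[OF \<Omega> V(1)]
  show "selfadjoint (schur22 \<Omega> V)" unfolding s by (rule schur11_selfadjoint[OF \<Omega>' V(1)]) (simp add: b V(2))
  show "x \<in> \<Omega>\<^sup>\<bottom> \<Longrightarrow> schur22 \<Omega> V x = 0" unfolding s by (rule schur11_vanishes[OF \<Omega>' V(1)])
  show "positive_op (blk22 \<Omega> V) \<Longrightarrow> range (blk21 \<Omega> V) \<subseteq> range (blk22 \<Omega> V) \<Longrightarrow>
      schur22 \<Omega> V y \<bullet> y \<le> V y \<bullet> y"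
    unfolding s by (rule schur11_le[OF \<Omega>' V(1)]) (simp_all add: b V(2))
qed

text \<open>
The Schur complement \<open>V / V\<^sub>2\<^sub>2\<close> vanishes on \<open>\<Omega>\<^sup>\<bottom>\<close>, which contains \<open>w - w' = \<gamma> e + L \<delta>\<close>; so its form at
\<open>\<gamma> e\<close>, where \<open>e\<close> is the difference of the values of \<open>A\<close>, equals its form at \<open>L \<delta>\<close>.
\<close>

lemma monotone_estimate_semimonotone:
  fixes L :: "'h::{real_inner,complete_space} \<Rightarrow>\<^sub>L 'h"
  assumes \<gamma>: "\<gamma> > 0" and A: "semimonotone U V A"
    and \<Omega>: "subspace \<Omega>" "closed \<Omega>"
    and V: "selfadjoint V" "closed (range (blk22 \<Omega> V))" "positive_op (blk22 \<Omega> V)"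
      "range (blk21 \<Omega> V) \<subseteq> range (blk22 \<Omega> V)"
    and w: "w \<in> \<Omega>\<^sup>\<bottom>" "w' \<in> \<Omega>\<^sup>\<bottom>"
    and x: "x \<in> Phi A (\<lambda>_. 0) P R L q \<gamma> w" and x': "x' \<in> Phi A (\<lambda>_. 0) P R L q \<gamma> w'"
  shows "\<gamma> * (U (x - x') \<bullet> (x - x')) + (symm_part L - Theta_II \<Omega> L V \<gamma>) (x - x') \<bullet> (x - x')
    \<le> (w - w') \<bullet> (x - x')"
proof -
  obtain a where a: "a \<in> A x" "w + q = \<gamma> *\<^sub>R a + L x"
    using x by (auto simp: Phi_def)
  obtain a' where a': "a' \<in> A x'" "w' + q = \<gamma> *\<^sub>R a' + L x'"
    using x' by (auto simp: Phi_def)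
  define \<delta> where "\<delta> = x - x'"
  define e where "e = a - a'"
  let ?S = "schur22 \<Omega> V"
  note S = schur22_props[OF \<Omega> V(1,2)]
  have ww: "w - w' = \<gamma> *\<^sub>R e + L \<delta>"
    using arg_cong2[OF a(2) a'(2), of "(-)"]
    by (simp add: e_def \<delta>_def blinfun.diff_right algebra_simps)
  have "w - w' \<in> \<Omega>\<^sup>\<bottom>" using w subspace_diff subspace_orthogonal_comp by blast
  then have "?S (\<gamma> *\<^sub>R e + L \<delta>) = 0" using S(2) ww by simp
  then have Se: "\<gamma> *\<^sub>R ?S e = - ?S (L \<delta>)"
    by (simp add: blinfun.add_right blinfun.scaleR_right eq_neg_iff_add_eq_0)
  have "\<gamma>\<^sup>2 * (?S e \<bullet> e) = (\<gamma> *\<^sub>R ?S e) \<bullet> (\<gamma> *\<^sub>R e)" by (simp add: power2_eq_square)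
  also have "\<dots> = - (L \<delta> \<bullet> (\<gamma> *\<^sub>R ?S e))"
    by (simp only: Se inner_minus_left inner_minus_right minus_minus selfadjointD[OF S(1)]
        blinfun.scaleR_right)
  also have "\<dots> = L \<delta> \<bullet> ?S (L \<delta>)" by (simp only: Se inner_minus_right minus_minus)
  finally have "\<gamma> * (?S e \<bullet> e) = - (Theta_II \<Omega> L V \<gamma> \<delta> \<bullet> \<delta>)"
    using \<gamma> by (simp add: Theta_II_inner selfadjointD[OF S(1)] field_simps power2_eq_square)
  moreover have "\<gamma> * (?S e \<bullet> e) \<le> \<gamma> * (V e \<bullet> e)" using S(3)[OF V(3,4)] \<gamma> by simp
  moreover have "U \<delta> \<bullet> \<delta> + V e \<bullet> e \<le> e \<bullet> \<delta>"
    using A a(1) a'(1) unfolding semimonotone_def gra_def \<delta>_def e_def by (fastforce simp: inner_commute)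
  then have "\<gamma> * (U \<delta> \<bullet> \<delta> + V e \<bullet> e) \<le> \<gamma> * (e \<bullet> \<delta>)" using \<gamma> by simp
  ultimately show ?thesis
    unfolding \<delta>_def[symmetric] ww
    by (simp add: blinfun.diff_left inner_diff_left inner_add_left symm_part_quadratic algebra_simps)
qed

section \<open>Convergence of the dual and primal sequences\<close>

theorem theorem3p5:
  fixes A :: "'h::{real_inner, complete_space} \<Rightarrow> 'h set"
    and B :: "'k::{real_inner, complete_space} \<Rightarrow> 'k"
    and P :: "'k \<Rightarrow>\<^sub>L 'h" and R :: "'h \<Rightarrow>\<^sub>L 'k"
    and M :: "'g::{real_inner, complete_space} \<Rightarrow>\<^sub>L 'h" and b :: 'g
    and L :: "'h \<Rightarrow>\<^sub>L 'h" and q :: 'h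
    and U V X :: "'h \<Rightarrow>\<^sub>L 'h" and W :: "'k \<Rightarrow>\<^sub>L 'k"
    and \<Omega> \<Omega>b S :: "'h set"
    and \<Theta> :: "real \<Rightarrow> 'h \<Rightarrow>\<^sub>L 'h"
    and \<gamma> :: real and \<beta> :: ereal and lam :: "nat \<Rightarrow> real"
    and x :: "nat \<Rightarrow> 'h" and z :: "nat \<Rightarrow> 'g" and z0 :: 'g
  defines "\<Omega> \<equiv> ker (adj M)"
    and "\<Omega>b \<equiv> {y. adj M y = b}"
    and "S \<equiv> zer (incl_op A B P R M b)"
    and "X \<equiv> schur11 \<Omega> U"
    and "\<beta> \<equiv> step_bound (Xi_hat L \<Theta> X \<gamma>) M"
  assumes solvable: "S \<noteq> {}"
    and A1: "selfadjoint U" "selfadjoint V" "semimonotone U V A"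
    and A2: "selfadjoint W" "strongly_monotone_on UNIV W" "inv_cocoercive W B"
    and A3: "\<Omega> \<subseteq> ker (adj P - R)"
    and A4: "closed (range M)"
    and B1: "L ` \<Omega> \<subseteq> \<Omega>\<^sup>\<bottom>" "\<exists>xbar\<in>\<Omega>b. L xbar - q \<in> \<Omega>\<^sup>\<bottom>"
    and B2: "ker (symm_part L) = \<Omega>" "strongly_monotone_on (\<Omega>\<^sup>\<bottom>) (symm_part L)"
    and C1: "U = 0 \<or> strongly_monotone_on \<Omega> (blk11 \<Omega> U)"
    and C2: "(V = 0 \<and> \<Theta> = Theta_I P R W) \<or>
             (B = (\<lambda>_. 0) \<and> positive_op (blk22 \<Omega> V) \<and> closed (range (blk22 \<Omega> V)) \<and>
              range (blk21 \<Omega> V) \<subseteq> range (blk22 \<Omega> V) \<and> \<Theta> = Theta_II \<Omega> L V)"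
    and gam: "\<gamma> \<in> Lambda_set A B P R L q \<Omega> \<inter> Gamma_set L \<Theta> X"
    and lam_range: "\<And>k. 0 \<le> lam k" "\<And>k. ereal (lam k) \<le> 2 * \<beta>"
    and lam_sum: "(\<Sum>k. ereal (lam k) * (2 * \<beta> - ereal (lam k))) = \<infinity>"
    and z_init: "z 0 = z0"
    and x_step: "\<And>k. Phi A B P R L q \<gamma> (M (z k)) = {x k}"
    and z_step: "\<And>k. z (Suc k) = z k - lam k *\<^sub>R (adj M (x k) - b)"
  shows "(bounded (range z) \<and>
          (\<exists>zstar \<in> zer (Psi A B P R L q M b \<gamma>). weakly_converges z zstar) \<and>
          (\<forall>k. Psi A B P R L q M b \<gamma> (z k) = {adj M (x k) - b}) \<and>
          (\<lambda>k. adj M (x k) - b) \<longlonglongrightarrow> 0) \<and>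
         (maximally_comonotone V A \<and> U = 0 \<and> bounded (range x) \<longrightarrow>
          (\<exists>xstar\<in>S. weakly_converges x xstar)) \<and>
         (strongly_monotone_on \<Omega> U \<longrightarrow> (\<exists>xstar\<in>S. x \<longlonglongrightarrow> xstar))"
proof -
  have \<Omega>: "subspace \<Omega>" "closed \<Omega>" unfolding \<Omega>_def by (rule ker_subspace ker_closed)+
  have \<gamma>: "\<gamma> > 0" using gam by (simp add: Gamma_set_def)
  have U11: "closed (range (blk11 \<Omega> U))" "positive_op (blk11 \<Omega> U)"
    "range (blk12 \<Omega> U) \<subseteq> range (blk11 \<Omega> U)"
  proof -
    have "closed (range (blk11 \<Omega> U)) \<and> positive_op (blk11 \<Omega> U) \<and>
        range (blk12 \<Omega> U) \<subseteq> range (blk11 \<Omega> U)"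
      using C1
    proof
      assume "U = 0"
      then have "blk11 \<Omega> U = 0" "blk12 \<Omega> U = 0" by (simp_all add: blk11_def blk12_def)
      then show ?thesis by (simp add: positive_op_def image_constant_conv)
    next
      assume "strongly_monotone_on \<Omega> (blk11 \<Omega> U)"
      note blk11_strongly_monotone[OF \<Omega> A1(1) this]
      moreover have "range (blk12 \<Omega> U) \<subseteq> \<Omega>"
        by (auto simp: blk_apply[OF \<Omega> A1(1)] proj_in[OF \<Omega>])
      ultimately show ?thesis by blast
    qed
    then show "closed (range (blk11 \<Omega> U))" "positive_op (blk11 \<Omega> U)"
      "range (blk12 \<Omega> U) \<subseteq> range (blk11 \<Omega> U)" by auto
  qed
  have X: "selfadjoint X" "\<And>y. y \<in> \<Omega> \<Longrightarrow> X y = 0" "\<And>y. X y \<bullet> y \<le> U y \<bullet> y"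
    unfolding X_def
    by (rule schur11_selfadjoint[OF \<Omega> A1(1) U11(1)], rule schur11_vanishes[OF \<Omega> A1(1)], assumption,
        rule schur11_le[OF \<Omega> A1(1) U11])
  have \<Theta>: "selfadjoint (\<Theta> \<gamma>)" "\<And>y. y \<in> \<Omega> \<Longrightarrow> \<Theta> \<gamma> y = 0"
  proof -
    have "selfadjoint (\<Theta> \<gamma>) \<and> (\<forall>y\<in>\<Omega>. \<Theta> \<gamma> y = 0)"
      using C2
    proof (elim disjE conjE)
      assume "V = 0" and t: "\<Theta> = Theta_I P R W"
      have "Theta_I P R W \<gamma> y = 0" if "y \<in> \<Omega>" for y
      proof -
        have "(adj P - R) y = 0" using A3 that by (auto simp: ker_def)
        then have "Theta_I P R W \<gamma> y \<bullet> u = 0" for u by (simp add: Theta_I_inner)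
        then show ?thesis by (metis inner_eq_zero_iff)
      qed
      then show ?thesis by (simp add: t Theta_I_selfadjoint[OF A2(1)])
    next
      assume t: "\<Theta> = Theta_II \<Omega> L V" and cl: "closed (range (blk22 \<Omega> V))"
      note S = schur22_props[OF \<Omega> A1(2) cl]
      have "Theta_II \<Omega> L V \<gamma> y = 0" if "y \<in> \<Omega>" for y
      proof -
        have "L y \<in> \<Omega>\<^sup>\<bottom>" using B1(1) that by blast
        then have "Theta_II \<Omega> L V \<gamma> y \<bullet> u = 0" for u by (simp add: Theta_II_inner S(2))
        then show ?thesis by (metis inner_eq_zero_iff)
      qed
      moreover have "selfadjoint (Theta_II \<Omega> L V \<gamma>)"
        unfolding selfadjoint_iff by (metis Theta_II_inner inner_commute selfadjointD[OF S(1)])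
      ultimately show ?thesis by (simp add: t)
    qed
    then show "selfadjoint (\<Theta> \<gamma>)" "\<And>y. y \<in> \<Omega> \<Longrightarrow> \<Theta> \<gamma> y = 0" by auto
  qed
  define \<Xi> where "\<Xi> = Xi_hat L \<Theta> X \<gamma>"
  define Q where "Q = symm_part L - \<Theta> \<gamma>"
  have \<Xi>_diff: "\<Xi> = symm_part L - (\<Theta> \<gamma> - \<gamma> *\<^sub>R X)" by (simp add: \<Xi>_def Xi_hat_def)
  have Ls0: "symm_part L y = 0" if "y \<in> \<Omega>" for y using B2(1) that by (auto simp: ker_def)
  note Ls = symm_part_selfadjoint[of L]
  have D: "selfadjoint (\<Theta> \<gamma> - \<gamma> *\<^sub>R X)" "\<And>y. y \<in> \<Omega> \<Longrightarrow> (\<Theta> \<gamma> - \<gamma> *\<^sub>R X) y = 0"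
    by (simp_all add: selfadjoint_iff blinfun.diff_left blinfun.scaleR_left inner_diff_left inner_diff_right
        selfadjointD[OF X(1)] selfadjointD[OF \<Theta>(1)] X(2) \<Theta>(2))
  have \<Xi>: "selfadjoint \<Xi>" "\<And>y. y \<in> \<Omega> \<Longrightarrow> \<Xi> y = 0"
    using D by (simp_all add: \<Xi>_diff selfadjoint_iff blinfun.diff_left[of "symm_part L"] inner_diff_left inner_diff_right
        selfadjointD[OF Ls] Ls0)
  have Q: "selfadjoint Q" "\<And>y. y \<in> \<Omega> \<Longrightarrow> Q y = 0"
    by (simp_all add: Q_def selfadjoint_iff blinfun.diff_left inner_diff_left inner_diff_right
        selfadjointD[OF Ls] selfadjointD[OF \<Theta>(1)] Ls0 \<Theta>(2))
  have less: "lambda_max (mp_inverse (sqrt_op (symm_part L)) o\<^sub>L (\<Theta> \<gamma> - \<gamma> *\<^sub>R X)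
      o\<^sub>L mp_inverse (sqrt_op (symm_part L))) < 1"
    using gam by (simp add: Gamma_set_def)
  obtain c where c: "c > 0" "\<And>y. c * (norm (y - proj \<Omega> y))\<^sup>2 \<le> \<Xi> y \<bullet> y"
    using lambda_max_less_1_imp_strongly_monotone[OF Ls _ D(1) _ less] B2 D(2)
    unfolding \<Xi>_diff by metis
  have estimate: "\<gamma> * (U (y - y') \<bullet> (y - y')) + Q (y - y') \<bullet> (y - y') \<le> (w - w') \<bullet> (y - y')"
    if "w \<in> \<Omega>\<^sup>\<bottom>" "w' \<in> \<Omega>\<^sup>\<bottom>" "y \<in> Phi A B P R L q \<gamma> w" "y' \<in> Phi A B P R L q \<gamma> w'" for w w' y y'
    using C2
  proof (elim disjE conjE)
    assume "V = 0" "\<Theta> = Theta_I P R W"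
    then show ?thesis
      using monotone_estimate_cocoercive[OF \<gamma> _ A2 that(3,4), of U] A1(3) by (simp add: Q_def)
  next
    assume h: "\<Theta> = Theta_II \<Omega> L V" "B = (\<lambda>_. 0)" "closed (range (blk22 \<Omega> V))"
      "positive_op (blk22 \<Omega> V)" "range (blk21 \<Omega> V) \<subseteq> range (blk22 \<Omega> V)"
    show ?thesis
      using monotone_estimate_semimonotone[OF \<gamma> A1(3) \<Omega> A1(2) h(3,4,5) that(1,2)] that(3,4)
      by (simp add: Q_def h(1,2))
  qed
  interpret warped_resolvent A B P R M b L q \<gamma> U Q \<Xi> c
  proof
    show "\<exists>!y. y \<in> Phi A B P R L q \<gamma> w" if "w \<in> (ker (adj M))\<^sup>\<bottom>" for w
      using gam that by (simp add: Lambda_set_def \<Omega>_def)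
    show "\<exists>xbar. adj M xbar = b \<and> L xbar - q \<in> (ker (adj M))\<^sup>\<bottom>"
      using B1(2) by (auto simp: \<Omega>b_def \<Omega>_def)
    show "\<Xi> y \<bullet> y \<le> \<gamma> * (U y \<bullet> y) + Q y \<bullet> y" for y
      using X(3)[of y] \<gamma>
      by (simp add: \<Xi>_def Xi_hat_def Q_def blinfun.add_left blinfun.diff_left blinfun.scaleR_left
          inner_add_left inner_diff_left)
  qed (use A4 \<gamma> B1(1) \<Xi> c estimate in \<open>simp_all add: \<Omega>_def\<close>)
  have x_eq: "x k = J (M (z k))" for k by (rule J_eq[OF M_in, symmetric]) (simp add: x_step)
  then have F_eq: "F (z k) = adj M (x k) - b" for k by (simp add: F_def)
  have "bounded (range z) \<and> (\<exists>zs. F zs = 0 \<and> weakly_converges z zs) \<and> (\<lambda>k. F (z k)) \<longlonglongrightarrow> 0"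
  proof (rule dual_iteration)
    show "zer (incl_op A B P R M b) \<noteq> {}" using solvable by (simp add: S_def)
    show "ereal (lam k) \<le> 2 * step_bound \<Xi> M" for k using lam_range(2) by (simp add: \<beta>_def \<Xi>_def)
    show "(\<Sum>k. ereal (lam k) * (2 * step_bound \<Xi> M - ereal (lam k))) = \<infinity>"
      using lam_sum by (simp add: \<beta>_def \<Xi>_def)
    show "z (Suc k) = z k - lam k *\<^sub>R F (z k)" for k by (simp add: z_step F_eq)
  qed (rule lam_range(1))
  then obtain zs where zs: "bounded (range z)" "F zs = 0" "weakly_converges z zs" "(\<lambda>k. F (z k)) \<longlonglongrightarrow> 0"
    by blast
  have sol: "J (M zs) \<in> S" unfolding S_def by (rule residual_zero_imp_solution[OF zs(2)])
  have zer: "zs \<in> zer (Psi A B P R L q M b \<gamma>)"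
    using zs(2) J_in[OF M_in, of zs] by (auto simp: zer_def Psi_def F_def)
  have weak: "weakly_converges x (J (M zs))"
    if h: "maximally_comonotone V A" "U = 0" "bounded (range x)"
  proof -
    obtain \<omega> where \<omega>: "\<omega> > 0" "\<And>u v. \<omega> * (norm (B u - B v))\<^sup>2 \<le> (u - v) \<bullet> (B u - B v)"
      using inv_cocoercive_lower[OF A2] by blast
    have Lpos: "positive_op (symm_part L)"
    proof -
      obtain \<alpha> where \<alpha>: "\<alpha> > 0" "\<And>y. y \<in> \<Omega>\<^sup>\<bottom> \<Longrightarrow> \<alpha> * (norm y)\<^sup>2 \<le> symm_part L y \<bullet> y"
        using B2(2) unfolding strongly_monotone_on_def by blast
      have "0 \<le> symm_part L y \<bullet> y" for y
      proof -
        have "0 \<le> \<alpha> * (norm (y - proj \<Omega> y))\<^sup>2" using \<alpha>(1) by simp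
        also have "\<dots> \<le> symm_part L y \<bullet> y"
          using \<alpha>(2)[OF proj_residual[OF \<Omega>, of y]] vanishing_quadratic[OF \<Omega> Ls0 Ls, of y] by simp
        finally show ?thesis .
      qed
      then show ?thesis by (simp add: positive_op_def)
    qed
    have BV: "(\<lambda>k. B (R (J (M (z k))))) \<longlonglongrightarrow> B (R (J (M zs))) \<and> positive_op (blk22 \<Omega> V)"
      using C2
    proof (elim disjE conjE)
      assume V: "V = 0"
      then have "positive_op (blk22 \<Omega> V)" by (simp add: positive_op_def blk22_def)
      moreover have "semimonotone 0 0 A" using A1(3) V h(2) by simp
      ultimately show ?thesis
        using forward_operator_converges[OF zs(3,4,2) _ Lpos _ \<omega>] A3 unfolding \<Omega>_def by blast
    qed simp
    have "weakly_converges (\<lambda>k. J (M (z k))) (J (M zs))"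
    proof (rule weak_convergence[OF zs(3,4,2) h(1)])
      show "bounded (range (\<lambda>k. J (M (z k))))" using h(3) by (simp flip: x_eq)
    qed (use BV B2(1) A1(2) \<omega> in \<open>auto simp: \<Omega>_def\<close>)
    then show ?thesis by (simp flip: x_eq)
  qed
  have strong: "x \<longlonglongrightarrow> J (M zs)" if "strongly_monotone_on \<Omega> U"
    using strong_convergence[OF zs(3,4,2) A1(1) _ Q(1)] Q(2) that
    by (simp add: \<Omega>_def flip: x_eq)
  show ?thesis
    using zs zer sol weak strong by (auto simp: F_eq Psi_def x_step)
qed

end
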